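(* Let $\mathfrak A$ be admissible for a topological dynamical system $(\Omega,T)$, let $W\in\mathfrak A$ be real-valued and continuous, and let $V\in C^\omega(\mathbb T,\mathbb R)$ be non-constant. For every fixed $E\in\mathbb R$ and $|\varepsilon|$ sufficiently small, $$\sup_{\theta\in\Omega}\widehat\delta\Big(\widetilde{\mathcal E}^{\,l}_{\varepsilon,c}(\theta),\ \mathcal M^c_{V,E,\varepsilon}(\theta)\Big)\longrightarrow0\qquad(l\to\infty)$$ in the gap topology of closed subspaces of $\mathcal X_\xi$.
   Context: $\Omega$ is a compact metric space, $T$ a homeomorphism. $\mathfrak A$ (a complex unital Banach algebra of functions on $\Omega$) is admissible if $f\mapsto f\circ T$ is an isometric automorphism of $\mathfrak A$, $\|f\|_\infty\le\|f\|_{\mathfrak A}$, and $1/f\in\mathfrak A$ whenever $f\in\mathfrak A$, $\inf|f|>0$. $V$ is identified via $z=e^{2\pi i x}$ with $V(z)=\sum_n\widehat v_nz^n$, analytic in $\{e^{-h}<|z|<e^h\}$; fix $0<\xi<h$; $V_l(z)=\sum_{|n|\le l}\widehat v_nz^n$. $\mathcal X_\xi=\{u=(u_n)_{n\in\mathbb Z}:\|u\|_\xi=\sum_n|u_n|e^{-\xi|n|}<\infty\}$, $(Su)_n=u_{n+1}$, $(\mathbf L_{V,\varepsilon W,T,\theta}u)_n=\sum_k\widehat v_ku_{n+k}+\varepsilon W(T^n\theta)u_n$. Choose $e^{-\xi}<r_-<1<r_+<e^\xi$ such that the only zeros of $V(z)-E$ in $r_-\le|z|\le r_+$ lie on $|z|=1$.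 For small $\varepsilon$, the canonical center bundle has fibers $$\mathcal M^c_{V,E,\varepsilon}(\theta)=\{u\in\mathcal X_\xi:\mathbf L_{V,\varepsilon W,T,\theta}u=Eu,\ \sup_{n\ge0}r_+^{-n}\|S^nu\|_\xi<\infty,\ \sup_{n\ge0}r_-^n\|S^{-n}u\|_\xi<\infty\}.$$ For finite $l$ with $\widehat v_l\ne0$, the companion cocycle $A^l_\varepsilon(E,\theta)$ is the $2l\times2l$ matrix with first row entries $-\widehat v_{l-j}/\widehat v_l$ in column $j\in\{1,\dots,2l\}\setminus\{l\}$ and $(E-\widehat v_0-\varepsilon W(\theta))/\widehat v_l$ in column $l$, entries $1$ at positions $(i+1,i)$, $1\le i\le 2l-1$, and $0$ elsewhere; it maps $(u_{n+l-1},\dots,u_{n-l})^\top$ to $(u_{n+l},\dots,u_{n-l+1})^\top$ for solutions of $\mathbf L_{V_l,\varepsilon W,T,\theta}u=Eu$ (at $\theta$ replaced by $T^n\theta$). Its iterates are $(A^l_\varepsilon)_n(E,\theta)=A^l_\varepsilon(E,T^{n-1}\theta)\cdots A^l_\varepsilon(E,\theta)$ and $(A^l_\varepsilon)_{-n}(E,\theta)=(A_\varepsilon^l)_n(E,T^{-n}\theta)^{-1}$. For $|\varepsilon|$ small (uniformly in large $l$) it is partially hyperbolic, and its center subspace $\mathcal E^l_{\varepsilon,c}(\theta)\subset\mathbb C^{2l}$ is the set of $v\in\mathbb C^{2l}$ with $\sup_{n\ge0}r_+^{-n}\|(A^l_\varepsilon)_n(E,\theta)v\|<\infty$ and $\sup_{n\ge0}r_-^n\|(A^l_\varepsilon)_{-n}(E,\theta)v\|<\infty$.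 Labelling coordinates of $v\in\mathbb C^{2l}$ as $v=(v_{l-1},\dots,v_{-l})^\top$, let $\iota_l:\mathbb C^{2l}\to\mathcal X_\xi$ be extension by zero, $(\iota_lv)_j=v_j$ for $-l\le j\le l-1$ and $0$ otherwise, and $\widetilde{\mathcal E}^{\,l}_{\varepsilon,c}(\theta)=\iota_l\mathcal E^l_{\varepsilon,c}(\theta)$. For closed subspaces $M,N$ of a Banach space: $\delta(M,N)=\sup_{u\in M,\|u\|=1}\operatorname{dist}(u,N)$ and $\widehat\delta(M,N)=\max\{\delta(M,N),\delta(N,M)\}$. The limit $l\to\infty$ is along those $l$ with $\widehat v_l\neq0$ (if $V$ is a trigonometric polynomial the statement is vacuous). *)

theory Defs
  imports
    "HOL-Analysis.Analysis"
    "Jordan_Normal_Form.Gauss_Jordan_Elimination"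
begin

subsection \<open>Dynamics and admissible algebras\<close>

definition topological_dynamical_system :: "('w::metric_space \<Rightarrow> 'w) \<Rightarrow> bool" where
  "topological_dynamical_system T \<longleftrightarrow>
     compact (UNIV :: 'w set) \<and> homeomorphism UNIV UNIV T (inv_into UNIV T)"

definition ipow :: "('w \<Rightarrow> 'w) \<Rightarrow> int \<Rightarrow> 'w \<Rightarrow> 'w" where
  "ipow T n = (if 0 \<le> n then T ^^ nat n else inv_into UNIV T ^^ nat (- n))"

text \<open>A complex unital Banach algebra of functions, given by its carrier \<open>A\<close> and its norm \<open>N\<close>;
  values of \<open>N\<close> outside \<open>A\<close> are irrelevant.\<close>

definition function_banach_algebra ::
    "('w \<Rightarrow> complex) set \<Rightarrow> (('w \<Rightarrow> complex) \<Rightarrow> real) \<Rightarrow> bool" where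
  "function_banach_algebra A N \<longleftrightarrow>
     (\<lambda>_. 1) \<in> A \<and>
     (\<forall>f\<in>A. \<forall>g\<in>A. (\<lambda>x. f x + g x) \<in> A) \<and>
     (\<forall>c. \<forall>f\<in>A. (\<lambda>x. c * f x) \<in> A) \<and>
     (\<forall>f\<in>A. \<forall>g\<in>A. (\<lambda>x. f x * g x) \<in> A) \<and>
     (\<forall>f\<in>A. 0 \<le> N f) \<and>
     (\<forall>f\<in>A. N f = 0 \<longleftrightarrow> f = (\<lambda>_. 0)) \<and>
     (\<forall>c. \<forall>f\<in>A. N (\<lambda>x. c * f x) = cmod c * N f) \<and>
     (\<forall>f\<in>A. \<forall>g\<in>A. N (\<lambda>x. f x + g x) \<le> N f + N g) \<and>
     (\<forall>f\<in>A. \<forall>g\<in>A. N (\<lambda>x. f x * g x) \<le> N f * N g) \<and>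
     N (\<lambda>_. 1) = 1 \<and>
     (\<forall>F :: nat \<Rightarrow> 'w \<Rightarrow> complex.
        (\<forall>n. F n \<in> A) \<and>
        (\<forall>e>0. \<exists>M. \<forall>m\<ge>M. \<forall>n\<ge>M. N (\<lambda>x. F m x - F n x) < e) \<longrightarrow>
        (\<exists>f\<in>A. (\<lambda>n. N (\<lambda>x. F n x - f x)) \<longlonglongrightarrow> 0))"

text \<open>Composition with \<open>T\<close> is automatically a unital algebra homomorphism and injective (\<open>T\<close> is
  onto), so being an isometric automorphism amounts to mapping \<open>A\<close> onto itself isometrically.\<close>

definition admissible ::
    "('w::metric_space \<Rightarrow> 'w) \<Rightarrow> ('w \<Rightarrow> complex) set \<Rightarrow> (('w \<Rightarrow> complex) \<Rightarrow> real) \<Rightarrow> bool" where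
  "admissible T A N \<longleftrightarrow>
     function_banach_algebra A N \<and>
     (\<lambda>f. f \<circ> T) ` A = A \<and>
     (\<forall>f\<in>A. N (f \<circ> T) = N f) \<and>
     (\<forall>f\<in>A. \<forall>x. cmod (f x) \<le> N f) \<and>
     (\<forall>f\<in>A. 0 < (INF x. cmod (f x)) \<longrightarrow> (\<lambda>x. 1 / f x) \<in> A)"

subsection \<open>The symbol\<close>

definition real_analytic_circle :: "(real \<Rightarrow> real) \<Rightarrow> bool" where
  "real_analytic_circle V \<longleftrightarrow>
     (\<forall>x. V (x + 1) = V x) \<and>
     (\<forall>x0. \<exists>r>0. \<exists>a. \<forall>x. \<bar>x - x0\<bar> < r \<longrightarrow> (\<lambda>n. a n * (x - x0) ^ n) sums V x)"

definition annulus :: "real \<Rightarrow> complex set" where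
  "annulus h = {z. exp (- h) < cmod z \<and> cmod z < exp h}"

definition extends_to_annulus :: "(real \<Rightarrow> real) \<Rightarrow> real \<Rightarrow> bool" where
  "extends_to_annulus V h \<longleftrightarrow>
     (\<exists>F. F holomorphic_on annulus h \<and> (\<forall>x. F (cis (2 * pi * x)) = of_real (V x)))"

definition fourier_coeff :: "(real \<Rightarrow> real) \<Rightarrow> int \<Rightarrow> complex" where
  "fourier_coeff V n =
     integral {0..1} (\<lambda>x. of_real (V x) * cis (- (2 * pi * of_int n * x)))"

text \<open>The Laurent series converges absolutely on \<open>annulus h\<close> whenever \<open>extends_to_annulus V h\<close>.\<close>

definition symbol :: "(real \<Rightarrow> real) \<Rightarrow> complex \<Rightarrow> complex" where
  "symbol V z = (\<Sum>\<^sub>\<infinity>n\<in>UNIV. fourier_coeff V n * z powi n)"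

subsection \<open>The weighted sequence space and the canonical center bundle\<close>

definition X_space :: "real \<Rightarrow> (int \<Rightarrow> complex) set" where
  "X_space \<xi> = {u. (\<lambda>n. cmod (u n) * exp (- \<xi> * of_int \<bar>n\<bar>)) summable_on UNIV}"

definition X_norm :: "real \<Rightarrow> (int \<Rightarrow> complex) \<Rightarrow> real" where
  "X_norm \<xi> u = (\<Sum>\<^sub>\<infinity>n\<in>UNIV. cmod (u n) * exp (- \<xi> * of_int \<bar>n\<bar>))"

text \<open>\<open>shift m\<close> is the \<open>m\<close>-th power of the bilateral shift \<open>u \<mapsto> (\<lambda>n. u (n + 1))\<close>.\<close>

definition shift :: "int \<Rightarrow> (int \<Rightarrow> complex) \<Rightarrow> int \<Rightarrow> complex" where
  "shift m u = (\<lambda>n. u (n + m))"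

definition L_op ::
    "(real \<Rightarrow> real) \<Rightarrow> real \<Rightarrow> ('w \<Rightarrow> real) \<Rightarrow> ('w \<Rightarrow> 'w) \<Rightarrow> 'w \<Rightarrow> (int \<Rightarrow> complex) \<Rightarrow> int \<Rightarrow> complex"
  where
  "L_op V \<epsilon> W T \<theta> u =
     (\<lambda>n. (\<Sum>\<^sub>\<infinity>k\<in>UNIV. fourier_coeff V k * u (n + k)) + of_real (\<epsilon> * W (ipow T n \<theta>)) * u n)"

definition center_bundle ::
    "real \<Rightarrow> real \<Rightarrow> real \<Rightarrow> (real \<Rightarrow> real) \<Rightarrow> ('w \<Rightarrow> real) \<Rightarrow> ('w \<Rightarrow> 'w) \<Rightarrow> real \<Rightarrow> real \<Rightarrow> 'w
      \<Rightarrow> (int \<Rightarrow> complex) set" where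
  "center_bundle \<xi> rm rp V W T E \<epsilon> \<theta> =
     {u \<in> X_space \<xi>.
        L_op V \<epsilon> W T \<theta> u = (\<lambda>n. of_real E * u n) \<and>
        bdd_above (range (\<lambda>n::nat. inverse rp ^ n * X_norm \<xi> (shift (int n) u))) \<and>
        bdd_above (range (\<lambda>n::nat. rm ^ n * X_norm \<xi> (shift (- int n) u)))}"

subsection \<open>The companion cocycle and its center subspace\<close>

text \<open>Matrices of \<^typ>\<open>'a mat\<close> are indexed from 0, the entries below from 1; hence the shift.\<close>

definition companion ::
    "(real \<Rightarrow> real) \<Rightarrow> ('w \<Rightarrow> real) \<Rightarrow> real \<Rightarrow> real \<Rightarrow> nat \<Rightarrow> 'w \<Rightarrow> complex mat" where
  "companion V W E \<epsilon> l \<theta> = mat (2 * l) (2 * l) (\<lambda>(i0, j0).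
     let i = i0 + 1; j = j0 + 1 in
     if i = 1 then
       (if j = l
        then (of_real E - fourier_coeff V 0 - of_real (\<epsilon> * W \<theta>)) / fourier_coeff V (int l)
        else - fourier_coeff V (int l - int j) / fourier_coeff V (int l))
     else if i = j + 1 then 1 else 0)"

primrec companion_iter ::
    "(real \<Rightarrow> real) \<Rightarrow> ('w \<Rightarrow> real) \<Rightarrow> ('w \<Rightarrow> 'w) \<Rightarrow> real \<Rightarrow> real \<Rightarrow> nat \<Rightarrow> nat \<Rightarrow> 'w \<Rightarrow> complex mat"
  where
  "companion_iter V W T E \<epsilon> l 0 \<theta> = 1\<^sub>m (2 * l)"
| "companion_iter V W T E \<epsilon> l (Suc n) \<theta> =
     companion V W E \<epsilon> l ((T ^^ n) \<theta>) * companion_iter V W T E \<epsilon> l n \<theta>"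

text \<open>The matrix inverted below is invertible when \<open>fourier_coeff V (int l) \<noteq> 0\<close> and \<open>l \<ge> 1\<close>,
  because \<open>fourier_coeff V (- int l)\<close> is its complex conjugate.\<close>

definition companion_iter_back ::
    "(real \<Rightarrow> real) \<Rightarrow> ('w \<Rightarrow> real) \<Rightarrow> ('w \<Rightarrow> 'w) \<Rightarrow> real \<Rightarrow> real \<Rightarrow> nat \<Rightarrow> nat \<Rightarrow> 'w \<Rightarrow> complex mat"
  where
  "companion_iter_back V W T E \<epsilon> l n \<theta> =
     the (mat_inverse (companion_iter V W T E \<epsilon> l n (ipow T (- int n) \<theta>)))"

definition cvec_norm :: "complex vec \<Rightarrow> real" where
  "cvec_norm v = L2_set (\<lambda>i. cmod (vec_index v i)) {..<dim_vec v}"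

definition center_subspace ::
    "real \<Rightarrow> real \<Rightarrow> (real \<Rightarrow> real) \<Rightarrow> ('w \<Rightarrow> real) \<Rightarrow> ('w \<Rightarrow> 'w) \<Rightarrow> real \<Rightarrow> real \<Rightarrow> nat \<Rightarrow> 'w
      \<Rightarrow> complex vec set" where
  "center_subspace rm rp V W T E \<epsilon> l \<theta> =
     {v \<in> carrier_vec (2 * l).
        bdd_above (range (\<lambda>n::nat.
          inverse rp ^ n * cvec_norm (companion_iter V W T E \<epsilon> l n \<theta> *\<^sub>v v))) \<and>
        bdd_above (range (\<lambda>n::nat.
          rm ^ n * cvec_norm (companion_iter_back V W T E \<epsilon> l n \<theta> *\<^sub>v v)))}"

text \<open>A vector of length \<open>2 * l\<close> lists the values of a sequence at \<open>l - 1, l - 2, ..., - l\<close>, in this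
  order.\<close>

definition zero_extension :: "nat \<Rightarrow> complex vec \<Rightarrow> int \<Rightarrow> complex" where
  "zero_extension l v =
     (\<lambda>j. if - int l \<le> j \<and> j \<le> int l - 1 then vec_index v (nat (int l - 1 - j)) else 0)"

definition embedded_center ::
    "real \<Rightarrow> real \<Rightarrow> (real \<Rightarrow> real) \<Rightarrow> ('w \<Rightarrow> real) \<Rightarrow> ('w \<Rightarrow> 'w) \<Rightarrow> real \<Rightarrow> real \<Rightarrow> nat \<Rightarrow> 'w
      \<Rightarrow> (int \<Rightarrow> complex) set" where
  "embedded_center rm rp V W T E \<epsilon> l \<theta> =
     zero_extension l ` center_subspace rm rp V W T E \<epsilon> l \<theta>"

subsection \<open>The gap between subspaces of the weighted sequence space\<close>

text \<open>Suprema and infima are taken in \<^typ>\<open>ennreal\<close>, so that they always exist and the supremum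
  over the empty unit sphere of the zero subspace is 0.\<close>

definition X_dist :: "real \<Rightarrow> (int \<Rightarrow> complex) \<Rightarrow> (int \<Rightarrow> complex) set \<Rightarrow> ennreal" where
  "X_dist \<xi> u N = (INF w\<in>N. ennreal (X_norm \<xi> (\<lambda>n. u n - w n)))"

definition one_sided_gap ::
    "real \<Rightarrow> (int \<Rightarrow> complex) set \<Rightarrow> (int \<Rightarrow> complex) set \<Rightarrow> ennreal" where
  "one_sided_gap \<xi> M N = (SUP u\<in>{u \<in> M. X_norm \<xi> u = 1}. X_dist \<xi> u N)"

definition gap :: "real \<Rightarrow> (int \<Rightarrow> complex) set \<Rightarrow> (int \<Rightarrow> complex) set \<Rightarrow> ennreal" where
  "gap \<xi> M N = max (one_sided_gap \<xi> M N) (one_sided_gap \<xi> N M)"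

end

theory Submission
  imports Defs "HOL-Complex_Analysis.Complex_Analysis" "HOL-Real_Asymp.Real_Asymp"
    "Jordan_Normal_Form.Determinant"
begin

text \<open>Solutions in the center bundle are the solutions \<open>u\<close> of \<open>(V(S) - E) u = - \<epsilon> W u\<close>, with \<open>S\<close> the shift,
  that are bounded relative to the weight \<open>rp\<^sup>n\<close> (\<open>n \<ge> 0\<close>), \<open>rm\<^sup>n\<close> (\<open>n < 0\<close>); those of the companion cocycle solve the same
  equation with \<open>V\<close> replaced by its truncation. Dividing the zeros of \<open>V - E\<close> on the unit circle out
  gives \<open>V - E = P G\<close> with \<open>P\<close> a polynomial and \<open>G\<close> zero-free on \<open>rm \<le> |z| \<le> rp\<close>, so \<open>G(S)\<close> is inverted on
  the weighted space by the Laurent coefficients of \<open>1/G\<close>. The recurrence operator \<open>P(S)\<close> has a bounded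
  right inverse there, and \<open>u\<close> is controlled by \<open>P(S) u\<close> and finitely many initial values. Hence, for
  small \<open>\<epsilon>\<close> and a small perturbation of the symbol, weighted norms of solutions are bounded by values on
  a fixed window, and a Neumann series corrects any solution for one symbol to a solution for the other,
  at a distance controlled by the difference of the symbols. All constants are uniform in \<open>\<theta>\<close>.\<close>

section \<open>Weighted sequences and convolution\<close>

text \<open>The obstacle is that the zero extension of a center vector in general satisfies no
  equation: only 2l values of a solution survive, and division by the l-th Fourier coefficient makes
  the companion matrices grow with l. So these matrices are never estimated. They only serve to
  identify center vectors with windows of solutions; everything quantitative is done for whole
  sequences. Unit norm of an extended vector bounds the values at 0, ..., d - 1, with d the number
  of unimodular roots counted with multiplicity, once d \<le> l, and these values recover a bound on
  the uncut solution. Two sizes of a sequence interact: the sup bound relative to the weight, in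
  which solutions are bounded and corrected, and the norm of \<open>X_space \<xi>\<close>, in which
  the gap is measured. Since exp (- \<xi>) < rm and rp < exp \<xi> are strict, a weighted sup bound
  makes the part outside the window [-l, l - 1] small in the second norm. The same tail bounds the
  discarded Fourier coefficients, so a single vanishing quantity controls both errors.\<close>

lemma infsum_diff_complex:
  fixes f g :: "'a \<Rightarrow> complex"
  assumes "f summable_on A" "g summable_on A"
  shows "(\<Sum>\<^sub>\<infinity>x\<in>A. f x - g x) = infsum f A - infsum g A"
  using infsum_add[OF assms(1) summable_on_uminus[THEN iffD2, OF assms(2)]] by (simp add: infsum_uminus)

section \<open>Exponential weights on the integers\<close>

locale growth_rates =
  fixes \<xi> rm rp :: real
  assumes \<xi>_pos: "0 < \<xi>" and rm_gt: "exp (- \<xi>) < rm" and rm_less: "rm < 1"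
    and rp_gt: "1 < rp" and rp_less: "rp < exp \<xi>"
begin

lemma rm_pos: "0 < rm"
  using rm_gt exp_gt_zero[of "- \<xi>"] by linarith

lemma rp_pos: "0 < rp"
  using rp_gt by simp

definition weight :: "int \<Rightarrow> real" where
  "weight n = (if 0 \<le> n then rp powi n else rm powi n)"

text \<open>As rm < 1 < rp, the larger power is that of \<open>rp\<close> for n \<ge> 0 and that of
  \<open>rm\<close> for n < 0. In this form submultiplicativity is inherited from two multiplicative
  functions.\<close>

lemma weight_eq_max: "weight n = max (rp powi n) (rm powi n)"
proof (cases "0 \<le> n")
  case True
  then have "rm powi n \<le> 1" "1 \<le> rp powi n"
    using rm_pos rm_less rp_gt by (auto simp: power_int_def power_le_one one_le_power)
  then show ?thesis using True by (simp add: weight_def)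
next
  case False
  then have "rp powi n \<le> 1" "1 \<le> rm powi n"
    using rm_pos rm_less rp_gt
    by (auto simp: power_int_def power_le_one one_le_power inverse_le_1_iff one_le_inverse_iff)
  then show ?thesis using False by (simp add: weight_def)
qed

lemma weight_of_nat: "weight (int n) = rp ^ n"
  by (simp add: weight_def)

lemma weight_of_minus_nat: "weight (- int n) = inverse (rm ^ n)"
  by (cases n) (auto simp: weight_def power_int_minus simp del: of_nat_Suc)

lemma weight_ge_1: "1 \<le> weight n"
  using rm_pos rm_less rp_gt
  by (auto simp: weight_def power_int_def one_le_power power_le_one one_le_inverse_iff)

lemma weight_pos: "0 < weight n"
  using weight_ge_1[of n] by linarith

lemma weight_add: "weight (m + n) \<le> weight m * weight n"
proof -
  have "rp powi m * rp powi n \<le> weight m * weight n" "rm powi m * rm powi n \<le> weight m * weight n"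
    by (rule mult_mono; use rm_pos rp_pos weight_pos[of m] in \<open>simp add: weight_eq_max\<close>)+
  then have "rp powi (m + n) \<le> weight m * weight n" "rm powi (m + n) \<le> weight m * weight n"
    using rm_pos rp_pos by (simp_all add: power_int_add)
  then show ?thesis by (simp add: weight_eq_max[of "m + n"])
qed

text \<open>Both halves are geometric, with ratios \<open>rp * exp (- \<xi>)\<close> and
  \<open>exp (- \<xi>) / rm\<close>, less than 1 by the strict inequalities between the rates. This
  embeds weight-bounded sequences in \<open>X_space\<close> and makes coefficients of rate \<xi>
  summable against the weight.\<close>

lemma exp_weight_summable: "(\<lambda>n. weight n * exp (- \<xi> * of_int \<bar>n\<bar>)) summable_on UNIV"
proof -
  let ?f = "\<lambda>n::int. weight n * exp (- \<xi> * of_int \<bar>n\<bar>)"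
  have e: "exp (- (\<xi> * real n)) = exp (- \<xi>) ^ n" for n
    by (simp add: exp_of_nat_mult[symmetric] mult.commute)
  have q: "rp * exp (- \<xi>) < 1" "exp (- \<xi>) / rm < 1" "rp * exp (- \<xi>) > 0" "exp (- \<xi>) / rm > 0"
    using rp_less rm_gt rm_pos rp_pos by (auto simp: exp_minus field_simps)
  have "summable (\<lambda>n. norm (?f (int n)))"
  proof -
    have "(\<lambda>n. norm (?f (int n))) = (\<lambda>n. (rp * exp (- \<xi>)) ^ n)"
      by (auto simp: weight_of_nat e power_mult_distrib abs_mult rp_pos less_imp_le)
    then show ?thesis using q by (simp add: summable_geometric_iff)
  qed
  then have "(\<lambda>n::nat. ?f (int n)) summable_on UNIV"
    by (rule norm_summable_imp_summable_on)
  then have 1: "?f summable_on range int"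
    by (subst summable_on_reindex) (auto simp: o_def inj_on_def)
  have "summable (\<lambda>n. norm (?f (- int n)))"
  proof -
    have "(\<lambda>n. norm (?f (- int n))) = (\<lambda>n. (exp (- \<xi>) / rm) ^ n)"
      using rm_pos by (auto simp: weight_of_minus_nat e power_mult_distrib abs_mult power_divide field_simps)
    then show ?thesis using q by (simp add: summable_geometric_iff)
  qed
  then have "(\<lambda>n::nat. ?f (- int n)) summable_on UNIV"
    by (rule norm_summable_imp_summable_on)
  then have 2: "?f summable_on range (\<lambda>n. - int n)"
    by (subst summable_on_reindex) (auto simp: o_def inj_on_def)
  have "range int \<union> range (\<lambda>n. - int n) = UNIV"
    by (auto simp: image_iff) (metis int_cases2)
  then show ?thesis using summable_on_union[OF 1 2] by simp
qed

section \<open>Convolution operators on weight-bounded sequences\<close>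

definition bounded_by :: "real \<Rightarrow> (int \<Rightarrow> complex) \<Rightarrow> bool" where
  "bounded_by C u \<longleftrightarrow> (\<forall>n. cmod (u n) \<le> C * weight n)"

definition wsummable :: "(int \<Rightarrow> complex) \<Rightarrow> bool" where
  "wsummable a \<longleftrightarrow> (\<lambda>k. cmod (a k) * weight k) summable_on UNIV"

definition wnorm :: "(int \<Rightarrow> complex) \<Rightarrow> real" where
  "wnorm a = (\<Sum>\<^sub>\<infinity>k. cmod (a k) * weight k)"

text \<open>The argument n + k, not n - k, makes this the operator a(S) for the forward shift S, in
  agreement with \<open>L_op\<close>; its symbol is the Laurent series of \<open>a\<close>.\<close>

definition conv :: "(int \<Rightarrow> complex) \<Rightarrow> (int \<Rightarrow> complex) \<Rightarrow> int \<Rightarrow> complex" where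
  "conv a u = (\<lambda>n. \<Sum>\<^sub>\<infinity>k. a k * u (n + k))"

lemma bounded_byD: "bounded_by C u \<Longrightarrow> cmod (u n) \<le> C * weight n"
  by (simp add: bounded_by_def)

lemma bounded_by_nonneg: "bounded_by C u \<Longrightarrow> 0 \<le> C"
  using bounded_byD[of C u 0] weight_pos[of 0] norm_ge_zero[of "u 0"]
  by (smt (verit) mult_neg_pos)

lemma bounded_by_mono: "bounded_by C u \<Longrightarrow> C \<le> D \<Longrightarrow> bounded_by D u"
  unfolding bounded_by_def using weight_pos by (meson less_imp_le mult_right_mono order_trans)

lemma bounded_by_add: "bounded_by C u \<Longrightarrow> bounded_by D w \<Longrightarrow> bounded_by (C + D) (\<lambda>n. u n + w n)"
  unfolding bounded_by_def distrib_right by (meson add_mono norm_triangle_le)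

lemma bounded_by_diff: "bounded_by C u \<Longrightarrow> bounded_by D w \<Longrightarrow> bounded_by (C + D) (\<lambda>n. u n - w n)"
  unfolding bounded_by_def distrib_right by (meson add_mono norm_triangle_le_diff)

lemma bounded_by_mult:
  assumes "bounded_by C u" "\<And>n. cmod (c n) \<le> B"
  shows "bounded_by (B * C) (\<lambda>n. c n * u n)"
  unfolding bounded_by_def norm_mult mult.assoc
  by (intro allI mult_mono bounded_byD[OF assms(1)] assms(2) order_trans[OF norm_ge_zero assms(2)]) simp

lemma wnorm_nonneg: "0 \<le> wnorm a"
  unfolding wnorm_def by (intro infsum_nonneg) (simp add: weight_pos less_imp_le)

text \<open>Submultiplicativity of the weight separates the dependence on n from that on k; the
  later bounds on \<open>conv\<close> sum this one over k.\<close>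

lemma conv_term_bound:
  assumes "bounded_by C u"
  shows "cmod (a k * u (n + k)) \<le> C * weight n * (cmod (a k) * weight k)"
proof -
  have "cmod (u (n + k)) \<le> C * weight (n + k)" using assms by (simp add: bounded_byD)
  also have "\<dots> \<le> C * (weight n * weight k)"
    using bounded_by_nonneg[OF assms] weight_add by (rule mult_left_mono[rotated])
  finally have "cmod (a k) * cmod (u (n + k)) \<le> cmod (a k) * (C * (weight n * weight k))"
    by (rule mult_left_mono) simp
  then show ?thesis
    by (simp add: norm_mult mult_ac)
qed

lemma conv_abs_summable:
  assumes "wsummable a" "bounded_by C u"
  shows "(\<lambda>k. cmod (a k * u (n + k))) summable_on UNIV"
proof (rule summable_on_comparison_test)
  show "(\<lambda>k. C * weight n * (cmod (a k) * weight k)) summable_on UNIV"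
    using assms(1) unfolding wsummable_def by (rule summable_on_cmult_right)
qed (auto intro: conv_term_bound[OF assms(2)])

lemma conv_summable:
  assumes "wsummable a" "bounded_by C u"
  shows "(\<lambda>k. a k * u (n + k)) summable_on UNIV"
  using conv_abs_summable[OF assms] by (rule abs_summable_summable)

lemma conv_abs_bound:
  assumes "wsummable a" "bounded_by C u"
  shows "(\<Sum>\<^sub>\<infinity>k. cmod (a k * u (n + k))) \<le> wnorm a * C * weight n"
proof -
  have "(\<Sum>\<^sub>\<infinity>k. cmod (a k * u (n + k))) \<le> (\<Sum>\<^sub>\<infinity>k. C * weight n * (cmod (a k) * weight k))"
  proof (rule infsum_mono[OF conv_abs_summable[OF assms]])
    show "(\<lambda>k. C * weight n * (cmod (a k) * weight k)) summable_on UNIV"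
      using assms(1) unfolding wsummable_def by (rule summable_on_cmult_right)
  qed (rule conv_term_bound[OF assms(2)])
  also have "\<dots> = wnorm a * C * weight n"
    unfolding wnorm_def by (subst infsum_cmult_right') simp
  finally show ?thesis .
qed

lemma bounded_by_conv:
  assumes "wsummable a" "bounded_by C u"
  shows "bounded_by (wnorm a * C) (conv a u)"
  unfolding bounded_by_def conv_def
  using norm_infsum_bound[OF conv_abs_summable[OF assms]] conv_abs_bound[OF assms] order_trans by blast

lemma conv_diff_right:
  assumes "wsummable a" "bounded_by C u" "bounded_by D w"
  shows "conv a (\<lambda>n. u n - w n) = (\<lambda>n. conv a u n - conv a w n)"
  unfolding conv_def right_diff_distrib
  by (intro ext infsum_diff_complex conv_summable[OF assms(1,2)] conv_summable[OF assms(1,3)])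

lemma conv_add_right:
  assumes "wsummable a" "bounded_by C u" "bounded_by D w"
  shows "conv a (\<lambda>n. u n + w n) = (\<lambda>n. conv a u n + conv a w n)"
  unfolding conv_def distrib_left
  by (intro ext infsum_add conv_summable[OF assms(1,2)] conv_summable[OF assms(1,3)])

lemma conv_diff_left:
  assumes "wsummable a" "wsummable b" "bounded_by C u"
  shows "conv (\<lambda>k. a k - b k) u = (\<lambda>n. conv a u n - conv b u n)"
  unfolding conv_def left_diff_distrib
  by (intro ext infsum_diff_complex conv_summable[OF assms(1,3)] conv_summable[OF assms(2,3)])

lemma wsummable_diff:
  assumes "wsummable a" "wsummable b"
  shows "wsummable (\<lambda>k. a k - b k)"
  unfolding wsummable_def
proof (rule summable_on_comparison_test)
  show "(\<lambda>k. cmod (a k) * weight k + cmod (b k) * weight k) summable_on UNIV"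
    using assms unfolding wsummable_def by (rule summable_on_add)
  show "cmod (a k - b k) * weight k \<le> cmod (a k) * weight k + cmod (b k) * weight k" for k
    unfolding distrib_right[symmetric]
    by (intro mult_right_mono norm_triangle_ineq4) (simp add: weight_pos less_imp_le)
qed (simp add: weight_pos less_imp_le)

text \<open>With m = k + j the double sum regroups into the Cauchy product of the coefficients, so
  a(S) b(S) = (ab)(S). The exchange of sums rests on absolute summability: the inner sum over j is
  at most \<open>wnorm b * C * weight (n + k)\<close>.\<close>

lemma conv_conv:
  assumes "wsummable a" "wsummable b" "bounded_by C u"
  shows "conv a (conv b u) = conv (\<lambda>m. \<Sum>\<^sub>\<infinity>k. a k * b (m - k)) u"
proof
  fix n
  have sm0: "(\<lambda>(k, j). cmod (a k * (b j * u (n + k + j)))) summable_on UNIV \<times> UNIV"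
  proof (rule summable_on_SigmaI)
    fix k
    show "((\<lambda>j. case (k, j) of (k, j) \<Rightarrow> cmod (a k * (b j * u (n + k + j)))) has_sum
        cmod (a k) * (\<Sum>\<^sub>\<infinity>j. cmod (b j * u (n + k + j)))) UNIV"
      unfolding norm_mult[of "a k" for k] prod.case
      by (intro has_sum_cmult_right has_sum_infsum conv_abs_summable[OF assms(2,3)])
  next
    show "(\<lambda>k. cmod (a k) * (\<Sum>\<^sub>\<infinity>j. cmod (b j * u (n + k + j)))) summable_on UNIV"
    proof (rule summable_on_comparison_test)
      show "(\<lambda>k. wnorm b * C * weight n * (cmod (a k) * weight k)) summable_on UNIV"
        using assms(1) unfolding wsummable_def by (rule summable_on_cmult_right)
    next
      fix k
      have "(\<Sum>\<^sub>\<infinity>j. cmod (b j * u (n + k + j))) \<le> wnorm b * C * weight (n + k)"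
        using assms by (intro conv_abs_bound)
      also have "\<dots> \<le> wnorm b * C * (weight n * weight k)"
        using wnorm_nonneg bounded_by_nonneg[OF assms(3)] by (intro mult_left_mono weight_add) auto
      finally have "cmod (a k) * (\<Sum>\<^sub>\<infinity>j. cmod (b j * u (n + k + j)))
          \<le> cmod (a k) * (wnorm b * C * (weight n * weight k))"
        by (rule mult_left_mono) simp
      then show "cmod (a k) * (\<Sum>\<^sub>\<infinity>j. cmod (b j * u (n + k + j)))
          \<le> wnorm b * C * weight n * (cmod (a k) * weight k)"
        by (simp add: mult_ac)
    qed (auto intro!: mult_nonneg_nonneg infsum_nonneg)
  qed auto
  then have "(\<lambda>(k, j). a k * (b j * u (n + k + j))) summable_on UNIV \<times> UNIV"
    unfolding case_prod_unfold by (rule abs_summable_summable)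
  then have sm: "(\<lambda>(k, m). a k * b (m - k) * u (n + m)) summable_on UNIV \<times> UNIV"
    by (subst summable_on_reindex_bij_witness[where i = "\<lambda>(k, j). (k, j + k)" and T = "UNIV \<times> UNIV"
          and j = "\<lambda>(k, m). (k, m - k)" and h = "\<lambda>(k, j). a k * (b j * u (n + k + j))"]) auto
  have "conv a (conv b u) n = (\<Sum>\<^sub>\<infinity>k. \<Sum>\<^sub>\<infinity>j. a k * (b j * u (n + k + j)))"
    by (simp add: conv_def infsum_cmult_right')
  also have "\<dots> = (\<Sum>\<^sub>\<infinity>k. \<Sum>\<^sub>\<infinity>m. a k * b (m - k) * u (n + m))"
  proof (rule infsum_cong)
    fix k
    show "(\<Sum>\<^sub>\<infinity>j. a k * (b j * u (n + k + j))) = (\<Sum>\<^sub>\<infinity>m. a k * b (m - k) * u (n + m))"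
      by (rule infsum_reindex_bij_witness[where i = "\<lambda>m. m - k" and j = "\<lambda>j. j + k"])
        (auto simp: add_ac)
  qed
  also have "\<dots> = (\<Sum>\<^sub>\<infinity>m. \<Sum>\<^sub>\<infinity>k. a k * b (m - k) * u (n + m))"
    using sm by (rule infsum_swap_banach)
  also have "\<dots> = conv (\<lambda>m. \<Sum>\<^sub>\<infinity>k. a k * b (m - k)) u n"
    by (simp add: conv_def infsum_cmult_left')
  finally show "conv a (conv b u) n = conv (\<lambda>m. \<Sum>\<^sub>\<infinity>k. a k * b (m - k)) u n" .
qed

end

section \<open>Recurrences with roots on the unit circle\<close>

context growth_rates begin

section \<open>First-order factors S - z and their solution operators\<close>

definition factor_op :: "complex \<Rightarrow> (int \<Rightarrow> complex) \<Rightarrow> int \<Rightarrow> complex" where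
  "factor_op z u = (\<lambda>n. u (n + 1) - z * u n)"

primrec factors_op :: "complex list \<Rightarrow> (int \<Rightarrow> complex) \<Rightarrow> int \<Rightarrow> complex" where
  "factors_op [] u = u"
| "factors_op (z # zs) u = factors_op zs (factor_op z u)"

text \<open>Variation of constants for (S - z) u = f with u(0) = 0. At most one of the two interval
  sums is nonempty: the first runs forward from 0, the second backward.\<close>

definition solve_factor :: "complex \<Rightarrow> (int \<Rightarrow> complex) \<Rightarrow> int \<Rightarrow> complex" where
  "solve_factor z f = (\<lambda>n. z powi n *
     ((\<Sum>k\<in>{0..<n}. z powi (- k - 1) * f k) - (\<Sum>k\<in>{n..<0}. z powi (- k - 1) * f k)))"

primrec solve_factors :: "complex list \<Rightarrow> (int \<Rightarrow> complex) \<Rightarrow> int \<Rightarrow> complex" where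
  "solve_factors [] f = f"
| "solve_factors (z # zs) f = solve_factor z (solve_factors zs f)"

lemma solve_factor_0: "solve_factor z f 0 = 0"
  by (simp add: solve_factor_def)

lemma solve_factor_diff:
  "solve_factor z (\<lambda>n. f n - g n) = (\<lambda>n. solve_factor z f n - solve_factor z g n)"
  by (auto simp: solve_factor_def algebra_simps sum_subtractf)

lemma solve_factors_diff:
  "solve_factors zs (\<lambda>n. f n - g n) = (\<lambda>n. solve_factors zs f n - solve_factors zs g n)"
  by (induction zs) (auto simp: solve_factor_diff)

lemma factor_op_solve_factor:
  assumes "z \<noteq> 0"
  shows "factor_op z (solve_factor z f) = f"
proof
  fix n :: int
  define g where "g k = z powi (- k - 1) * f k" for k
  define S where "S n = sum g {0..<n} - sum g {n..<0}" for n
  have "S (n + 1) = S n + g n"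
  proof (cases "0 \<le> n")
    case True
    then have "{0..<n + 1} = insert n {0..<n}" by auto
    then show ?thesis using True by (simp add: S_def)
  next
    case False
    then have "{n..<0} = insert n {n + 1..<0}" by auto
    then show ?thesis using False by (simp add: S_def)
  qed
  moreover have "solve_factor z f n = z powi n * S n" for n
    by (simp add: solve_factor_def S_def g_def)
  ultimately have "factor_op z (solve_factor z f) n = z powi (n + 1) * g n"
    using assms by (simp add: factor_op_def power_int_add algebra_simps)
  also have "\<dots> = z powi ((n + 1) + (- n - 1)) * f n"
    using assms unfolding g_def by (subst power_int_add) auto
  finally show "factor_op z (solve_factor z f) n = f n" by simp
qed

lemma factors_op_solve_factors: "0 \<notin> set zs \<Longrightarrow> factors_op zs (solve_factors zs f) = f"
  by (induction zs) (auto simp: factor_op_solve_factor)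

text \<open>The inequality used to the right holds from 1 / (rp - 1) on, the one to the left from 1
  / (1 - rm) on; the sum is large enough for both.\<close>

definition step_const :: real where
  "step_const = 1 / (rp - 1) + 1 / (1 - rm)"

lemma step_const: "1 + step_const \<le> step_const * rp" "1 + step_const * rm \<le> step_const" "0 < step_const"
proof -
  define p m where "p = 1 / (rp - 1)" and "m = 1 / (1 - rm)"
  have pm: "p * (rp - 1) = 1" "m * (1 - rm) = 1" "0 < p" "0 < m"
    using rp_gt rm_less by (auto simp: p_def m_def)
  have "0 \<le> m * (rp - 1)" "0 \<le> p * (1 - rm)"
    using pm rp_gt rm_less by auto
  with pm show "1 + step_const \<le> step_const * rp" "1 + step_const * rm \<le> step_const" "0 < step_const"
    unfolding step_const_def p_def[symmetric] m_def[symmetric] distrib_right right_diff_distrib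
    by linarith+
qed

lemma weight_Suc: "0 \<le> n \<Longrightarrow> weight (n + 1) = rp * weight n"
  using rp_pos by (simp add: weight_def power_int_add)

lemma weight_pred: "n \<le> 0 \<Longrightarrow> weight n = rm * weight (n - 1)"
  using rm_pos by (auto simp: weight_def power_int_diff)

text \<open>Since |z| = 1, one step in either direction increases |u| by at most the forcing, while
  the weight gains a factor rp or 1 / rm. The inequalities for \<open>step_const\<close> say that
  this gain pays for the forcing; the initial value enters with factor 1.\<close>

lemma bounded_by_of_factor_op:
  assumes z: "cmod z = 1" and f: "bounded_by C (factor_op z u)" and a: "cmod (u 0) \<le> a"
  shows "bounded_by (a + step_const * C) u"
proof -
  have a0: "0 \<le> a" using a norm_ge_zero order_trans by blast
  have C0: "0 \<le> C" using f by (rule bounded_by_nonneg)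
  have "cmod (u n) \<le> (a + step_const * C) * weight n" for n
  proof (induction n rule: int_induct[of _ 0])
    case base
    have "0 \<le> step_const * C" using C0 step_const(3) by simp
    then show ?case using a by (simp add: weight_def)
  next
    case (step1 n)
    have "u (n + 1) = z * u n + factor_op z u n" by (simp add: factor_op_def)
    then have "cmod (u (n + 1)) \<le> cmod (u n) + cmod (factor_op z u n)"
      by (metis norm_mult mult_1 norm_triangle_ineq z)
    also have "\<dots> \<le> (a + step_const * C) * weight n + C * weight n"
      by (intro add_mono step1 bounded_byD[OF f])
    also have "\<dots> = (a + C * (1 + step_const)) * weight n" by (simp add: algebra_simps)
    also have "\<dots> \<le> (a * rp + C * (step_const * rp)) * weight n"
      using a0 C0 rp_gt weight_pos[of n] step_const(1)
      by (intro mult_right_mono add_mono mult_left_mono) (auto simp: mult_le_cancel_left1)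
    also have "\<dots> = (a + step_const * C) * weight (n + 1)"
      by (simp only: weight_Suc[OF step1(1)]) (simp add: algebra_simps)
    finally show ?case .
  next
    case (step2 n)
    have "z * u (n - 1) = u n - factor_op z u (n - 1)" by (simp add: factor_op_def)
    then have "cmod (u (n - 1)) \<le> cmod (u n) + cmod (factor_op z u (n - 1))"
      by (metis norm_mult mult_1 norm_triangle_ineq4 z)
    also have "\<dots> \<le> (a + step_const * C) * weight n + C * weight (n - 1)"
      by (intro add_mono step2 bounded_byD[OF f])
    also have "\<dots> = (a * rm + C * (1 + step_const * rm)) * weight (n - 1)"
      by (simp only: weight_pred[OF step2(1)]) (simp add: algebra_simps)
    also have "\<dots> \<le> (a * 1 + C * step_const) * weight (n - 1)"
      using a0 C0 rm_less weight_pos[of "n - 1"] step_const(2)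
      by (intro mult_right_mono add_mono mult_left_mono) auto
    finally show ?case by (simp add: algebra_simps)
  qed
  then show ?thesis by (simp add: bounded_by_def)
qed

text \<open>\<open>solve_factor\<close> starts from the value 0, so the initial-value term drops out
  and each factor costs one \<open>step_const\<close>.\<close>

lemma bounded_by_solve_factors:
  assumes "\<And>z. z \<in> set zs \<Longrightarrow> cmod z = 1" "bounded_by C f"
  shows "bounded_by (step_const ^ length zs * C) (solve_factors zs f)"
  using assms(1)
proof (induction zs)
  case (Cons z zs)
  have "z \<noteq> 0" using Cons.prems[of z] by auto
  with Cons have "bounded_by (0 + step_const * (step_const ^ length zs * C)) (solve_factor z (solve_factors zs f))"
    by (intro bounded_by_of_factor_op[of z]) (auto simp: factor_op_solve_factor solve_factor_0)
  then show ?case by (simp add: mult.assoc)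
qed (simp add: assms)

text \<open>Peeling off one factor uses the value u(0) and the values of
  \<open>factor_op z u\<close> on a window shorter by one, where they are at most 2a. So as many
  values are needed as there are roots with multiplicity.\<close>

lemma bounded_by_of_factors_op:
  assumes "\<And>z. z \<in> set zs \<Longrightarrow> cmod z = 1"
  shows "\<exists>K\<ge>0. \<forall>u a C. 0 \<le> a \<longrightarrow> (\<forall>j<length zs. cmod (u (int j)) \<le> a) \<longrightarrow>
    bounded_by C (factors_op zs u) \<longrightarrow> bounded_by (K * (a + C)) u"
  using assms
proof (induction zs)
  case Nil
  then show ?case by (intro exI[of _ 1]) (auto elim: bounded_by_mono)
next
  case (Cons z zs)
  then obtain K where K: "K \<ge> 0" "\<And>u a C. 0 \<le> a \<Longrightarrow> (\<forall>j<length zs. cmod (u (int j)) \<le> a) \<Longrightarrow>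
    bounded_by C (factors_op zs u) \<Longrightarrow> bounded_by (K * (a + C)) u"
    by (metis list.set_intros(2))
  have z: "cmod z = 1" using Cons by simp
  show ?case
  proof (intro exI[of _ "1 + step_const * K * 2"] conjI allI impI)
    show "0 \<le> 1 + step_const * K * 2" using K(1) step_const(3) by simp
    fix u a C
    assume *: "0 \<le> a" "\<forall>j<length (z # zs). cmod (u (int j)) \<le> a" "bounded_by C (factors_op (z # zs) u)"
    have C0: "0 \<le> C" using *(3) by (rule bounded_by_nonneg)
    have "cmod (factor_op z u (int j)) \<le> 2 * a" if "j < length zs" for j
    proof -
      have "cmod (u (int j + 1)) \<le> a" using *(2)[rule_format, of "Suc j"] that by (simp add: add.commute)
      moreover have "cmod (z * u (int j)) \<le> a" using *(2) that by (simp add: norm_mult z)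
      ultimately show ?thesis
        unfolding factor_op_def using norm_triangle_ineq4[of "u (int j + 1)" "z * u (int j)"] by linarith
    qed
    then have "bounded_by (K * (2 * a + C)) (factor_op z u)"
      using * by (intro K(2)) auto
    then have "bounded_by (a + step_const * (K * (2 * a + C))) u"
      using *(2) by (intro bounded_by_of_factor_op[OF z]) auto
    moreover have "a + step_const * (K * (2 * a + C)) \<le> (1 + step_const * K * 2) * (a + C)"
      using C0 K(1) step_const(3) by (simp add: algebra_simps)
    ultimately show "bounded_by ((1 + step_const * K * 2) * (a + C)) u"
      by (rule bounded_by_mono)
  qed
qed

text \<open>The best constant S, the supremum of |u(n)| / weight(n), satisfies S \<le> M + S / 2.
  The bound C is qualitative: it makes S finite and does not appear in the result.\<close>

lemma bounded_by_absorb: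
  assumes "bounded_by C u" and step: "\<And>C. bounded_by C u \<Longrightarrow> bounded_by (M + C / 2) u"
  shows "bounded_by (2 * M) u"
proof -
  define S where "S = (SUP n. cmod (u n) / weight n)"
  have bdd: "bdd_above (range (\<lambda>n. cmod (u n) / weight n))"
    using bounded_byD[OF assms(1)] weight_pos by (intro bdd_aboveI2[of _ _ C]) (simp add: pos_divide_le_eq)
  have "bounded_by S u"
    unfolding bounded_by_def
  proof
    fix n
    have "cmod (u n) / weight n \<le> S" unfolding S_def by (rule cSUP_upper[OF _ bdd]) simp
    then show "cmod (u n) \<le> S * weight n" using weight_pos[of n] by (simp add: pos_divide_le_eq)
  qed
  from step[OF this] have "S \<le> M + S / 2"
    unfolding S_def[symmetric]
    by (subst S_def, intro cSUP_least) (auto simp: pos_divide_le_eq weight_pos dest: bounded_byD)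
  then show ?thesis
    using \<open>bounded_by S u\<close> by (elim bounded_by_mono) simp
qed

text \<open>A Neumann series for an operator with bound 1/2, realized by iteration and pointwise
  limits. Compatibility with differences is asked for on weight-bounded sequences, since infinite
  sums are additive only where they converge.\<close>

lemma fixed_point:
  assumes Q: "\<And>C u. bounded_by C u \<Longrightarrow> bounded_by (C / 2) (Q u)"
    and Q_diff: "\<And>C D u w. bounded_by C u \<Longrightarrow> bounded_by D w \<Longrightarrow> Q (\<lambda>n. u n - w n) = (\<lambda>n. Q u n - Q w n)"
    and b: "bounded_by B b"
  obtains y where "bounded_by (2 * B) y" "y = (\<lambda>n. b n + Q y n)"
proof -
  define s where "s N = ((\<lambda>y n. b n + Q y n) ^^ N) (\<lambda>_. 0)" for N
  have s_Suc: "s (Suc N) = (\<lambda>n. b n + Q (s N) n)" for N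
    by (simp add: s_def)
  have B0: "0 \<le> B" using b by (rule bounded_by_nonneg)
  have s: "bounded_by (2 * B) (s N)" for N
  proof (induction N)
    case 0
    then show ?case using B0 weight_pos by (simp add: s_def bounded_by_def less_imp_le)
  next
    case (Suc N)
    then show ?case using bounded_by_add[OF b Q[OF Suc]] by (simp add: s_Suc)
  qed
  have s_diff: "bounded_by (2 * B / 2 ^ N) (\<lambda>n. s (N + M) n - s N n)" for N M
  proof (induction N)
    case 0
    then show ?case using s[of M] by (simp add: s_def)
  next
    case (Suc N)
    have "(\<lambda>n. s (Suc N + M) n - s (Suc N) n) = Q (\<lambda>n. s (N + M) n - s N n)"
      by (simp add: s_Suc Q_diff[OF s s])
    then show ?case using Q[OF Suc] by simp
  qed
  have dist0: "(\<lambda>N. D / 2 ^ N * weight n) \<longlonglongrightarrow> 0" for D :: real and n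
    by real_asymp
  have conv: "convergent (\<lambda>N. s N n)" for n
  proof (rule Cauchy_convergent, rule metric_CauchyI)
    fix e :: real assume "0 < e"
    with order_tendstoD(2)[OF dist0[of "2 * (2 * B)" n]] obtain N where N: "2 * (2 * B) / 2 ^ N * weight n < e"
      unfolding eventually_sequentially by blast
    define X where "X = 2 * B / 2 ^ N * weight n"
    have X: "dist (s m n) (s N n) \<le> X" if "N \<le> m" for m
      using bounded_byD[OF s_diff[of N "m - N"], of n] that by (simp add: dist_norm X_def)
    have "2 * X < e" using N by (simp add: X_def)
    then have "dist (s m n) (s k n) < e" if "N \<le> m" "N \<le> k" for m k
      using dist_triangle2[of "s m n" "s k n" "s N n"] X[OF that(1)] X[OF that(2)] by linarith
    then show "\<exists>N. \<forall>m\<ge>N. \<forall>k\<ge>N. dist (s m n) (s k n) < e" by blast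
  qed
  define y where "y n = lim (\<lambda>N. s N n)" for n
  have lim_y: "(\<lambda>N. s N n) \<longlonglongrightarrow> y n" for n
    using conv unfolding y_def by (simp add: convergent_LIMSEQ_iff)
  \<comment> \<open>The geometric bound on s (N + M) - s N survives the pointwise limit in M; it
    then identifies Q y as the limit of Q (s N).\<close>
  have y_s: "bounded_by (2 * B / 2 ^ N) (\<lambda>n. y n - s N n)" for N
    unfolding bounded_by_def
  proof
    fix n
    have "(\<lambda>M. cmod (s (N + M) n - s N n)) \<longlonglongrightarrow> cmod (y n - s N n)"
      using LIMSEQ_ignore_initial_segment[OF lim_y[of n], of N]
      by (intro tendsto_intros) (simp add: add.commute)
    then show "cmod (y n - s N n) \<le> 2 * B / 2 ^ N * weight n"
      by (rule LIMSEQ_le_const2) (use bounded_byD[OF s_diff] in blast)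
  qed
  have y: "bounded_by (2 * B) y"
    using y_s[of 0] by (simp add: s_def)
  have "y n = b n + Q y n" for n
  proof (rule LIMSEQ_unique)
    show "(\<lambda>N. s (Suc N) n) \<longlonglongrightarrow> y n"
      by (rule LIMSEQ_Suc[OF lim_y])
    have "(\<lambda>N. Q (s N) n) \<longlonglongrightarrow> Q y n"
    proof (rule Lim_null_comparison[THEN LIM_zero_cancel])
      show "(\<lambda>N. B / 2 ^ N * weight n) \<longlonglongrightarrow> 0" by (rule dist0)
      have "cmod (Q (s N) n - Q y n) \<le> B / 2 ^ N * weight n" for N
        using bounded_byD[OF Q[OF y_s[of N]], of n] by (simp add: Q_diff[OF y s] norm_minus_commute)
      then show "\<forall>\<^sub>F N in sequentially. cmod (Q (s N) n - Q y n) \<le> B / 2 ^ N * weight n"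
        by simp
    qed
    then show "(\<lambda>N. s (Suc N) n) \<longlonglongrightarrow> b n + Q y n"
      by (simp add: s_Suc tendsto_add)
  qed
  with y show thesis using that by blast
qed

lemma factors_op_append: "factors_op (zs @ ws) u = factors_op ws (factors_op zs u)"
  by (induction zs arbitrary: u) auto

lemma bounded_by_factor_op:
  assumes "bounded_by C u"
  shows "bounded_by ((weight 1 + cmod z) * C) (factor_op z u)"
  unfolding factor_op_def distrib_right
proof (rule bounded_by_diff)
  show "bounded_by (weight 1 * C) (\<lambda>n. u (n + 1))"
    unfolding bounded_by_def
  proof
    fix n
    have "cmod (u (n + 1)) \<le> C * weight (n + 1)" by (rule bounded_byD[OF assms])
    also have "\<dots> \<le> C * (weight n * weight 1)"
      using bounded_by_nonneg[OF assms] by (intro mult_left_mono weight_add)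
    finally show "cmod (u (n + 1)) \<le> weight 1 * C * weight n" by (simp add: mult_ac)
  qed
  show "bounded_by (cmod z * C) (\<lambda>n. z * u n)"
    using assms by (rule bounded_by_mult) simp
qed

lemma bounded_by_factors_op:
  assumes "bounded_by C u"
  obtains D where "bounded_by D (factors_op zs u)"
proof -
  have "\<exists>D. bounded_by D (factors_op zs u)"
    using assms
  proof (induction zs arbitrary: u C)
    case (Cons z zs)
    from Cons.IH[OF bounded_by_factor_op[OF Cons.prems]] show ?case by simp
  qed auto
  then show thesis using that by blast
qed

end

section \<open>Perturbed symbols\<close>

text \<open>In the application \<open>f\<close> belongs to V - E, \<open>g\<close> to the zero-free
  factor, \<open>c\<close> to its reciprocal, and \<open>zs\<close> lists the roots with
  multiplicity. The factorization and inversion are recorded as operator identities on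
  weight-bounded sequences, the form in which the estimates use them.\<close>

locale factored_symbol = growth_rates +
  fixes f g c :: "int \<Rightarrow> complex" and zs :: "complex list"
  assumes roots: "\<And>z. z \<in> set zs \<Longrightarrow> cmod z = 1"
    and wsummable_f: "wsummable f" and wsummable_c: "wsummable c"
    and conv_c_conv_g: "\<And>C u. bounded_by C u \<Longrightarrow> conv c (conv g u) = u"
    and conv_g_conv_c: "\<And>C u. bounded_by C u \<Longrightarrow> conv g (conv c u) = u"
    and conv_f: "\<And>C u. bounded_by C u \<Longrightarrow> conv f u = conv g (factors_op zs u)"
begin

text \<open>Splitting f = f1 + (f - f1) turns the equation into f(S) u = (f - f1)(S) u - p u, with
  two terms of size \<eta> C on the right; inverting g(S) by \<open>c\<close> leaves the bare
  recurrence.\<close>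

lemma bounded_by_perturbed_solution:
  assumes "bounded_by C u" and "wsummable f1" and "wnorm (\<lambda>k. f k - f1 k) \<le> \<eta>"
    and "\<And>n. cmod (p n) \<le> \<eta>" and "conv f1 u = (\<lambda>n. - p n * u n)"
  shows "bounded_by (wnorm c * (2 * \<eta> * C)) (factors_op zs u)"
proof -
  obtain D where D: "bounded_by D (factors_op zs u)"
    using bounded_by_factors_op[OF assms(1)] by blast
  have "conv f u = (\<lambda>n. conv (\<lambda>k. f k - f1 k) u n - p n * u n)"
    by (simp add: conv_diff_left[OF wsummable_f assms(2,1)] assms(5))
  then have "factors_op zs u = conv c (\<lambda>n. conv (\<lambda>k. f k - f1 k) u n - p n * u n)"
    using conv_c_conv_g[OF D] conv_f[OF assms(1)] by simp
  moreover have "bounded_by (\<eta> * C + \<eta> * C) (\<lambda>n. conv (\<lambda>k. f k - f1 k) u n - p n * u n)"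
  proof (rule bounded_by_diff)
    show "bounded_by (\<eta> * C) (conv (\<lambda>k. f k - f1 k) u)"
      using bounded_by_conv[OF wsummable_diff[OF wsummable_f assms(2)] assms(1)]
      by (rule bounded_by_mono) (intro mult_right_mono assms bounded_by_nonneg[OF assms(1)])
    show "bounded_by (\<eta> * C) (\<lambda>n. p n * u n)"
      using assms by (intro bounded_by_mult)
  qed
  ultimately show ?thesis
    using bounded_by_conv[OF wsummable_c] by (metis mult.assoc mult_2)
qed

text \<open>The constants depend on \<open>f\<close>, \<open>c\<close> and \<open>zs\<close> alone,
  so they serve all close truncations at once. For the first claim the perturbation terms are fed
  back into the bound by initial values and absorbed; for the second, w = u + y, and the correction
  y is found by a Neumann series with \<open>f\<close> as the unperturbed symbol.\<close>

lemma solutions_of_perturbations: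
  obtains \<eta> K where "0 < \<eta>" "0 \<le> K"
    "\<And>f1 p u a C. wsummable f1 \<Longrightarrow> wnorm (\<lambda>k. f k - f1 k) \<le> \<eta> \<Longrightarrow> (\<And>n. cmod (p n) \<le> \<eta>) \<Longrightarrow>
       bounded_by C u \<Longrightarrow> conv f1 u = (\<lambda>n. - p n * u n) \<Longrightarrow> 0 \<le> a \<Longrightarrow>
       (\<And>j. j < length zs \<Longrightarrow> cmod (u (int j)) \<le> a) \<Longrightarrow> bounded_by (K * a) u"
    "\<And>f1 f2 p u C. wsummable f1 \<Longrightarrow> wsummable f2 \<Longrightarrow> wnorm (\<lambda>k. f k - f2 k) \<le> \<eta> \<Longrightarrow>
       (\<And>n. cmod (p n) \<le> \<eta>) \<Longrightarrow> bounded_by C u \<Longrightarrow> conv f1 u = (\<lambda>n. - p n * u n) \<Longrightarrow>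
       \<exists>w. conv f2 w = (\<lambda>n. - p n * w n) \<and>
         bounded_by (K * wnorm (\<lambda>k. f1 k - f2 k) * C) (\<lambda>n. w n - u n)"
proof -
  obtain K0 where K0: "K0 \<ge> 0" "\<And>u a C. 0 \<le> a \<Longrightarrow> (\<And>j. j < length zs \<Longrightarrow> cmod (u (int j)) \<le> a) \<Longrightarrow>
    bounded_by C (factors_op zs u) \<Longrightarrow> bounded_by (K0 * (a + C)) u"
    using bounded_by_of_factors_op[of zs] roots by metis
  define R where "R = step_const ^ length zs"
  have R0: "0 \<le> R" using step_const(3) by (simp add: R_def)
  define M where "M = (K0 + R) * wnorm c + 1"
  have M: "0 < M" "K0 * wnorm c \<le> M" "R * wnorm c \<le> M"
    using wnorm_nonneg[of c] K0(1) R0 by (auto simp: M_def algebra_simps intro!: add_pos_nonneg)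
  \<comment> \<open>Two perturbation terms of size \<eta> then contribute at most a factor 1/2, both
    in the a priori estimate (through \<open>K0\<close>) and in the correction (through
    \<open>R\<close>). The 1 in \<open>M\<close> keeps it positive.\<close>
  define \<eta> where "\<eta> = 1 / (4 * M)"
  have \<eta>: "0 < \<eta>" "K0 * wnorm c * \<eta> \<le> 1 / 4" "R * wnorm c * \<eta> \<le> 1 / 4"
    using M by (auto simp: \<eta>_def divide_le_eq)
  define K where "K = 2 * K0 + 2 * (R * wnorm c)"
  have K: "0 \<le> K" "2 * K0 \<le> K" "2 * (R * wnorm c) \<le> K"
    using K0(1) R0 wnorm_nonneg[of c] by (auto simp: K_def)
  show thesis
  proof (rule that[OF \<eta>(1) K(1)])
    fix f1 p u a C
    assume f1: "wsummable f1" "wnorm (\<lambda>k. f k - f1 k) \<le> \<eta>" and p: "\<And>n. cmod (p n) \<le> \<eta>"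
      and u: "bounded_by C u" "conv f1 u = (\<lambda>n. - p n * u n)"
      and a: "0 \<le> a" "\<And>j. j < length zs \<Longrightarrow> cmod (u (int j)) \<le> a"
    have "bounded_by (2 * (K0 * a)) u"
    proof (rule bounded_by_absorb[OF u(1)])
      fix C assume C: "bounded_by C u"
      have "bounded_by (K0 * (a + wnorm c * (2 * \<eta> * C))) u"
        using a bounded_by_perturbed_solution[OF C f1 p u(2)] by (rule K0(2))
      moreover have "K0 * wnorm c * \<eta> * (2 * C) \<le> 1 / 4 * (2 * C)"
        using \<eta>(2) bounded_by_nonneg[OF C] by (intro mult_right_mono) auto
      ultimately show "bounded_by (K0 * a + C / 2) u"
        by (elim bounded_by_mono) (simp add: algebra_simps)
    qed
    then show "bounded_by (K * a) u"
      by (rule bounded_by_mono) (use mult_right_mono[OF K(2) a(1)] in simp)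
  next
    fix f1 f2 p u C
    assume f1: "wsummable f1" and f2: "wsummable f2" "wnorm (\<lambda>k. f k - f2 k) \<le> \<eta>"
      and p: "\<And>n. cmod (p n) \<le> \<eta>" and u: "bounded_by C u" "conv f1 u = (\<lambda>n. - p n * u n)"
    \<comment> \<open>For w = u + y the equation for \<open>f2\<close> reads f2(S) y = h - p y, that
      is, f(S) y = h - Z y.\<close>
    define h where "h = conv (\<lambda>k. f1 k - f2 k) u"
    define Z where "Z y = (\<lambda>n. p n * y n - conv (\<lambda>k. f k - f2 k) y n)" for y
    note f_f2 = wsummable_diff[OF wsummable_f f2(1)]
    have h: "bounded_by (wnorm (\<lambda>k. f1 k - f2 k) * C) h"
      unfolding h_def by (intro bounded_by_conv wsummable_diff f1 f2 u)
    have Z: "bounded_by (\<eta> * C + \<eta> * C) (Z y)" if "bounded_by C y" for C y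
      unfolding Z_def
    proof (rule bounded_by_diff)
      show "bounded_by (\<eta> * C) (conv (\<lambda>k. f k - f2 k) y)"
        using bounded_by_conv[OF f_f2 that]
        by (rule bounded_by_mono) (intro mult_right_mono f2 bounded_by_nonneg[OF that])
      show "bounded_by (\<eta> * C) (\<lambda>n. p n * y n)"
        using that p by (rule bounded_by_mult)
    qed
    \<comment> \<open>\<open>solve_factors zs\<close> after \<open>conv c\<close> is a right inverse
      of f(S); applied to h - Z y it gives the fixed-point form y = b + Q y.\<close>
    define b where "b = solve_factors zs (conv c h)"
    have b: "bounded_by (R * (wnorm c * (wnorm (\<lambda>k. f1 k - f2 k) * C))) b"
      unfolding b_def R_def by (intro bounded_by_solve_factors roots bounded_by_conv wsummable_c h)
    define Q where "Q y = (\<lambda>n. - solve_factors zs (conv c (Z y)) n)" for y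
    have Q: "bounded_by (C / 2) (Q y)" if C: "bounded_by C y" for C y
    proof -
      have "bounded_by (R * (wnorm c * (\<eta> * C + \<eta> * C))) (solve_factors zs (conv c (Z y)))"
        unfolding R_def by (intro bounded_by_solve_factors roots bounded_by_conv wsummable_c Z C)
      moreover have "R * wnorm c * \<eta> * (2 * C) \<le> 1 / 4 * (2 * C)"
        using \<eta>(3) bounded_by_nonneg[OF C] by (intro mult_right_mono) auto
      ultimately have "bounded_by (C / 2) (solve_factors zs (conv c (Z y)))"
        by (elim bounded_by_mono) (simp add: algebra_simps)
      then show ?thesis by (simp add: Q_def bounded_by_def)
    qed
    have Q_diff: "Q (\<lambda>n. x n - y n) = (\<lambda>n. Q x n - Q y n)" if x: "bounded_by C x" and y: "bounded_by D y" for C D x y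
    proof -
      have "Z (\<lambda>n. x n - y n) = (\<lambda>n. Z x n - Z y n)"
        by (auto simp: Z_def conv_diff_right[OF f_f2 x y] algebra_simps)
      then have "solve_factors zs (conv c (Z (\<lambda>n. x n - y n)))
          = (\<lambda>n. solve_factors zs (conv c (Z x)) n - solve_factors zs (conv c (Z y)) n)"
        by (simp add: conv_diff_right[OF wsummable_c Z[OF x] Z[OF y]] solve_factors_diff)
      then show ?thesis by (auto simp: Q_def)
    qed
    obtain y where y: "bounded_by (2 * (R * (wnorm c * (wnorm (\<lambda>k. f1 k - f2 k) * C)))) y"
      and fix_y: "y = (\<lambda>n. b n + Q y n)"
    proof (rule fixed_point[of Q, OF _ _ b])
      show "bounded_by (C / 2) (Q y)" if "bounded_by C y" for C y by (rule Q[OF that])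
      show "Q (\<lambda>n. x n - y n) = (\<lambda>n. Q x n - Q y n)" if "bounded_by C x" "bounded_by D y" for C D x y
        by (rule Q_diff[OF that])
    qed (rule that)
    have hZ: "bounded_by (wnorm (\<lambda>k. f1 k - f2 k) * C +
        (\<eta> * (2 * (R * (wnorm c * (wnorm (\<lambda>k. f1 k - f2 k) * C)))) + \<eta> * (2 * (R * (wnorm c * (wnorm (\<lambda>k. f1 k - f2 k) * C))))))
        (\<lambda>n. h n - Z y n)"
      by (intro bounded_by_diff h Z y)
    have "y = solve_factors zs (conv c (\<lambda>n. h n - Z y n))"
      by (subst fix_y) (simp add: Q_def b_def conv_diff_right[OF wsummable_c h Z[OF y]] solve_factors_diff)
    moreover have "0 \<notin> set zs" using roots[of 0] by auto
    ultimately have "factors_op zs y = conv c (\<lambda>n. h n - Z y n)"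
      using factors_op_solve_factors by metis
    then have "conv f y = (\<lambda>n. h n - Z y n)"
      by (simp add: conv_f[OF y] conv_g_conv_c[OF hZ])
    then have "conv f y n = h n - Z y n" for n
      by simp
    then have "conv f2 y n = h n - p n * y n" for n
      by (simp add: Z_def conv_diff_left[OF wsummable_f f2(1) y] algebra_simps)
    then have "conv f2 (\<lambda>n. u n + y n) = (\<lambda>n. - p n * (u n + y n))"
      by (auto simp: conv_add_right[OF f2(1) u(1) y] h_def conv_diff_left[OF f1 f2(1) u(1)] u(2) algebra_simps)
    moreover have "bounded_by (K * wnorm (\<lambda>k. f1 k - f2 k) * C) (\<lambda>n. (u n + y n) - u n)"
    proof -
      have "2 * (R * wnorm c) * (wnorm (\<lambda>k. f1 k - f2 k) * C) \<le> K * (wnorm (\<lambda>k. f1 k - f2 k) * C)"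
        using K(3) wnorm_nonneg bounded_by_nonneg[OF u(1)] by (intro mult_right_mono) auto
      then show ?thesis by simp (rule bounded_by_mono[OF y], simp add: mult_ac)
    qed
    ultimately show "\<exists>w. conv f2 w = (\<lambda>n. - p n * w n) \<and>
         bounded_by (K * wnorm (\<lambda>k. f1 k - f2 k) * C) (\<lambda>n. w n - u n)"
      by blast
  qed
qed

end

section \<open>Laurent coefficients\<close>

abbreviation circle_point :: "real \<Rightarrow> real \<Rightarrow> complex" where
  "circle_point r x \<equiv> of_real r * cis (2 * pi * x)"

text \<open>Up to the factor 2 pi i the mean is the contour integral of \<phi>(z) / z, and
  concentric circles are homotopic in the annulus. The origin is removed from U because of the
  denominator.\<close>

lemma circle_mean_eq:
  assumes "\<phi> holomorphic_on U" "open U" "0 < s" "s \<le> r" "{z. s \<le> cmod z \<and> cmod z \<le> r} \<subseteq> U"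
  shows "integral {0..1} (\<lambda>x. \<phi> (circle_point r x)) = integral {0..1} (\<lambda>x. \<phi> (circle_point s x))"
proof -
  have cp: "contour_integral (circlepath 0 t) (\<lambda>z. \<phi> z / z)
      = 2 * pi * \<i> * integral {0..1} (\<lambda>x. \<phi> (circle_point t x))" if "0 < t" for t
  proof -
    have "contour_integral (circlepath 0 t) (\<lambda>z. \<phi> z / z)
        = integral {0..1} (\<lambda>x. 2 * pi * \<i> * \<phi> (circle_point t x))"
      unfolding contour_integral_integral
    proof (rule integral_cong)
      fix x :: real
      have "circlepath 0 t x = circle_point t x"
        by (simp add: circlepath cis_conv_exp mult_ac)
      moreover have "vector_derivative (circlepath 0 t) (at x) = 2 * pi * \<i> * circle_point t x"
        by (simp add: vector_derivative_circlepath cis_conv_exp mult_ac)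
      ultimately show "\<phi> (circlepath 0 t x) / circlepath 0 t x * vector_derivative (circlepath 0 t) (at x)
          = 2 * pi * \<i> * \<phi> (circle_point t x)"
        using that by simp
    qed
    then show ?thesis by simp
  qed
  have "contour_integral (circlepath 0 r) (\<lambda>z. \<phi> z / z) = contour_integral (circlepath 0 s) (\<lambda>z. \<phi> z / z)"
  proof (rule Cauchy_theorem_homotopic_loops)
    show "homotopic_loops (U - {0}) (circlepath 0 r) (circlepath 0 s)"
    \<comment> \<open>Points at the same parameter have the same argument, so the segment between
      them is radial and stays in the annulus.\<close>
    proof (rule homotopic_loops_linear)
      fix t :: real assume "t \<in> {0..1}"
      show "closed_segment (circlepath 0 r t) (circlepath 0 s t) \<subseteq> U - {0}"
      proof
        fix z assume "z \<in> closed_segment (circlepath 0 r t) (circlepath 0 s t)"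
        then obtain v where v: "0 \<le> v" "v \<le> 1"
          "z = of_real ((1 - v) * r + v * s) * exp (2 * of_real pi * \<i> * of_real t)"
          by (auto simp: closed_segment_def circlepath scaleR_conv_of_real algebra_simps)
        have "(1 - v) * s + v * s \<le> (1 - v) * r + v * s" "(1 - v) * r + v * s \<le> (1 - v) * r + v * r"
          using v assms by (auto intro!: mult_left_mono)
        then have "s \<le> (1 - v) * r + v * s" "(1 - v) * r + v * s \<le> r"
          by (auto simp: algebra_simps)
        moreover from this have "cmod z = (1 - v) * r + v * s"
          using \<open>0 < s\<close> unfolding v(3) norm_mult norm_of_real by simp
        ultimately show "z \<in> U - {0}"
          using assms by auto
      qed
    qed auto
    show "open (U - {0})" using assms by auto
    show "(\<lambda>z. \<phi> z / z) holomorphic_on U - {0}"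
      using assms by (auto intro!: holomorphic_intros elim: holomorphic_on_subset)
  qed auto
  then show ?thesis using assms by (simp add: cp)
qed

text \<open>The Laurent coefficient of index n, read off from values on the unit circle; this is the
  shape of \<open>fourier_coeff\<close>.\<close>

definition circle_coeff :: "(complex \<Rightarrow> complex) \<Rightarrow> int \<Rightarrow> complex" where
  "circle_coeff \<phi> n = integral {0..1} (\<lambda>x. \<phi> (cis (2 * pi * x)) * cis (- (2 * pi * of_int n * x)))"

text \<open>The coefficient is a circle mean of \<phi>(z) z^(-n), whose circle may be moved to any
  radius t between s and r, where the integrand is at most M t^(-n). Radius r serves n \<ge> 0,
  radius s serves n < 0.\<close>

lemma circle_coeff_bound:
  assumes "\<phi> holomorphic_on U" "open U" "0 < s" "s \<le> r" "{z. s \<le> cmod z \<and> cmod z \<le> r} \<subseteq> U"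
    and "s \<le> 1" "1 \<le> r"
  obtains M where "0 \<le> M" "\<And>n. cmod (circle_coeff \<phi> n) \<le> M * r powi (- n)"
    "\<And>n. cmod (circle_coeff \<phi> n) \<le> M * s powi (- n)"
proof -
  let ?K = "{z. s \<le> cmod z \<and> cmod z \<le> r}"
  have K: "compact ?K"
  proof -
    have "?K = cball 0 r - ball 0 s" by auto
    then show ?thesis by (simp add: compact_diff)
  qed
  have cont: "continuous_on ?K \<phi>"
    using assms holomorphic_on_imp_continuous_on continuous_on_subset by blast
  then have "bounded (\<phi> ` ?K)"
    by (intro compact_imp_bounded compact_continuous_image K)
  then obtain M where M: "\<And>z. z \<in> ?K \<Longrightarrow> cmod (\<phi> z) \<le> M"
    by (auto simp: bounded_iff)
  have "0 \<le> M"
    by (rule order_trans[OF norm_ge_zero M[of 1]]) (use assms in simp)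
  have bd: "cmod (circle_coeff \<phi> n) \<le> M * t powi (- n)" if t: "s \<le> t" "t \<le> r" for t n
  proof -
    define \<psi> where "\<psi> z = \<phi> z * z powi (- n)" for z
    have t0: "0 < t" using t assms by linarith
    have hol: "\<psi> holomorphic_on U - {0}"
      unfolding \<psi>_def using assms(1)
      by (auto intro!: holomorphic_intros elim: holomorphic_on_subset)
    have "circle_coeff \<phi> n = integral {0..1} (\<lambda>x. \<psi> (circle_point 1 x))"
      by (simp add: circle_coeff_def \<psi>_def cis_power_int mult_ac)
    also have "\<dots> = integral {0..1} (\<lambda>x. \<psi> (circle_point t x))"
    proof -
      \<comment> \<open>Means are compared with the one on the outermost circle, so radii 1 and t
        need not be ordered.\<close>
      have "integral {0..1} (\<lambda>x. \<psi> (circle_point r x)) = integral {0..1} (\<lambda>x. \<psi> (circle_point q x))"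
        if "s \<le> q" "q \<le> r" for q
        by (rule circle_mean_eq[OF hol]) (use assms that in auto)
      from this[of 1] this[of t] show ?thesis using assms t by simp
    qed
    finally have eq: "circle_coeff \<phi> n = integral {0..1} (\<lambda>x. \<psi> (circle_point t x))" .
    have inK: "circle_point t x \<in> ?K" for x
      using t t0 by (simp add: norm_mult)
    have "cmod (integral {0..1} (\<lambda>x. \<psi> (circle_point t x))) \<le> integral {0..1} (\<lambda>x::real. M * t powi (- n))"
    proof (rule integral_norm_bound_integral)
      have "continuous_on {0..1} (\<lambda>x. \<phi> (circle_point t x))"
        by (rule continuous_on_compose2[OF cont]) (use inK in \<open>auto intro!: continuous_intros\<close>)
      then have "continuous_on {0..1} (\<lambda>x. \<psi> (circle_point t x))"
        unfolding \<psi>_def using t0 by (auto intro!: continuous_intros)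
      then show "(\<lambda>x. \<psi> (circle_point t x)) integrable_on {0..1}"
        by (rule integrable_continuous_real)
      show "cmod (\<psi> (circle_point t x)) \<le> M * t powi - n" for x
        using M[OF inK[of x]] t0 by (simp add: \<psi>_def norm_mult norm_power_int)
    qed auto
    then show ?thesis by (simp add: eq)
  qed
  show thesis
    by (rule that[OF \<open>0 \<le> M\<close>]; rule bd) (use assms in auto)
qed

lemma circle_coeff_decay:
  assumes "F holomorphic_on annulus h" "0 < \<xi>" "\<xi> < h"
  shows "\<exists>C. \<forall>n. cmod (circle_coeff F n) \<le> C * exp (- \<xi> * of_int \<bar>n\<bar>)"
proof -
  have op: "open (annulus h)"
    unfolding annulus_def by (intro open_Collect_conj open_Collect_less continuous_intros)
  obtain M where M: "0 \<le> M" "\<And>n. cmod (circle_coeff F n) \<le> M * exp \<xi> powi (- n)"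
    "\<And>n. cmod (circle_coeff F n) \<le> M * exp (- \<xi>) powi (- n)"
  proof (rule circle_coeff_bound[OF assms(1) op])
    show "{z. exp (- \<xi>) \<le> cmod z \<and> cmod z \<le> exp \<xi>} \<subseteq> annulus h"
    proof
      fix z :: complex assume "z \<in> {z. exp (- \<xi>) \<le> cmod z \<and> cmod z \<le> exp \<xi>}"
      moreover have "exp (- h) < exp (- \<xi>)" "exp \<xi> < exp h" using assms by auto
      ultimately show "z \<in> annulus h" unfolding annulus_def mem_Collect_eq by linarith
    qed
  qed (use assms that in auto)
  have e: "exp a powi n = exp (a * of_int n)" for a :: real and n
    by (simp add: exp_power_int mult.commute)
  have "cmod (circle_coeff F n) \<le> M * exp (- \<xi> * of_int \<bar>n\<bar>)" for n
    using M(2)[of n] M(3)[of n] by (cases "0 \<le> n") (simp_all add: e)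
  then show ?thesis by blast
qed

context growth_rates begin

text \<open>The rate \<xi> itself is recorded, beyond \<open>wsummable\<close>: it is preserved when
  a unimodular root is divided out, and it makes the Laurent series holomorphic on an open set
  around the closed annulus.\<close>

definition decaying :: "(int \<Rightarrow> complex) \<Rightarrow> bool" where
  "decaying a \<longleftrightarrow> (\<exists>C. \<forall>n. cmod (a n) \<le> C * exp (- \<xi> * of_int \<bar>n\<bar>))"

definition laurent :: "(int \<Rightarrow> complex) \<Rightarrow> complex \<Rightarrow> complex" where
  "laurent a z = (\<Sum>\<^sub>\<infinity>n. a n * z powi n)"

abbreviation closed_annulus :: "complex set" where
  "closed_annulus \<equiv> {z. rm \<le> cmod z \<and> cmod z \<le> rp}"

lemma decayingE:
  assumes "decaying a"
  obtains C where "0 \<le> C" "\<And>n. cmod (a n) \<le> C * exp (- \<xi> * of_int \<bar>n\<bar>)"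
proof -
  obtain C where C: "\<And>n. cmod (a n) \<le> C * exp (- \<xi> * of_int \<bar>n\<bar>)"
    using assms by (auto simp: decaying_def)
  from C[of 0] have "0 \<le> C" by (simp add: order_trans[OF norm_ge_zero])
  with C that show thesis by blast
qed

lemma closed_annulus_subset: "closed_annulus \<subseteq> annulus \<xi>"
  using rm_gt rp_less by (auto simp: annulus_def)

lemma unit_circle_closed_annulus: "cmod z = 1 \<Longrightarrow> z \<in> closed_annulus"
  using rm_less rp_gt by simp

lemma exp_summable: "(\<lambda>n::int. exp (- \<xi> * of_int \<bar>n\<bar>)) summable_on UNIV"
  by (rule summable_on_comparison_test[OF exp_weight_summable])
    (use weight_ge_1 in \<open>auto simp: mult_le_cancel_right1\<close>)

lemma decaying_wsummable:
  assumes "decaying a"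
  shows "wsummable a"
proof -
  obtain C where C: "\<And>n. cmod (a n) \<le> C * exp (- \<xi> * of_int \<bar>n\<bar>)"
    using assms by (auto simp: decaying_def)
  show ?thesis
    unfolding wsummable_def
  proof (rule summable_on_comparison_test)
    show "(\<lambda>n. C * (weight n * exp (- \<xi> * of_int \<bar>n\<bar>))) summable_on UNIV"
      by (intro summable_on_cmult_right exp_weight_summable)
    show "cmod (a n) * weight n \<le> C * (weight n * exp (- \<xi> * of_int \<bar>n\<bar>))" for n
      using mult_right_mono[OF C[of n] less_imp_le[OF weight_pos[of n]]] by (simp add: mult_ac)
  qed (simp add: weight_pos less_imp_le)
qed

text \<open>Two power series, in z and in 1/z, dominated by geometric series since exp (- \<xi>) |z|
  and exp (- \<xi>) / |z| are less than 1. The index - (n + 1) keeps the constant term out of the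
  second.\<close>

lemma laurent_split:
  assumes "decaying a" "z \<in> annulus \<xi>"
  shows "((\<lambda>n. a n * z powi n) has_sum
      (\<Sum>n. a (int n) * z ^ n) + (\<Sum>n. a (- int (Suc n)) * inverse z ^ Suc n)) UNIV"
    and "summable (\<lambda>n. norm (a (int n) * z ^ n))"
    and "summable (\<lambda>n. norm (a (- int (Suc n)) * inverse z ^ Suc n))"
proof -
  let ?q = "exp (- \<xi>)"
  obtain C where C: "0 \<le> C" "\<And>n. cmod (a n) \<le> C * exp (- \<xi> * of_int \<bar>n\<bar>)"
    using decayingE[OF assms(1)] by blast
  have e: "exp (- (\<xi> * real n)) = ?q ^ n" for n
    by (simp add: exp_of_nat_mult[symmetric] mult.commute)
  have z: "?q * cmod z < 1" "?q * inverse (cmod z) < 1" "0 < cmod z"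
    using assms(2) exp_gt_zero[of "- \<xi>"] unfolding annulus_def
    by (auto simp: exp_minus field_simps intro: order.strict_trans)
  then have z0: "z \<noteq> 0" by auto
  show s1: "summable (\<lambda>n. norm (a (int n) * z ^ n))"
  proof (rule summable_comparison_test')
    show "summable (\<lambda>n. C * (?q * cmod z) ^ n)"
      using z by (intro summable_mult summable_geometric) simp
    show "norm (norm (a (int n) * z ^ n)) \<le> C * (?q * cmod z) ^ n" for n
      using mult_right_mono[OF C(2)[of "int n"], of "cmod z ^ n"]
      by (simp add: norm_mult norm_power power_mult_distrib e mult_ac)
  qed
  show s2: "summable (\<lambda>n. norm (a (- int (Suc n)) * inverse z ^ Suc n))"
  proof (rule summable_comparison_test')
    show "summable (\<lambda>n. C * (?q * inverse (cmod z)) ^ Suc n)"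
      using z by (subst summable_Suc_iff, intro summable_mult summable_geometric) simp
    show "norm (norm (a (- int (Suc n)) * inverse z ^ Suc n)) \<le> C * (?q * inverse (cmod z)) ^ Suc n" for n
    proof -
      have "cmod (a (- int (Suc n))) \<le> C * ?q ^ Suc n"
        using C(2)[of "- int (Suc n)"] e[of "Suc n"] by (simp only: abs_minus_cancel) simp
      from mult_right_mono[OF this, of "inverse (cmod z) ^ Suc n"] show ?thesis
        by (simp add: norm_mult norm_power norm_inverse power_mult_distrib mult_ac)
    qed
  qed
  have 1: "((\<lambda>n. a n * z powi n) has_sum (\<Sum>n. a (int n) * z ^ n)) (range int)"
    using norm_summable_imp_has_sum[OF s1 summable_sums[OF summable_norm_cancel[OF s1]]]
    by (subst has_sum_reindex) (auto simp: o_def inj_on_def)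
  have 2: "((\<lambda>n. a n * z powi n) has_sum (\<Sum>n. a (- int (Suc n)) * inverse z ^ Suc n)) (range (\<lambda>n. - int (Suc n)))"
  proof -
    have "z powi (- int (Suc n)) = inverse z ^ Suc n" for n
      by (simp only: power_int_minus power_int_of_nat power_inverse)
    then show ?thesis
      using norm_summable_imp_has_sum[OF s2 summable_sums[OF summable_norm_cancel[OF s2]]]
      by (subst has_sum_reindex) (auto simp: o_def inj_on_def simp del: power_Suc of_nat_Suc)
  qed
  have u: "range int \<union> range (\<lambda>n. - int (Suc n)) = UNIV"
    by (auto simp: image_iff simp del: of_nat_Suc) (metis int_cases)
  show "((\<lambda>n. a n * z powi n) has_sum
      (\<Sum>n. a (int n) * z ^ n) + (\<Sum>n. a (- int (Suc n)) * inverse z ^ Suc n)) UNIV"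
    using has_sum_Un_disjoint[OF 1 2] unfolding u by fastforce
qed

lemma laurent_has_sum:
  "decaying a \<Longrightarrow> z \<in> annulus \<xi> \<Longrightarrow> ((\<lambda>n. a n * z powi n) has_sum laurent a z) UNIV"
  unfolding laurent_def using laurent_split(1) has_sum_infsum has_sum_imp_summable by blast

lemma open_annulus: "open (annulus \<xi>)"
  unfolding annulus_def by (intro open_Collect_conj open_Collect_less continuous_intros)

lemma annulus_nonzero: "z \<in> annulus \<xi> \<Longrightarrow> z \<noteq> 0"
  using exp_gt_zero[of "- \<xi>"] by (auto simp: annulus_def simp del: exp_gt_zero)

lemma inverse_annulus:
  assumes "z \<in> annulus \<xi>"
  shows "inverse z \<in> annulus \<xi>"
  using assms annulus_nonzero[OF assms] less_imp_inverse_less[of "exp (- \<xi>)" "cmod z"]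
    less_imp_inverse_less[of "cmod z" "exp \<xi>"]
  by (simp add: annulus_def norm_inverse exp_minus)

lemma laurent_holomorphic:
  assumes "decaying a"
  shows "laurent a holomorphic_on annulus \<xi>"
proof -
  define P where "P w = (\<Sum>n. a (int n) * w ^ n)" for w
  define N where "N w = (\<Sum>n. a (- int (Suc n)) * w ^ Suc n)" for w
  \<comment> \<open>Convergence is known only on the annulus; a point w of the disc is dominated in
    modulus by the annulus point max 1 |w|.\<close>
  have ball: "w = 0 \<or> (\<exists>v\<in>annulus \<xi>. cmod w \<le> cmod v)" if "w \<in> ball 0 (exp \<xi>)" for w
  proof -
    have "max 1 (cmod w) < exp \<xi>" "exp (- \<xi>) < max 1 (cmod w)"
      using that \<xi>_pos by (auto simp: less_max_iff_disj)
    then have "complex_of_real (max 1 (cmod w)) \<in> annulus \<xi>"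
      by (auto simp: annulus_def)
    then show ?thesis by (intro disjI2 bexI[of _ "complex_of_real (max 1 (cmod w))"]) auto
  qed
  have sP: "summable (\<lambda>n. a (int n) * w ^ n)" if "w \<in> ball 0 (exp \<xi>)" for w
  proof -
    from ball[OF that] have "w = 0 \<or> (\<exists>v\<in>annulus \<xi>. cmod w \<le> cmod v)" .
    then show ?thesis
    proof
      assume "\<exists>v\<in>annulus \<xi>. cmod w \<le> cmod v"
      then obtain v where v: "v \<in> annulus \<xi>" "cmod w \<le> cmod v" by blast
      show ?thesis
        by (rule summable_comparison_test'[OF laurent_split(2)[OF assms v(1)]])
          (auto simp: norm_mult norm_power intro!: mult_left_mono power_mono v)
    qed auto
  qed
  have sN: "summable (\<lambda>n. a (- int (Suc n)) * w ^ Suc n)" if "w \<in> ball 0 (exp \<xi>)" for w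
  proof -
    from ball[OF that] have "w = 0 \<or> (\<exists>v\<in>annulus \<xi>. cmod w \<le> cmod v)" .
    then show ?thesis
    proof
      assume "\<exists>v\<in>annulus \<xi>. cmod w \<le> cmod v"
      then obtain v where v: "v \<in> annulus \<xi>" "cmod w \<le> cmod v" by blast
      then have "inverse v \<in> annulus \<xi>"
        by (simp add: inverse_annulus)
      from laurent_split(3)[OF assms this] show ?thesis
        by (rule summable_comparison_test')
          (auto simp: norm_mult norm_power intro!: mult_left_mono mult_mono power_mono v simp del: of_nat_Suc)
    qed auto
  qed
  have "P holomorphic_on ball 0 (exp \<xi>)"
    by (rule power_series_holomorphic[where a = "\<lambda>n. a (int n)"])
      (use sP in \<open>auto simp: P_def summable_sums\<close>)
  moreover have "N holomorphic_on ball 0 (exp \<xi>)"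
  proof (rule power_series_holomorphic[where a = "\<lambda>n. if n = 0 then 0 else a (- int n)"])
    fix w assume w: "w \<in> ball (0::complex) (exp \<xi>)"
    let ?F = "\<lambda>n. (if n = 0 then 0 else a (- int n)) * (w - 0) ^ n"
    have "(\<lambda>n. ?F (Suc n)) sums N w"
      using summable_sums[OF sN[OF w]] by (simp add: N_def del: of_nat_Suc power_Suc)
    then show "?F sums N w"
      using sums_Suc_iff[of ?F "N w"] by simp
  qed
  ultimately have "(\<lambda>z. P z + N (inverse z)) holomorphic_on annulus \<xi>"
    using annulus_nonzero inverse_annulus
    by (intro holomorphic_intros holomorphic_on_compose_gen[where g = N and f = inverse, unfolded o_def])
      (auto elim!: holomorphic_on_subset simp: annulus_def)
  moreover have "P z + N (inverse z) = laurent a z" if "z \<in> annulus \<xi>" for z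
    using laurent_split(1)[OF assms that] laurent_has_sum[OF assms that]
    unfolding P_def N_def by (rule has_sum_unique)
  ultimately show ?thesis
    using holomorphic_transform by blast
qed

text \<open>Division by \<open>z - z\<^sub>0\<close>: the quotient has the tail sums of the dividend as coefficients, and it
  decays in both directions because the full sum vanishes.\<close>

lemma divide_root:
  assumes a: "decaying a" and z0: "cmod z0 = 1" and zero: "laurent a z0 = 0"
  obtains b where "decaying b" "\<And>n. a n = b (n - 1) - z0 * b n"
proof -
  obtain C where C: "0 \<le> C" "\<And>n. cmod (a n) \<le> C * exp (- \<xi> * of_int \<bar>n\<bar>)"
    using decayingE[OF a] by blast
  define t where "t k = a k * z0 powi k" for k
  define T where "T n = infsum t {n<..}" for n
  have t_bound: "cmod (t k) \<le> C * exp (- \<xi> * of_int \<bar>k\<bar>)" for k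
    using C(2)[of k] z0 by (simp add: t_def norm_mult norm_power_int)
  have abs: "(\<lambda>k. cmod (t k)) summable_on S" for S
    by (rule summable_on_subset[of _ UNIV], rule summable_on_comparison_test[OF summable_on_cmult_right[OF exp_summable]])
      (use t_bound in auto)
  then have sm: "t summable_on S" for S
    by (rule abs_summable_summable)
  have z0': "z0 \<noteq> 0" "z0 \<in> annulus \<xi>"
    using z0 unit_circle_closed_annulus[OF z0] closed_annulus_subset by auto
  have total: "infsum t UNIV = 0"
    using zero by (simp add: laurent_def t_def[abs_def])
  have T_neg: "T n = - infsum t {..n}" for n
  proof -
    have "{n<..} \<union> {..n} = UNIV" by auto
    then have "T n + infsum t {..n} = infsum t UNIV"
      unfolding T_def by (subst infsum_Un_disjoint[symmetric]) (auto intro: sm)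
    then show ?thesis using total by (simp add: eq_neg_iff_add_eq_0)
  qed
  define S0 where "S0 = (\<Sum>\<^sub>\<infinity>n::int. exp (- \<xi> * of_int \<bar>n\<bar>))"
  \<comment> \<open>The condition on \<open>A\<close> says that k lies at or beyond n as seen from
    0, so exp (- \<xi> |k|) splits off exp (- \<xi> |n|) and no decay rate is lost.\<close>
  have tail: "cmod (infsum t A) \<le> C * S0 * exp (- \<xi> * of_int \<bar>n\<bar>)" if A: "\<And>k. k \<in> A \<Longrightarrow> \<bar>k\<bar> = \<bar>n\<bar> + \<bar>k - n\<bar>" for A n
  proof -
    let ?e = "\<lambda>k. C * exp (- \<xi> * of_int \<bar>n\<bar>) * exp (- \<xi> * of_int \<bar>k - n\<bar>)"
    have e: "(\<lambda>k. exp (- \<xi> * of_int \<bar>k - n\<bar>)) summable_on UNIV"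
      "(\<Sum>\<^sub>\<infinity>k. exp (- \<xi> * of_int \<bar>k - n\<bar>)) = S0"
    proof -
      have bij: "bij_betw (\<lambda>k. k - n) UNIV UNIV"
        by (rule bij_betwI[of _ _ _ "\<lambda>k. k + n"]) auto
      show "(\<lambda>k. exp (- \<xi> * of_int \<bar>k - n\<bar>)) summable_on UNIV"
        using summable_on_reindex_bij_betw[OF bij, of "\<lambda>k. exp (- \<xi> * of_int \<bar>k\<bar>)"] exp_summable by simp
      show "(\<Sum>\<^sub>\<infinity>k. exp (- \<xi> * of_int \<bar>k - n\<bar>)) = S0"
        unfolding S0_def by (rule infsum_reindex_bij_betw[OF bij, of "\<lambda>k. exp (- \<xi> * of_int \<bar>k\<bar>)"])
    qed
    have "cmod (infsum t A) \<le> (\<Sum>\<^sub>\<infinity>k\<in>A. cmod (t k))"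
      by (rule norm_infsum_bound) (rule abs)
    also have "\<dots> \<le> (\<Sum>\<^sub>\<infinity>k\<in>UNIV. ?e k)"
    proof (rule infsum_mono_neutral)
      show "?e summable_on UNIV" by (intro summable_on_cmult_right e)
      fix k assume "k \<in> A \<inter> UNIV"
      then have "\<bar>k\<bar> = \<bar>n\<bar> + \<bar>k - n\<bar>" using A by simp
      then have "exp (- \<xi> * of_int \<bar>k\<bar>) = exp (- \<xi> * of_int \<bar>n\<bar>) * exp (- \<xi> * of_int \<bar>k - n\<bar>)"
        by (simp add: exp_add[symmetric] algebra_simps)
      then show "cmod (t k) \<le> ?e k"
        using t_bound[of k] by simp
    qed (use C(1) abs in auto)
    also have "\<dots> = C * S0 * exp (- \<xi> * of_int \<bar>n\<bar>)"
      using e(2) by (simp add: infsum_cmult_right' mult_ac)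
    finally show ?thesis .
  qed
  have T_bound: "cmod (T n) \<le> C * S0 * exp (- \<xi> * of_int \<bar>n\<bar>)" for n
  proof (cases "0 \<le> n")
    case True
    then show ?thesis unfolding T_def by (intro tail) auto
  next
    case False
    then show ?thesis unfolding T_neg norm_minus_cancel by (intro tail) auto
  qed
  \<comment> \<open>Multiplied by z0^n, the relation a_n = b_(n-1) - z0 b_n becomes t n = T (n - 1)
    - T n with T n = z0^(n+1) b_n.\<close>
  define b where "b n = z0 powi (- n - 1) * T n" for n
  show thesis
  proof
    show "decaying b"
      unfolding decaying_def b_def using T_bound z0 by (auto simp: norm_mult norm_power_int)
    fix n :: int
    have "{n - 1<..} = insert n {n<..}" by auto
    then have "T (n - 1) = t n + T n"
      unfolding T_def by (simp add: infsum_insert sm)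
    then have "b (n - 1) = z0 powi (- n) * (t n + T n)"
      by (simp add: b_def)
    moreover have "z0 * b n = z0 powi (- n) * T n"
      using z0' by (simp add: b_def power_int_diff)
    moreover have "z0 powi (- n) * t n = a n"
      using z0' by (simp add: t_def power_int_minus)
    ultimately show "a n = b (n - 1) - z0 * b n"
      by (simp add: distrib_left)
  qed
qed

lemma laurent_root_product:
  assumes "decaying b" "\<And>n. a n = b (n - 1) - z0 * b n" "z \<in> annulus \<xi>"
  shows "laurent a z = (z - z0) * laurent b z"
proof -
  have 1: "((\<lambda>n. b (n - 1) * z powi n) has_sum z * laurent b z) UNIV"
  proof -
    have "((\<lambda>n. z * (b n * z powi n)) has_sum z * laurent b z) UNIV"
      by (intro has_sum_cmult_right laurent_has_sum assms)
    moreover have "z \<noteq> 0" using assms(3) by (rule annulus_nonzero)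
    ultimately show ?thesis
      by (subst has_sum_reindex_bij_witness[where i = "\<lambda>n. n + 1" and j = "\<lambda>n. n - 1" and T = UNIV
            and h = "\<lambda>n. z * (b n * z powi n)"]) (auto simp: power_int_diff)
  qed
  have "((\<lambda>n. - (z0 * (b n * z powi n))) has_sum - (z0 * laurent b z)) UNIV"
    by (intro has_sum_uminusI has_sum_cmult_right laurent_has_sum assms)
  from has_sum_add[OF 1 this] have "((\<lambda>n. a n * z powi n) has_sum (z - z0) * laurent b z) UNIV"
    by (simp add: assms(2) algebra_simps)
  then show ?thesis
    unfolding laurent_def by (rule infsumI)
qed

text \<open>The operator form of a(z) = (z - z0) b(z): reindexing the sum by one turns the
  coefficients b_(k-1) into a shift of u.\<close>

lemma conv_root_product:
  assumes "decaying b" "\<And>n. a n = b (n - 1) - z0 * b n" "bounded_by C u"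
  shows "conv a u = conv b (factor_op z0 u)"
proof
  fix n
  note b = conv_summable[OF decaying_wsummable[OF assms(1)] assms(3)]
  have "((\<lambda>k. b k * u (n + k + 1)) has_sum conv b (\<lambda>n. u (n + 1)) n) UNIV"
    using has_sum_infsum[OF b[of "n + 1"]] by (simp add: conv_def add_ac)
  then have 1: "((\<lambda>k. b (k - 1) * u (n + k)) has_sum conv b (\<lambda>n. u (n + 1)) n) UNIV"
    by (subst has_sum_reindex_bij_witness[where i = "\<lambda>n. n + 1" and j = "\<lambda>n. n - 1" and T = UNIV
          and h = "\<lambda>k. b k * u (n + k + 1)"]) auto
  have "((\<lambda>k. - (z0 * (b k * u (n + k)))) has_sum - (z0 * conv b u n)) UNIV"
    unfolding conv_def by (intro has_sum_uminusI has_sum_cmult_right has_sum_infsum b)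
  from has_sum_add[OF 1 this] have "conv a u n = conv b (\<lambda>n. u (n + 1)) n - z0 * conv b u n"
    unfolding conv_def[of a] by (intro infsumI) (simp add: assms(2) algebra_simps)
  moreover have "conv b (factor_op z0 u) n = conv b (\<lambda>n. u (n + 1)) n - z0 * conv b u n"
  proof (unfold conv_def factor_op_def, rule infsumI)
    have "((\<lambda>k. b k * u (n + k + 1) + - (z0 * (b k * u (n + k)))) has_sum
        conv b (\<lambda>n. u (n + 1)) n + - (z0 * conv b u n)) UNIV"
      using \<open>((\<lambda>k. b k * u (n + k + 1)) has_sum conv b (\<lambda>n. u (n + 1)) n) UNIV\<close>
        \<open>((\<lambda>k. - (z0 * (b k * u (n + k)))) has_sum - (z0 * conv b u n)) UNIV\<close> by (rule has_sum_add)
    then show "((\<lambda>k. b k * (u (n + k + 1) - z0 * u (n + k))) has_sum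
        (\<Sum>\<^sub>\<infinity>k. b k * u (n + k + 1)) - z0 * (\<Sum>\<^sub>\<infinity>k. b k * u (n + k))) UNIV"
      by (simp add: conv_def algebra_simps)
  qed
  ultimately show "conv a u n = conv b (factor_op z0 u) n" by simp
qed

end

section \<open>Factorization of the symbol\<close>

context growth_rates begin

lemma connected_annulus_xi: "connected (annulus \<xi>)"
proof -
  have "connected {x :: complex. exp (- \<xi>) < norm (x - 0) \<and> norm (x - 0) < exp \<xi>}"
    by (rule connected_annulus) simp
  then show ?thesis by (simp add: annulus_def)
qed

text \<open>Two identities are carried along: the one between functions locates the zeros of the
  quotient, the one between operators enters the estimates. Decay of the quotient allows the
  division to be repeated.\<close>

definition divides_by :: "(int \<Rightarrow> complex) \<Rightarrow> complex list \<Rightarrow> (int \<Rightarrow> complex) \<Rightarrow> bool" where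
  "divides_by f zs g \<longleftrightarrow> decaying g \<and>
     (\<forall>z\<in>annulus \<xi>. laurent f z = (\<Prod>w\<leftarrow>zs. z - w) * laurent g z) \<and>
     (\<forall>C u. bounded_by C u \<longrightarrow> conv f u = conv g (factors_op zs u))"

lemma divides_by_Nil: "decaying f \<Longrightarrow> divides_by f [] f"
  by (simp add: divides_by_def)

lemma divides_by_append:
  assumes "divides_by f zs g" "divides_by g ws k"
  shows "divides_by f (zs @ ws) k"
  unfolding divides_by_def
proof (intro conjI allI impI ballI)
  fix C u assume u: "bounded_by C u"
  obtain D where "bounded_by D (factors_op zs u)" using bounded_by_factors_op[OF u] .
  then have "conv g (factors_op zs u) = conv k (factors_op ws (factors_op zs u))"
    using assms(2) unfolding divides_by_def by blast
  moreover have "conv f u = conv g (factors_op zs u)"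
    using assms(1) u unfolding divides_by_def by blast
  ultimately show "conv f u = conv k (factors_op (zs @ ws) u)"
    by (simp only: factors_op_append)
qed (use assms in \<open>auto simp: divides_by_def\<close>)

lemma divides_by_root:
  assumes "decaying f" "cmod z = 1" "laurent f z = 0"
  obtains g where "divides_by f [z] g"
proof -
  obtain g where g: "decaying g" "\<And>n. f n = g (n - 1) - z * g n"
    using divide_root[OF assms] by blast
  show thesis
  proof (rule that)
    show "divides_by f [z] g"
      unfolding divides_by_def
      using g(1) laurent_root_product[OF g] conv_root_product[OF g] by simp
  qed
qed

text \<open>The root can only be divided out finitely often, by the local factorization of a nonconstant
  holomorphic function at a zero.\<close>

lemma divides_by_root_power:
  assumes f: "decaying f" and z: "cmod z = 1" and v: "v \<in> annulus \<xi>" "laurent f v \<noteq> 0"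
  obtains m g where "divides_by f (replicate m z) g" "laurent g z \<noteq> 0"
proof (rule ccontr)
  note found = that
  assume "\<not> thesis"
  then have stuck: "laurent g z = 0" if "divides_by f (replicate m z) g" for m g
    using found[OF that] by blast
  have ex: "\<exists>g. divides_by f (replicate m z) g" for m
  proof (induction m)
    case 0
    then show ?case using divides_by_Nil[OF f] by auto
  next
    case (Suc m)
    then obtain g where g: "divides_by f (replicate m z) g" by blast
    then have "decaying g" by (simp add: divides_by_def)
    then obtain k where "divides_by g [z] k"
      using divides_by_root z stuck[OF g] by blast
    from divides_by_append[OF g this] show ?case
      by (auto simp: replicate_append_same)
  qed
  have zA: "z \<in> annulus \<xi>"
    using unit_circle_closed_annulus[OF z] closed_annulus_subset by blast
  have fz: "laurent f z = 0"
    using stuck[of 0 f] divides_by_Nil[OF f] by simp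
  then have nonconst: "\<not> laurent f constant_on annulus \<xi>"
    using v zA by (intro notI) (auto simp: constant_on_def)
  obtain g r n where g: "0 < n" "0 < r" "ball z r \<subseteq> annulus \<xi>" "g holomorphic_on ball z r"
    "\<And>w. w \<in> ball z r \<Longrightarrow> laurent f w = (w - z) ^ n * g w" "\<And>w. w \<in> ball z r \<Longrightarrow> g w \<noteq> 0"
    by (rule holomorphic_factor_zero_nonconstant[OF laurent_holomorphic[OF f] open_annulus
          connected_annulus_xi zA fz nonconst]) (rule that)
  \<comment> \<open>One factor more than the order n of the zero: cancelling (w - z)^n makes g(w) a
    multiple of w - z near z, which contradicts that g does not vanish at z.\<close>
  obtain k where k: "divides_by f (replicate (Suc n) z) k" using ex by blast
  have eq: "g w = (w - z) * laurent k w" if "w \<in> ball z r - {z}" for w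
  proof -
    have "(w - z) ^ n * g w = (w - z) ^ Suc n * laurent k w"
      using k g(3) g(5)[of w] that by (auto simp: divides_by_def)
    then show ?thesis using that by simp
  qed
  have "isCont g z"
    using g(2,4) by (intro continuous_on_interior[of "ball z r"] holomorphic_on_imp_continuous_on) auto
  then have lim1: "(g \<longlongrightarrow> g z) (at z)" by (simp add: isCont_def)
  have "isCont (laurent k) z"
    using k zA open_annulus
    by (intro continuous_on_interior[of "annulus \<xi>"] holomorphic_on_imp_continuous_on laurent_holomorphic)
      (auto simp: divides_by_def interior_open)
  then have "isCont (\<lambda>w. (w - z) * laurent k w) z"
    by (intro continuous_intros)
  then have "((\<lambda>w. (w - z) * laurent k w) \<longlongrightarrow> 0) (at z)"
    by (simp add: isCont_def)
  moreover have "\<forall>\<^sub>F w in at z. g w = (w - z) * laurent k w"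
    unfolding eventually_at using g(2) eq by (intro exI[of _ r]) (auto simp: dist_commute)
  ultimately have "(g \<longlongrightarrow> 0) (at z)"
    by (simp add: filterlim_cong)
  then have "g z = 0" using lim1 tendsto_unique[of "at z"] by auto
  then show False using g(2,6) by auto
qed

text \<open>Induction on the number of distinct zeros in the closed annulus: each step removes one
  zero with full multiplicity, and zeros of the quotient are zeros of the dividend.\<close>

lemma factor_out_zeros:
  assumes "decaying f" "\<And>z. z \<in> closed_annulus \<Longrightarrow> laurent f z = 0 \<Longrightarrow> cmod z = 1"
  obtains zs g where "divides_by f zs g" "\<And>z. z \<in> set zs \<Longrightarrow> cmod z = 1"
    "\<And>z. z \<in> closed_annulus \<Longrightarrow> laurent g z \<noteq> 0"
proof -
  have compact: "compact closed_annulus"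
  proof -
    have "closed_annulus = cball 0 rp - ball 0 rm" by auto
    then show ?thesis by (simp add: compact_diff)
  qed
  have rpA: "complex_of_real rp \<in> closed_annulus"
    using rp_gt rm_less by simp
  have "\<exists>zs g. divides_by f zs g \<and> (\<forall>z\<in>set zs. cmod z = 1) \<and> (\<forall>z\<in>closed_annulus. laurent g z \<noteq> 0)"
    using assms
  proof (induction "card {z \<in> closed_annulus. laurent f z = 0}" arbitrary: f rule: less_induct)
    case (less f)
    let ?Z = "\<lambda>f. {z \<in> closed_annulus. laurent f z = 0}"
    \<comment> \<open>The point rp > 1 is off the unit circle, hence no zero. It witnesses that the
      series does not vanish identically, which makes multiplicities and the number of zeros
      finite.\<close>
    have nz: "laurent f rp \<noteq> 0"
      using less.prems(2)[OF rpA] rp_gt by auto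
    show ?case
    proof (cases "?Z f = {}")
      case True
      then show ?thesis
        using divides_by_Nil[OF less.prems(1)] by (intro exI[of _ "[]"] exI[of _ f]) auto
    next
      case False
      then obtain z where z: "z \<in> closed_annulus" "laurent f z = 0" by blast
      have z1: "cmod z = 1" using less.prems(2) z by blast
      obtain m g where g: "divides_by f (replicate m z) g" "laurent g z \<noteq> 0"
        by (rule divides_by_root_power[OF less.prems(1) z1 subsetD[OF closed_annulus_subset rpA] nz])
      have "\<not> laurent f constant_on annulus \<xi>"
      proof
        assume "laurent f constant_on annulus \<xi>"
        then obtain y where y: "\<And>w. w \<in> annulus \<xi> \<Longrightarrow> laurent f w = y"
          by (auto simp: constant_on_def)
        have "laurent f z = laurent f rp"
          using y z(1) rpA closed_annulus_subset by (metis subsetD)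
        then show False using nz z(2) by simp
      qed
      then have fin: "finite (?Z f)"
        by (intro holomorphic_compact_finite_zeros[OF laurent_holomorphic[OF less.prems(1)] open_annulus
              connected_annulus_xi compact closed_annulus_subset])
      have sub: "?Z g \<subseteq> ?Z f"
        using g(1) closed_annulus_subset by (auto simp: divides_by_def)
      then have "?Z g \<subset> ?Z f" using z g(2) by blast
      then have "card (?Z g) < card (?Z f)" using fin by (rule psubset_card_mono[rotated])
      moreover have "decaying g" using g(1) by (simp add: divides_by_def)
      moreover have "cmod w = 1" if "w \<in> closed_annulus" "laurent g w = 0" for w
        using sub less.prems(2) that by blast
      ultimately have "\<exists>zs k. divides_by g zs k \<and> (\<forall>z\<in>set zs. cmod z = 1) \<and> (\<forall>z\<in>closed_annulus. laurent k z \<noteq> 0)"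
        by (rule less.hyps)
      then obtain zs k where k: "divides_by g zs k" "\<forall>z\<in>set zs. cmod z = 1"
        "\<forall>z\<in>closed_annulus. laurent k z \<noteq> 0"
        by blast
      have "divides_by f (replicate m z @ zs) k"
        using g(1) k(1) by (rule divides_by_append)
      then show ?thesis using k z1 by (intro exI[of _ "replicate m z @ zs"] exI[of _ k]) auto
    qed
  qed
  then show thesis using that by blast
qed

end

section \<open>Inversion of the zero-free factor\<close>

text \<open>For n \<noteq> 0, moving the circle from radius 1 to radius 2 multiplies the integral by
  2^(-n) and also leaves it unchanged, so it is 0.\<close>

lemma circle_coeff_const: "circle_coeff (\<lambda>_. 1) n = (if n = 0 then 1 else 0)"
proof (cases "n = 0")
  case True
  then show ?thesis by (simp add: circle_coeff_def)
next
  case False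
  define J where "J = circle_coeff (\<lambda>_. 1) n"
  have J: "J = integral {0..1} (\<lambda>x. circle_point 1 x powi (- n))"
    by (simp add: J_def circle_coeff_def cis_power_int mult_ac)
  also have "\<dots> = integral {0..1} (\<lambda>x. circle_point 2 x powi (- n))"
    by (rule circle_mean_eq[where U = "- {0}", symmetric]) (auto intro!: holomorphic_intros)
  also have "\<dots> = integral {0..1} (\<lambda>x. 2 powi (- n) * circle_point 1 x powi (- n))"
    by (simp add: power_int_mult_distrib)
  also have "\<dots> = 2 powi (- n) * J"
    unfolding J by (rule integral_mult_right)
  finally have "J = 0 \<or> (2 :: complex) powi (- n) = 1"
    by simp
  moreover have "(2 :: complex) powi (- n) \<noteq> 1"
  proof
    assume "(2 :: complex) powi (- n) = 1"
    then have "(2 :: real) powi (- n) = 2 powi 0"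
      using norm_power_int[of "2 :: complex" "- n"] by simp
    then show False
      using False power_int_strict_increasing[of "- n" 0 "2 :: real"]
        power_int_strict_increasing[of 0 "- n" "2 :: real"] by linarith
  qed
  ultimately show ?thesis using False by (simp add: J_def)
qed

context growth_rates begin

text \<open>Termwise integration of the Laurent series against \<phi>. Decay of \<open>g\<close>
  gives uniform convergence on the circle, along the finite index sets so as to match
  \<open>has_sum\<close>.\<close>

lemma circle_coeff_laurent_mult:
  assumes g: "decaying g" and \<phi>: "continuous_on (sphere 0 1) \<phi>"
  shows "((\<lambda>k. g k * circle_coeff \<phi> (n - k)) has_sum circle_coeff (\<lambda>z. laurent g z * \<phi> z) n) UNIV"
proof -
  define e where "e m x = cis (- (2 * pi * of_int m * x))" for m and x :: real
  define p where "p k x = g k * (\<phi> (cis (2 * pi * x)) * e (n - k) x)" for k and x :: real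
  define q where "q x = laurent g (cis (2 * pi * x)) * \<phi> (cis (2 * pi * x)) * e n x" for x
  have cont: "continuous_on {0..1} (\<lambda>x. \<phi> (cis (2 * pi * x)) * e m x)" for m
  proof -
    have "continuous_on {0..1} (\<lambda>x::real. \<phi> (cis (2 * pi * x)))"
      by (rule continuous_on_compose2[OF \<phi>]) (auto intro!: continuous_intros)
    then show ?thesis unfolding e_def by (intro continuous_intros)
  qed
  have "bounded (\<phi> ` sphere 0 1)"
    by (intro compact_imp_bounded compact_continuous_image \<phi>) simp
  then obtain M where "\<forall>z\<in>sphere 0 1. cmod (\<phi> z) \<le> M"
    by (auto simp: bounded_iff)
  then have M: "cmod (\<phi> z) \<le> M" if "cmod z = 1" for z
    using that by simp
  obtain C where C: "0 \<le> C" "\<And>n. cmod (g n) \<le> C * exp (- \<xi> * of_int \<bar>n\<bar>)"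
    using decayingE[OF g] by blast
  have "uniform_limit {0..1} (\<lambda>X x. \<Sum>k\<in>X. p k x) q (finite_subsets_at_top UNIV)"
  proof (rule Weierstrass_m_test_general')
    fix k and x :: real
    show "norm (p k x) \<le> C * exp (- \<xi> * of_int \<bar>k\<bar>) * M"
      unfolding p_def norm_mult e_def norm_cis mult_1_right
      by (intro mult_mono C M) (auto simp: C)
  next
    show "(\<lambda>k::int. C * exp (- \<xi> * of_int \<bar>k\<bar>) * M) summable_on UNIV"
      by (intro summable_on_cmult_right summable_on_cmult_left exp_summable)
  next
    fix x :: real
    have "cis (2 * pi * x) \<in> annulus \<xi>"
      using subsetD[OF closed_annulus_subset unit_circle_closed_annulus[of "cis (2 * pi * x)"]] by simp
    from has_sum_cmult_left[OF laurent_has_sum[OF g this], of "\<phi> (cis (2 * pi * x)) * e n x"]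
    have "((\<lambda>k. g k * cis (2 * pi * x) powi k * (\<phi> (cis (2 * pi * x)) * e n x)) has_sum q x) UNIV"
      by (simp add: q_def mult_ac)
    moreover have "g k * cis (2 * pi * x) powi k * (\<phi> (cis (2 * pi * x)) * e n x) = p k x" for k
      unfolding p_def e_def cis_power_int
      by (simp add: mult_ac cis_mult algebra_simps)
    ultimately show "((\<lambda>k. p k x) has_sum q x) UNIV" by simp
  qed
  moreover have "continuous_on {0..1} (\<lambda>x. \<Sum>k\<in>X. p k x)" for X
    unfolding p_def by (intro continuous_intros cont)
  moreover have "finite_subsets_at_top (UNIV :: int set) \<noteq> bot" by simp
  ultimately obtain I J where IJ: "\<And>X. ((\<lambda>x. \<Sum>k\<in>X. p k x) has_integral I X) {0..1}"
    "(q has_integral J) {0..1}" "(I \<longlongrightarrow> J) (finite_subsets_at_top UNIV)"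
    by (rule uniform_limit_integral) blast+
  have "I = (\<lambda>X. \<Sum>k\<in>X. g k * circle_coeff \<phi> (n - k))"
  proof
    fix X
    have "I X = integral {0..1} (\<lambda>x. \<Sum>k\<in>X. p k x)"
      by (rule integral_unique[OF IJ(1), symmetric])
    also have "\<dots> = (\<Sum>k\<in>X. integral {0..1} (p k))"
    proof (cases "finite X")
      case True
      then show ?thesis
        by (intro integral_sum) (auto simp: p_def intro!: integrable_continuous_real continuous_intros cont)
    qed simp
    also have "\<dots> = (\<Sum>k\<in>X. g k * circle_coeff \<phi> (n - k))"
    proof (rule sum.cong[OF refl])
      fix k
      have "integral {0..1} (p k) = g k * integral {0..1} (\<lambda>x. \<phi> (cis (2 * pi * x)) * e (n - k) x)"
        unfolding p_def[abs_def] by (rule integral_mult_right)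
      then show "integral {0..1} (p k) = g k * circle_coeff \<phi> (n - k)"
        by (simp only: circle_coeff_def e_def)
    qed
    finally show "I X = (\<Sum>k\<in>X. g k * circle_coeff \<phi> (n - k))" .
  qed
  moreover have "J = circle_coeff (\<lambda>z. laurent g z * \<phi> z) n"
    using IJ(2) by (simp add: circle_coeff_def q_def[abs_def] e_def integral_unique mult_ac)
  ultimately show ?thesis
    using IJ(3) by (simp add: has_sum_def)
qed

text \<open>By compactness U contains a slightly larger annulus, with radii s < rm and r > rp.
  Coefficient bounds from these radii beat the weight by the ratios rp / r and s / rm.\<close>

lemma circle_coeff_wsummable:
  assumes "\<phi> holomorphic_on U" "open U" "closed_annulus \<subseteq> U"
  shows "wsummable (circle_coeff \<phi>)"
proof -
  have "compact closed_annulus"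
  proof -
    have "closed_annulus = cball 0 rp - ball 0 rm" by auto
    then show ?thesis by (simp add: compact_diff)
  qed
  then obtain e where e: "0 < e" "(\<Union>z\<in>closed_annulus. cball z e) \<subseteq> U"
    using compact_subset_open_imp_cball_epsilon_subset assms by metis
  \<comment> \<open>The bound rm / 2 keeps the inner radius s positive.\<close>
  define d where "d = min e (rm / 2)"
  define s r where "s = rm - d" and "r = rp + d"
  have d: "0 < d" "d \<le> e" "d < rm" using e rm_pos by (auto simp: d_def)
  have sr: "0 < s" "s < rm" "rp < r" "s \<le> r" "s \<le> 1" "1 \<le> r"
    using d rm_less rp_gt by (auto simp: s_def r_def)
  have "{z. s \<le> cmod z \<and> cmod z \<le> r} \<subseteq> U"
  proof
    fix z assume "z \<in> {z. s \<le> cmod z \<and> cmod z \<le> r}"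
    then have z: "s \<le> cmod z" "cmod z \<le> r" by auto
    then have z0: "z \<noteq> 0" using sr by auto
    \<comment> \<open>\<open>t\<close> is |z| clamped to [rm, rp], so \<open>w\<close> is the radial
      projection of z onto the closed annulus, at distance at most d.\<close>
    define t where "t = max rm (min rp (cmod z))"
    define w where "w = of_real t * sgn z"
    have "cmod w = t"
      using z0 rm_pos by (simp add: w_def norm_mult norm_sgn t_def)
    then have "w \<in> closed_annulus" using rm_less rp_gt by (auto simp: t_def)
    moreover have "dist w z \<le> e"
    proof -
      have "z = of_real (cmod z) * sgn z" using z0 by (simp add: sgn_div_norm scaleR_conv_of_real)
      then have "w - z = of_real (t - cmod z) * sgn z"
        by (simp add: w_def algebra_simps)
      then have "dist w z = \<bar>t - cmod z\<bar>"
        using z0 by (simp add: dist_norm norm_mult norm_sgn del: of_real_diff)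
      also have "\<dots> \<le> d" using z d(1) rm_less rp_gt by (auto simp: t_def s_def r_def)
      finally show ?thesis using d(2) by simp
    qed
    ultimately have "z \<in> (\<Union>z\<in>closed_annulus. cball z e)"
      unfolding UN_iff mem_cball by blast
    then show "z \<in> U" using e(2) by blast
  qed
  then obtain M where M: "0 \<le> M" "\<And>n. cmod (circle_coeff \<phi> n) \<le> M * r powi (- n)"
    "\<And>n. cmod (circle_coeff \<phi> n) \<le> M * s powi (- n)"
    using circle_coeff_bound[OF assms(1,2) sr(1,4) _ sr(5,6)] by blast
  let ?f = "\<lambda>n. cmod (circle_coeff \<phi> n) * weight n"
  have "summable (\<lambda>n. norm (?f (int n)))"
  proof (rule summable_comparison_test')
    show "summable (\<lambda>n. M * (rp / r) ^ n)"
      using sr rp_pos by (intro summable_mult summable_geometric) simp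
    show "norm (norm (?f (int n))) \<le> M * (rp / r) ^ n" for n
      using mult_right_mono[OF M(2)[of "int n"], of "rp ^ n"] rp_pos
      by (simp add: weight_of_nat power_int_minus power_divide abs_mult field_simps)
  qed
  then have "(\<lambda>n::nat. ?f (int n)) summable_on UNIV"
    by (rule norm_summable_imp_summable_on)
  then have 1: "?f summable_on range int"
    by (subst summable_on_reindex) (auto simp: o_def inj_on_def)
  have "summable (\<lambda>n. norm (?f (- int n)))"
  proof (rule summable_comparison_test')
    show "summable (\<lambda>n. M * (s / rm) ^ n)"
      using sr rm_pos by (intro summable_mult summable_geometric) simp
    show "norm (norm (?f (- int n))) \<le> M * (s / rm) ^ n" for n
    proof -
      have "cmod (circle_coeff \<phi> (- int n)) * inverse (rm ^ n) \<le> M * s ^ n * inverse (rm ^ n)"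
        using M(3)[of "- int n"] rm_pos by (intro mult_right_mono) auto
      moreover have "M * s ^ n * inverse (rm ^ n) = M * (s / rm) ^ n"
        by (simp add: power_divide field_simps)
      ultimately show ?thesis
        using rm_pos by (simp only: weight_of_minus_nat) (simp add: abs_mult)
    qed
  qed
  then have "(\<lambda>n::nat. ?f (- int n)) summable_on UNIV"
    by (rule norm_summable_imp_summable_on)
  then have 2: "?f summable_on range (\<lambda>n. - int n)"
    by (subst summable_on_reindex) (auto simp: o_def inj_on_def)
  have "range int \<union> range (\<lambda>n. - int n) = UNIV"
    by (auto simp: image_iff) (metis int_cases2)
  then show ?thesis using summable_on_union[OF 1 2] by (simp add: wsummable_def)
qed

lemma conv_delta: "conv (\<lambda>n. if n = 0 then 1 else 0) u = u"
proof
  fix n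
  have "(\<Sum>\<^sub>\<infinity>k. (if k = 0 then 1 else 0) * u (n + k)) = (\<Sum>\<^sub>\<infinity>k\<in>{0}. u (n + k))"
    by (rule infsum_cong_neutral) auto
  then show "conv (\<lambda>n. if n = 0 then 1 else 0) u n = u n"
    by (simp add: conv_def)
qed

text \<open>The inverse has the Laurent coefficients of the reciprocal of \<open>laurent g\<close>;
  their Cauchy product with \<open>g\<close> gives the coefficients of the constant 1. Only
  \<open>wsummable\<close> is claimed, not rate \<xi>, since \<open>laurent g\<close> may have zeros
  in \<open>annulus \<xi>\<close> outside the closed annulus.\<close>

lemma conv_inverse:
  assumes g: "decaying g" and nz: "\<And>z. z \<in> closed_annulus \<Longrightarrow> laurent g z \<noteq> 0"
  obtains c where "wsummable c" "\<And>C u. bounded_by C u \<Longrightarrow> conv c (conv g u) = u"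
    "\<And>C u. bounded_by C u \<Longrightarrow> conv g (conv c u) = u"
proof -
  define U where "U = {z \<in> annulus \<xi>. laurent g z \<noteq> 0}"
  define \<phi> where "\<phi> z = inverse (laurent g z)" for z
  have "open (annulus \<xi> \<inter> laurent g -` (- {0}))"
    by (rule continuous_open_preimage[OF holomorphic_on_imp_continuous_on[OF laurent_holomorphic[OF g]] open_annulus]) auto
  then have U: "open U" by (simp add: U_def Int_def vimage_def)
  have KU: "closed_annulus \<subseteq> U"
    using nz closed_annulus_subset by (auto simp: U_def)
  have hol: "\<phi> holomorphic_on U"
    unfolding \<phi>_def
    by (intro holomorphic_on_inverse holomorphic_on_subset[OF laurent_holomorphic[OF g]]) (auto simp: U_def)
  have cont: "continuous_on (sphere 0 1) \<phi>"
    by (rule continuous_on_subset[OF holomorphic_on_imp_continuous_on[OF hol]])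
      (use KU unit_circle_closed_annulus in auto)
  have one: "(\<Sum>\<^sub>\<infinity>k. g k * circle_coeff \<phi> (n - k)) = (if n = 0 then 1 else 0)" for n
  proof -
    have "circle_coeff (\<lambda>z. laurent g z * \<phi> z) n = circle_coeff (\<lambda>_. 1) n"
      unfolding circle_coeff_def
      by (intro integral_cong) (use nz[OF unit_circle_closed_annulus] in \<open>simp add: \<phi>_def\<close>)
    then show ?thesis
      using infsumI[OF circle_coeff_laurent_mult[OF g cont, of n]] by (simp add: circle_coeff_const)
  qed
  have one': "(\<Sum>\<^sub>\<infinity>k. circle_coeff \<phi> k * g (n - k)) = (if n = 0 then 1 else 0)" for n
  proof -
    have "(\<Sum>\<^sub>\<infinity>k. circle_coeff \<phi> k * g (n - k)) = (\<Sum>\<^sub>\<infinity>k. g k * circle_coeff \<phi> (n - k))"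
      by (rule infsum_reindex_bij_witness[where i = "\<lambda>k. n - k" and j = "\<lambda>k. n - k"]) auto
    then show ?thesis by (simp add: one)
  qed
  have w: "wsummable (circle_coeff \<phi>)"
    using hol U KU by (rule circle_coeff_wsummable)
  show thesis
  proof (rule that[OF w])
    fix C u assume u: "bounded_by C u"
    show "conv (circle_coeff \<phi>) (conv g u) = u"
      by (simp only: conv_conv[OF w decaying_wsummable[OF g] u] one' conv_delta)
    show "conv g (conv (circle_coeff \<phi>) u) = u"
      by (simp only: conv_conv[OF decaying_wsummable[OF g] w u] one conv_delta)
  qed
qed

lemma factored_symbol_exists:
  assumes "decaying f" "\<And>z. z \<in> closed_annulus \<Longrightarrow> laurent f z = 0 \<Longrightarrow> cmod z = 1"
  obtains g c zs where "factored_symbol \<xi> rm rp f g c zs"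
proof -
  obtain zs g where g: "divides_by f zs g" "\<And>z. z \<in> set zs \<Longrightarrow> cmod z = 1"
    "\<And>z. z \<in> closed_annulus \<Longrightarrow> laurent g z \<noteq> 0"
  proof (rule factor_out_zeros[OF assms])
    fix zs g
    assume "divides_by f zs g" "\<And>z. z \<in> set zs \<Longrightarrow> cmod z = 1" "\<And>z. z \<in> closed_annulus \<Longrightarrow> laurent g z \<noteq> 0"
    then show ?thesis by (rule that)
  qed
  then have dg: "decaying g" by (simp add: divides_by_def)
  obtain c where c: "wsummable c" "\<And>C u. bounded_by C u \<Longrightarrow> conv c (conv g u) = u"
    "\<And>C u. bounded_by C u \<Longrightarrow> conv g (conv c u) = u"
  proof (rule conv_inverse[OF dg])
    show "laurent g z \<noteq> 0" if "z \<in> closed_annulus" for z using that by (rule g(3))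
    fix c
    assume "wsummable c" "\<And>C u. bounded_by C u \<Longrightarrow> conv c (conv g u) = u"
      "\<And>C u. bounded_by C u \<Longrightarrow> conv g (conv c u) = u"
    then show ?thesis by (rule that)
  qed
  have "factored_symbol \<xi> rm rp f g c zs"
  proof unfold_locales
    show "conv f u = conv g (factors_op zs u)" if "bounded_by C u" for C u
      using g(1) that unfolding divides_by_def by blast
  qed (rule g c decaying_wsummable dg assms; assumption?)+
  then show thesis by (rule that)
qed

end

section \<open>The companion cocycle\<close>

lemma ipow_0: "ipow T 0 \<theta> = \<theta>"
  by (simp add: ipow_def)

lemma ipow_add_1:
  assumes "bij T"
  shows "ipow T (n + 1) \<theta> = T (ipow T n \<theta>)"
proof (cases "0 \<le> n")
  case True
  then have "nat (n + 1) = Suc (nat n)" by simp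
  then show ?thesis using True by (simp add: ipow_def)
next
  case False
  define m where "m = nat (- (n + 1))"
  have m: "n = - int (Suc m)" "n + 1 = - int m" using False by (auto simp: m_def)
  have neg: "ipow T (- int k) = inv_into UNIV T ^^ k" for k
    by (cases "k = 0") (auto simp: ipow_def)
  show ?thesis
    unfolding m(2) unfolding m(1) neg using assms by (simp add: bij_is_surj surj_f_inv_f)
qed

lemma ipow_add_nat:
  assumes "bij T"
  shows "ipow T (n + int m) \<theta> = (T ^^ m) (ipow T n \<theta>)"
proof (induction m)
  case (Suc m)
  have "ipow T (n + int (Suc m)) \<theta> = ipow T ((n + int m) + 1) \<theta>" by (simp add: add_ac)
  then show ?case using Suc ipow_add_1[OF assms] by simp
qed simp

text \<open>A trivial kernel gives a nonzero determinant, so \<open>mat_inverse\<close> is not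
  \<open>None\<close> and \<open>the\<close> yields a genuine two-sided inverse.\<close>

lemma mat_inverse_mult_vec:
  fixes M :: "complex mat"
  assumes M: "M \<in> carrier_mat m m"
    and ker: "\<And>v. v \<in> carrier_vec m \<Longrightarrow> M *\<^sub>v v = 0\<^sub>v m \<Longrightarrow> v = 0\<^sub>v m"
  shows "the (mat_inverse M) \<in> carrier_mat m m"
    and "\<And>v. v \<in> carrier_vec m \<Longrightarrow> the (mat_inverse M) *\<^sub>v (M *\<^sub>v v) = v"
    and "\<And>v. v \<in> carrier_vec m \<Longrightarrow> M *\<^sub>v (the (mat_inverse M) *\<^sub>v v) = v"
proof -
  have "Determinant.det M \<noteq> 0"
    using ker det_0_iff_vec_prod_zero_field[OF M] by blast
  then have "M \<in> Units (ring_mat TYPE(complex) m ())"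
    by (rule det_non_zero_imp_unit[OF M])
  then have "mat_inverse M \<noteq> None"
    using mat_inverse(1)[OF M, where b = "()"] by blast
  then obtain B where "mat_inverse M = Some B" by blast
  with mat_inverse(2)[OF M this] have B: "the (mat_inverse M) = B" "M * B = 1\<^sub>m m" "B * M = 1\<^sub>m m" "B \<in> carrier_mat m m"
    by auto
  show "the (mat_inverse M) \<in> carrier_mat m m" by (simp add: B)
  fix v :: "complex vec" assume v: "v \<in> carrier_vec m"
  show "the (mat_inverse M) *\<^sub>v (M *\<^sub>v v) = v"
    using assoc_mult_mat_vec[OF B(4) M v] v by (simp add: B)
  show "M *\<^sub>v (the (mat_inverse M) *\<^sub>v v) = v"
    using assoc_mult_mat_vec[OF M B(4) v] v by (simp add: B)
qed

text \<open>The coordinate order of the companion matrix, from u(n + l - 1) down to u(n - l); the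
  value u(n) sits at position l - 1.\<close>

definition window :: "nat \<Rightarrow> int \<Rightarrow> (int \<Rightarrow> complex) \<Rightarrow> complex vec" where
  "window l n u = vec (2 * l) (\<lambda>i. u (n + int l - 1 - int i))"

lemma window_carrier: "window l n u \<in> carrier_vec (2 * l)"
  by (simp add: window_def)

lemma companion_carrier: "companion V W E \<epsilon> l \<phi> \<in> carrier_mat (2 * l) (2 * l)"
  by (simp add: companion_def)

lemma companion_mult_vec_Suc:
  assumes v: "v \<in> carrier_vec (2 * l)" and i: "Suc i < 2 * l"
  shows "vec_index (companion V W E \<epsilon> l \<phi> *\<^sub>v v) (Suc i) = vec_index v i"
proof -
  have "vec_index (companion V W E \<epsilon> l \<phi> *\<^sub>v v) (Suc i)
      = (\<Sum>j\<in>{0..<2 * l}. (if Suc i = j + 1 then 1 else 0) * vec_index v j)"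
    using v i by (auto simp: companion_def scalar_prod_def intro!: sum.cong)
  also have "\<dots> = (\<Sum>j\<in>{0..<2 * l}. if j = i then vec_index v j else 0)"
    by (intro sum.cong) auto
  also have "\<dots> = vec_index v i" using i by simp
  finally show ?thesis .
qed

text \<open>The exceptional column fits the general formula: counted from 0 it is j = l - 1, where
  the coefficient index l - 1 - j is 0.\<close>

lemma companion_mult_vec_0:
  assumes v: "v \<in> carrier_vec (2 * l)" and l: "1 \<le> l"
  shows "vec_index (companion V W E \<epsilon> l \<phi> *\<^sub>v v) 0 =
    (\<Sum>j<2 * l. ((if j + 1 = l then of_real E - of_real (\<epsilon> * W \<phi>) else 0) - fourier_coeff V (int l - 1 - int j))
       / fourier_coeff V (int l) * vec_index v j)"
proof -
  have "vec_index (companion V W E \<epsilon> l \<phi> *\<^sub>v v) 0 = row (companion V W E \<epsilon> l \<phi>) 0 \<bullet> v"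
    using l companion_carrier[of V W E \<epsilon> l \<phi>] by (intro index_mult_mat_vec) auto
  also have "\<dots> = (\<Sum>j\<in>{0..<2 * l}. ((if j + 1 = l then of_real E - of_real (\<epsilon> * W \<phi>) else 0) - fourier_coeff V (int l - 1 - int j))
       / fourier_coeff V (int l) * vec_index v j)"
    unfolding scalar_prod_def using v l
    by (intro sum.cong) (auto simp: companion_def algebra_simps)
  finally show ?thesis by (simp add: atLeast0LessThan)
qed

section \<open>Companion orbits as windows of solutions\<close>

locale companion_setup =
  fixes V :: "real \<Rightarrow> real" and W :: "'w \<Rightarrow> real" and T :: "'w \<Rightarrow> 'w" and E \<epsilon> :: real and l :: nat
  assumes bij: "bij T" and l: "1 \<le> l"
    and nz: "fourier_coeff V (int l) \<noteq> 0" and nz': "fourier_coeff V (- int l) \<noteq> 0"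
begin

abbreviation "a \<equiv> fourier_coeff V"
abbreviation "Comp \<equiv> companion V W E \<epsilon> l"
abbreviation "Iter \<equiv> companion_iter V W T E \<epsilon> l"
abbreviation "Back \<equiv> companion_iter_back V W T E \<epsilon> l"

text \<open>The lower rows copy all coordinates but the last, so these vanish; on the last one the
  first row acts by the nonzero factor - a(- l) / a(l).\<close>

lemma companion_kernel:
  assumes v: "v \<in> carrier_vec (2 * l)" and 0: "Comp \<phi> *\<^sub>v v = 0\<^sub>v (2 * l)"
  shows "v = 0\<^sub>v (2 * l)"
proof -
  have small: "vec_index v i = 0" if "Suc i < 2 * l" for i
    using companion_mult_vec_Suc[OF v that, of V W E \<epsilon> \<phi>] that by (simp add: 0)
  define m where "m = 2 * l - 1"
  have m: "2 * l = Suc m" "m + 1 \<noteq> l" "int l - 1 - int m = - int l" using l by (auto simp: m_def)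
  have "0 = (\<Sum>j<Suc m. ((if j + 1 = l then of_real E - of_real (\<epsilon> * W \<phi>) else 0) - a (int l - 1 - int j))
       / a (int l) * vec_index v j)"
    using companion_mult_vec_0[OF v l, of V W E \<epsilon> \<phi>] l by (simp add: 0 m(1)[symmetric])
  also have "\<dots> = ((if m + 1 = l then of_real E - of_real (\<epsilon> * W \<phi>) else 0) - a (int l - 1 - int m))
       / a (int l) * vec_index v m"
    using small by (simp add: m(1))
  also have "\<dots> = - a (- int l) / a (int l) * vec_index v m"
    unfolding m(3) using m(2) by simp
  finally have "vec_index v m = 0" using nz nz' by simp
  then have "vec_index v i = 0" if "i < 2 * l" for i
    using small[of i] that m(1) by (cases "i = m") auto
  then show ?thesis using v by (intro eq_vecI) auto
qed

text \<open>The lower rows hold for every sequence; the first row, multiplied by a(l), is the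
  truncated equation at site n.\<close>

lemma companion_window:
  "Comp \<phi> *\<^sub>v window l n u = window l (n + 1) u \<longleftrightarrow>
    (\<Sum>k\<in>{- int l..int l}. a k * u (n + k)) + of_real (\<epsilon> * W \<phi>) * u n = of_real E * u n"
proof -
  let ?v = "window l n u"
  let ?c = "\<lambda>k. (if k = 0 then of_real E - of_real (\<epsilon> * W \<phi>) else 0) - a k"
  have "vec_index (Comp \<phi> *\<^sub>v ?v) 0 =
    (\<Sum>j<2 * l. ((if j + 1 = l then of_real E - of_real (\<epsilon> * W \<phi>) else 0) - a (int l - 1 - int j)) / a (int l)
       * u (n + int l - 1 - int j))"
    unfolding companion_mult_vec_0[OF window_carrier l] by (simp add: window_def)
  also have "\<dots> = (\<Sum>k\<in>{- int l..int l - 1}. ?c k / a (int l) * u (n + k))"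
    by (rule sum.reindex_bij_witness[where i = "\<lambda>k. nat (int l - 1 - k)" and j = "\<lambda>j. int l - 1 - int j"])
      (auto simp: algebra_simps)
  also have "\<dots> = (\<Sum>k\<in>{- int l..int l - 1}. ?c k * u (n + k)) / a (int l)"
    by (simp add: sum_divide_distrib)
  finally have row0: "vec_index (Comp \<phi> *\<^sub>v ?v) 0 = (\<Sum>k\<in>{- int l..int l - 1}. ?c k * u (n + k)) / a (int l)" .
  have "{- int l..int l} = insert (int l) {- int l..int l - 1}" using l by auto
  then have sum1: "(\<Sum>k\<in>{- int l..int l}. ?c k * u (n + k)) = (\<Sum>k\<in>{- int l..int l - 1}. ?c k * u (n + k)) - a (int l) * u (n + int l)"
    using l by simp
  have sum2: "(\<Sum>k\<in>{- int l..int l}. ?c k * u (n + k))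
      = (of_real E - of_real (\<epsilon> * W \<phi>)) * u n - (\<Sum>k\<in>{- int l..int l}. a k * u (n + k))"
  proof -
    have "(\<Sum>k\<in>{- int l..int l}. ?c k * u (n + k))
      = (\<Sum>k\<in>{- int l..int l}. (if k = 0 then (of_real E - of_real (\<epsilon> * W \<phi>)) * u (n + k) else 0) - a k * u (n + k))"
      by (intro sum.cong) (auto simp: algebra_simps)
    also have "\<dots> = (\<Sum>k\<in>{- int l..int l}. (if k = 0 then (of_real E - of_real (\<epsilon> * W \<phi>)) * u (n + k) else 0))
        - (\<Sum>k\<in>{- int l..int l}. a k * u (n + k))"
      by (rule sum_subtractf)
    finally show ?thesis by simp
  qed
  note sums = sum1 sum2
  have row0': "vec_index (Comp \<phi> *\<^sub>v ?v) 0 = u (n + int l) \<longleftrightarrow>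
    (\<Sum>k\<in>{- int l..int l}. a k * u (n + k)) + of_real (\<epsilon> * W \<phi>) * u n = of_real E * u n"
  proof -
    define X Y Z where "X = (\<Sum>k\<in>{- int l..int l - 1}. ?c k * u (n + k))"
      and "Y = (\<Sum>k\<in>{- int l..int l}. ?c k * u (n + k))" and "Z = (\<Sum>k\<in>{- int l..int l}. a k * u (n + k))"
    have "Y = X - a (int l) * u (n + int l)" "Y = (of_real E - of_real (\<epsilon> * W \<phi>)) * u n - Z"
      using sums by (simp_all only: X_def Y_def Z_def)
    moreover have "X / a (int l) = u (n + int l) \<longleftrightarrow> X - a (int l) * u (n + int l) = 0"
      using nz by (auto simp: field_simps)
    ultimately have "X / a (int l) = u (n + int l) \<longleftrightarrow> Z + of_real (\<epsilon> * W \<phi>) * u n = of_real E * u n"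
      by (auto simp: algebra_simps)
    then show ?thesis unfolding row0 X_def Z_def .
  qed
  have rowS: "vec_index (Comp \<phi> *\<^sub>v ?v) (Suc i) = vec_index (window l (n + 1) u) (Suc i)" if "Suc i < 2 * l" for i
    unfolding companion_mult_vec_Suc[OF window_carrier that] using that by (simp add: window_def algebra_simps)
  have "Comp \<phi> *\<^sub>v ?v = window l (n + 1) u \<longleftrightarrow> vec_index (Comp \<phi> *\<^sub>v ?v) 0 = vec_index (window l (n + 1) u) 0"
  proof
    assume *: "vec_index (Comp \<phi> *\<^sub>v ?v) 0 = vec_index (window l (n + 1) u) 0"
    show "Comp \<phi> *\<^sub>v ?v = window l (n + 1) u"
    proof (rule eq_vecI)
      fix i assume "i < dim_vec (window l (n + 1) u)"
      then show "vec_index (Comp \<phi> *\<^sub>v ?v) i = vec_index (window l (n + 1) u) i"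
        using * rowS by (cases i) (auto simp: window_def)
    qed (simp add: companion_def window_def)
  qed simp
  also have "vec_index (window l (n + 1) u) 0 = u (n + int l)"
    using l by (simp add: window_def)
  finally show ?thesis using row0' by simp
qed

definition solves :: "'w \<Rightarrow> (int \<Rightarrow> complex) \<Rightarrow> bool" where
  "solves \<theta> u \<longleftrightarrow> (\<forall>n. (\<Sum>k\<in>{- int l..int l}. a k * u (n + k)) + of_real (\<epsilon> * W (ipow T n \<theta>)) * u n = of_real E * u n)"

lemma solves_iff: "solves \<theta> u \<longleftrightarrow> (\<forall>n. Comp (ipow T n \<theta>) *\<^sub>v window l n u = window l (n + 1) u)"
  by (simp add: solves_def companion_window)

lemma iter_carrier: "Iter n \<phi> \<in> carrier_mat (2 * l) (2 * l)"
  by (induction n) (auto intro: mult_carrier_mat companion_carrier)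

lemma iter_Suc_vec:
  "v \<in> carrier_vec (2 * l) \<Longrightarrow> Iter (Suc n) \<phi> *\<^sub>v v = Comp ((T ^^ n) \<phi>) *\<^sub>v (Iter n \<phi> *\<^sub>v v)"
  by (simp add: assoc_mult_mat_vec[OF companion_carrier iter_carrier])

text \<open>Peels off the earliest factor instead of the latest, as is needed for orbits that start
  at a negative time.\<close>

lemma iter_Suc_vec':
  assumes "v \<in> carrier_vec (2 * l)"
  shows "Iter (Suc n) \<phi> *\<^sub>v v = Iter n (T \<phi>) *\<^sub>v (Comp \<phi> *\<^sub>v v)"
proof (induction n)
  case 0
  then show ?case
    by (simp add: right_mult_one_mat[OF companion_carrier]
        one_mult_mat_vec[OF mult_mat_vec_carrier[OF companion_carrier assms]])
next
  case (Suc n)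
  have "Iter (Suc (Suc n)) \<phi> *\<^sub>v v = Comp ((T ^^ n) (T \<phi>)) *\<^sub>v (Iter n (T \<phi>) *\<^sub>v (Comp \<phi> *\<^sub>v v))"
    by (simp only: iter_Suc_vec[OF assms, of "Suc n"] Suc) (simp add: funpow_swap1)
  then show ?case
    by (simp only: iter_Suc_vec[OF mult_mat_vec_carrier[OF companion_carrier assms]])
qed

lemma iter_kernel:
  assumes "v \<in> carrier_vec (2 * l)" "Iter n \<phi> *\<^sub>v v = 0\<^sub>v (2 * l)"
  shows "v = 0\<^sub>v (2 * l)"
  using assms(2)
proof (induction n)
  case 0
  then show ?case using assms(1) by simp
next
  case (Suc n)
  then show ?case
    using companion_kernel[OF mult_mat_vec_carrier[OF iter_carrier assms(1)]] iter_Suc_vec[OF assms(1)] by simp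
qed

lemma back_carrier: "Back n \<phi> \<in> carrier_mat (2 * l) (2 * l)"
  unfolding companion_iter_back_def by (rule mat_inverse_mult_vec(1)[OF iter_carrier iter_kernel])

lemma iter_back:
  assumes "v \<in> carrier_vec (2 * l)"
  shows "Iter n (ipow T (- int n) \<phi>) *\<^sub>v (Back n \<phi> *\<^sub>v v) = v"
  unfolding companion_iter_back_def by (rule mat_inverse_mult_vec(3)[OF iter_carrier iter_kernel assms])

lemma iter_inj:
  assumes "v \<in> carrier_vec (2 * l)" "w \<in> carrier_vec (2 * l)" "Iter n \<phi> *\<^sub>v v = Iter n \<phi> *\<^sub>v w"
  shows "v = w"
proof -
  have "the (mat_inverse (Iter n \<phi>)) *\<^sub>v (Iter n \<phi> *\<^sub>v v) = v"
    by (rule mat_inverse_mult_vec(2)[OF iter_carrier iter_kernel assms(1)])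
  moreover have "the (mat_inverse (Iter n \<phi>)) *\<^sub>v (Iter n \<phi> *\<^sub>v w) = w"
    by (rule mat_inverse_mult_vec(2)[OF iter_carrier iter_kernel assms(2)])
  ultimately show ?thesis unfolding assms(3) by (rule trans[OF sym])
qed

lemma iter_window:
  assumes "solves \<theta> u"
  shows "Iter m (ipow T n \<theta>) *\<^sub>v window l n u = window l (n + int m) u"
proof (induction m)
  case 0
  then show ?case by (simp add: window_def)
next
  case (Suc m)
  have "Iter (Suc m) (ipow T n \<theta>) *\<^sub>v window l n u = Comp (ipow T (n + int m) \<theta>) *\<^sub>v window l (n + int m) u"
    unfolding iter_Suc_vec[OF window_carrier] Suc ipow_add_nat[OF bij] ..
  also have "\<dots> = window l (n + int m + 1) u" using assms by (simp add: solves_iff)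
  finally show ?case by (simp add: add_ac)
qed

lemma back_window:
  assumes "solves \<theta> u"
  shows "Back m \<theta> *\<^sub>v window l 0 u = window l (- int m) u"
proof (rule iter_inj)
  show "Iter m (ipow T (- int m) \<theta>) *\<^sub>v (Back m \<theta> *\<^sub>v window l 0 u)
      = Iter m (ipow T (- int m) \<theta>) *\<^sub>v window l (- int m) u"
    using iter_back[OF window_carrier] iter_window[OF assms, of m "- int m"] by simp
qed (auto intro: window_carrier mult_mat_vec_carrier[OF back_carrier])

text \<open>The orbit of v consists of windows of one sequence, because each companion step moves
  the coordinates down by one position; the sequence is read off at position l - 1.\<close>

lemma solution_through:
  assumes v: "v \<in> carrier_vec (2 * l)"
  obtains u where "solves \<theta> u" "window l 0 u = v"
proof -
  define x where "x n = (if 0 \<le> n then Iter (nat n) \<theta> *\<^sub>v v else Back (nat (- n)) \<theta> *\<^sub>v v)" for n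
  have x: "x n \<in> carrier_vec (2 * l)" for n
    using mult_mat_vec_carrier[OF iter_carrier v] mult_mat_vec_carrier[OF back_carrier v] by (simp add: x_def)
  have x0: "x 0 = v" using v by (simp add: x_def)
  have xb: "Iter m (ipow T (- int m) \<theta>) *\<^sub>v x (- int m) = v" for m
    using iter_back[OF v, of m \<theta>] v by (cases "m = 0") (auto simp: x_def ipow_0)
  have step: "x (n + 1) = Comp (ipow T n \<theta>) *\<^sub>v x n" for n
  proof (cases "0 \<le> n")
    case True
    then have "nat (n + 1) = Suc (nat n)" by simp
    then show ?thesis using True iter_Suc_vec[OF v, of "nat n" \<theta>] by (simp add: x_def ipow_def)
  next
    case False
    define m where "m = nat (- (n + 1))"
    have m: "n = - int (Suc m)" "n + 1 = - int m" using False by (auto simp: m_def)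
    have T: "T (ipow T n \<theta>) = ipow T (- int m) \<theta>" using ipow_add_1[OF bij, of n \<theta>] m(2) by simp
    \<comment> \<open>At negative times the one-step relation is not built into \<open>Back\<close>:
      both sides are carried to v by m forward steps, and these are injective.\<close>
    have "Iter m (ipow T (- int m) \<theta>) *\<^sub>v (Comp (ipow T n \<theta>) *\<^sub>v x n) = Iter (Suc m) (ipow T n \<theta>) *\<^sub>v x n"
      by (simp only: iter_Suc_vec'[OF x] T)
    also have "\<dots> = Iter m (ipow T (- int m) \<theta>) *\<^sub>v x (- int m)"
      using xb[of "Suc m"] xb[of m] by (simp only: m(1))
    finally have "Iter m (ipow T (- int m) \<theta>) *\<^sub>v (Comp (ipow T n \<theta>) *\<^sub>v x n)
      = Iter m (ipow T (- int m) \<theta>) *\<^sub>v x (- int m)" .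
    from iter_inj[OF mult_mat_vec_carrier[OF companion_carrier x] x this] show ?thesis
      unfolding m(2) by (rule sym)
  qed
  have shift: "vec_index (x (n + int k)) (i + k) = vec_index (x n) i" if "i + k < 2 * l" for n i k
    using that
  proof (induction k)
    case (Suc k)
    have "x (n + int (Suc k)) = Comp (ipow T (n + int k) \<theta>) *\<^sub>v x (n + int k)"
      using step[of "n + int k"] by (simp add: add_ac)
    moreover have "vec_index (Comp (ipow T (n + int k) \<theta>) *\<^sub>v x (n + int k)) (Suc (i + k)) = vec_index (x (n + int k)) (i + k)"
      by (rule companion_mult_vec_Suc[OF x]) (use Suc.prems in simp)
    ultimately show ?case using Suc by simp
  qed simp
  define u where "u n = vec_index (x n) (l - 1)" for n
  have win: "window l n u = x n" for n
  proof (rule eq_vecI)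
    fix i assume "i < dim_vec (x n)"
    then have i: "i < 2 * l" using x[of n] by auto
    have "u (n + int l - 1 - int i) = vec_index (x n) i"
    proof (cases "i \<le> l - 1")
      case True
      define k where "k = l - 1 - i"
      have k: "l - 1 = i + k" "n + int l - 1 - int i = n + int k"
        using True l by (auto simp: k_def)
      show ?thesis
        unfolding u_def k using True l i by (intro shift) (simp add: k_def)
    next
      case False
      define k m where "k = i - (l - 1)" and "m = n + int l - 1 - int i"
      have k: "i = (l - 1) + k" "n = m + int k"
        using False l by (auto simp: k_def m_def)
      have "vec_index (x n) i = vec_index (x (m + int k)) ((l - 1) + k)"
        using k by (intro arg_cong2[where f = vec_index] arg_cong[where f = x])
      also have "\<dots> = vec_index (x m) (l - 1)"
        using i k(1) by (intro shift) simp
      finally show ?thesis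
        unfolding m_def[symmetric] u_def by (rule sym)
    qed
    then show "vec_index (window l n u) i = vec_index (x n) i" using i by (simp add: window_def)
  qed (use x[of n] in \<open>simp add: window_def\<close>)
  have "solves \<theta> u" using step by (simp add: solves_iff win)
  then show thesis using that[of u] win[of 0] x0 by simp
qed

end

section \<open>Comparison of the center spaces\<close>

context growth_rates begin

text \<open>The indices outside the window are those lost in the zero extension. The quantity
  measures both errors: cutting a weight-bounded sequence to the window, and cutting the symbol to
  degree l.\<close>

definition window_tail :: "nat \<Rightarrow> real" where
  "window_tail l = (\<Sum>\<^sub>\<infinity>n\<in>- {- int l..int l - 1}. weight n * exp (- \<xi> * of_int \<bar>n\<bar>))"

lemma bounded_by_X_space:
  assumes "bounded_by C u"
  shows "u \<in> X_space \<xi>"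
  unfolding X_space_def mem_Collect_eq
proof (rule summable_on_comparison_test)
  show "(\<lambda>n. C * (weight n * exp (- \<xi> * of_int \<bar>n\<bar>))) summable_on UNIV"
    by (intro summable_on_cmult_right exp_weight_summable)
  show "cmod (u n) * exp (- \<xi> * of_int \<bar>n\<bar>) \<le> C * (weight n * exp (- \<xi> * of_int \<bar>n\<bar>))" for n
    using mult_right_mono[OF bounded_byD[OF assms, of n], of "exp (- \<xi> * of_int \<bar>n\<bar>)"] by (simp add: mult_ac)
qed simp

definition weight_sum :: real where
  "weight_sum = (\<Sum>\<^sub>\<infinity>n. weight n * exp (- \<xi> * of_int \<bar>n\<bar>))"

text \<open>Made for two kinds of error: one present everywhere, from replacing the symbol, and one
  confined to the outside of the window, from the zero extension.\<close>

lemma X_norm_le: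
  assumes "\<And>n. cmod (x n) \<le> B * weight n + (if n \<in> {- int l..int l - 1} then 0 else D * weight n)"
  shows "X_norm \<xi> x \<le> B * weight_sum + D * window_tail l"
proof -
  let ?F = "\<lambda>n::int. weight n * exp (- \<xi> * of_int \<bar>n\<bar>)"
  let ?S = "- {- int l..int l - 1}"
  have sm1: "(\<lambda>n. A * ?F n) summable_on X" for A X
    by (rule summable_on_subset[of _ UNIV], rule summable_on_cmult_right[OF exp_weight_summable]) simp
  have sm2: "(\<lambda>n. if n \<in> ?S then D * ?F n else 0) summable_on UNIV"
    by (rule summable_on_cong_neutral[THEN iffD1, OF _ _ _ sm1[of D ?S]]) auto
  have sm: "(\<lambda>n. B * ?F n + (if n \<in> ?S then D * ?F n else 0)) summable_on UNIV"
    by (intro summable_on_add sm1 sm2)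
  have le: "cmod (x n) * exp (- \<xi> * of_int \<bar>n\<bar>) \<le> B * ?F n + (if n \<in> ?S then D * ?F n else 0)" for n
    using mult_right_mono[OF assms[of n], of "exp (- \<xi> * of_int \<bar>n\<bar>)"]
    by (auto simp: algebra_simps split: if_splits)
  have "X_norm \<xi> x \<le> (\<Sum>\<^sub>\<infinity>n. B * ?F n + (if n \<in> ?S then D * ?F n else 0))"
    unfolding X_norm_def
  proof (rule infsum_mono[OF _ sm le])
    show "(\<lambda>n. cmod (x n) * exp (- \<xi> * of_int \<bar>n\<bar>)) summable_on UNIV"
      by (rule summable_on_comparison_test[OF sm le]) simp
  qed
  also have "\<dots> = (\<Sum>\<^sub>\<infinity>n. B * ?F n) + (\<Sum>\<^sub>\<infinity>n. if n \<in> ?S then D * ?F n else 0)"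
    by (rule infsum_add[OF sm1 sm2])
  also have "(\<Sum>\<^sub>\<infinity>n. if n \<in> ?S then D * ?F n else 0) = (\<Sum>\<^sub>\<infinity>n\<in>?S. D * ?F n)"
    by (rule infsum_cong_neutral) auto
  finally show ?thesis
    by (simp add: infsum_cmult_right' weight_sum_def window_tail_def)
qed

lemma X_space_point_bound:
  assumes "u \<in> X_space \<xi>"
  shows "cmod (u n) \<le> exp (\<xi> * of_int \<bar>n\<bar>) * X_norm \<xi> u"
proof -
  have "(\<Sum>n\<in>{n}. cmod (u n) * exp (- \<xi> * of_int \<bar>n\<bar>)) \<le> X_norm \<xi> u"
    unfolding X_norm_def using assms by (intro finite_sum_le_infsum) (auto simp: X_space_def)
  then show ?thesis
    by (simp add: exp_minus field_simps)
qed

lemma shift_X_space: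
  assumes "u \<in> X_space \<xi>"
  shows "shift m u \<in> X_space \<xi>"
  unfolding X_space_def mem_Collect_eq
proof (rule summable_on_comparison_test)
  let ?g = "\<lambda>k. cmod (u k) * exp (- \<xi> * of_int \<bar>k\<bar>)"
  have "bij_betw (\<lambda>k. k + m) UNIV UNIV" by (rule bij_betwI[of _ _ _ "\<lambda>k. k - m"]) auto
  then have "(\<lambda>k. ?g (k + m)) summable_on UNIV"
    using summable_on_reindex_bij_betw[of "\<lambda>k. k + m" UNIV UNIV ?g] assms by (simp add: X_space_def)
  then show "(\<lambda>k. exp (\<xi> * of_int \<bar>m\<bar>) * ?g (k + m)) summable_on UNIV"
    by (rule summable_on_cmult_right)
  fix k
  have "\<xi> * of_int \<bar>k + m\<bar> \<le> \<xi> * of_int (\<bar>m\<bar> + \<bar>k\<bar>)"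
    using \<xi>_pos by (intro mult_left_mono) auto
  then have "exp (- \<xi> * of_int \<bar>k\<bar>) \<le> exp (\<xi> * of_int \<bar>m\<bar>) * exp (- \<xi> * of_int \<bar>k + m\<bar>)"
    by (simp add: exp_add[symmetric] algebra_simps)
  from mult_left_mono[OF this, of "cmod (u (k + m))"]
  show "cmod (shift m u k) * exp (- \<xi> * of_int \<bar>k\<bar>) \<le> exp (\<xi> * of_int \<bar>m\<bar>) * ?g (k + m)"
    by (simp add: shift_def mult_ac)
qed simp

lemma bounded_by_shift_X_norm:
  assumes "bounded_by C u"
  shows "X_norm \<xi> (shift m u) \<le> C * weight m * weight_sum"
proof -
  have "cmod (shift m u n) \<le> C * weight m * weight n" for n
  proof -
    have "cmod (shift m u n) \<le> C * weight (n + m)" using assms by (simp add: shift_def bounded_byD)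
    also have "\<dots> \<le> C * (weight n * weight m)"
      using bounded_by_nonneg[OF assms] by (intro mult_left_mono weight_add)
    finally show ?thesis by (simp add: mult_ac)
  qed
  then have "X_norm \<xi> (shift m u) \<le> C * weight m * weight_sum + 0 * window_tail 0"
    by (intro X_norm_le) auto
  then show ?thesis by simp
qed

text \<open>Applied twice: to norms of the shifts of u for the center bundle, and to norms of the
  windows of u for the cocycle.\<close>

lemma weight_bound:
  assumes "\<And>n::nat. inverse rp ^ n * f (int n) \<le> B" "\<And>n::nat. rm ^ n * f (- int n) \<le> D"
  shows "f n \<le> max B D * weight n"
proof (cases "0 \<le> n")
  case True
  then obtain m where m: "n = int m" using nonneg_int_cases by blast
  have "f n \<le> B * rp ^ m"
    using assms(1)[of m] rp_pos by (simp add: m power_inverse field_simps)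
  also have "\<dots> \<le> max B D * rp ^ m" using rp_pos by (intro mult_right_mono) auto
  finally show ?thesis by (simp add: m weight_of_nat)
next
  case False
  then obtain m where m: "n = - int m" by (metis int_cases2 nle_le of_nat_0_le_iff)
  have "f n \<le> D * inverse (rm ^ m)"
    using assms(2)[of m] rm_pos by (simp add: m field_simps)
  also have "\<dots> \<le> max B D * inverse (rm ^ m)" using rm_pos by (intro mult_right_mono) auto
  finally show ?thesis by (simp add: m weight_of_minus_nat)
qed

text \<open>The growth conditions on shifted norms amount to one pointwise weight bound: |u(n)| is
  at most the norm of the n-th shift in one direction, and the weight is submultiplicative in the
  other.\<close>

lemma center_bundle_eq:
  "center_bundle \<xi> rm rp V W T E \<epsilon> \<theta> =
    {u. (\<exists>C. bounded_by C u) \<and> L_op V \<epsilon> W T \<theta> u = (\<lambda>n. of_real E * u n)}" (is "?M = ?N")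
proof (rule Set.set_eqI, rule iffI)
  fix u assume u: "u \<in> ?M"
  then have X: "u \<in> X_space \<xi>" by (simp add: center_bundle_def)
  from u obtain B D where "\<And>n::nat. inverse rp ^ n * X_norm \<xi> (shift (int n) u) \<le> B"
    "\<And>n::nat. rm ^ n * X_norm \<xi> (shift (- int n) u) \<le> D"
    unfolding center_bundle_def bdd_above_def by auto
  from weight_bound[of "\<lambda>n. X_norm \<xi> (shift n u)", OF this]
  have "X_norm \<xi> (shift n u) \<le> max B D * weight n" for n .
  moreover have "cmod (u n) \<le> X_norm \<xi> (shift n u)" for n
    using X_space_point_bound[OF shift_X_space[OF X], of n 0] by (simp add: shift_def)
  ultimately have "bounded_by (max B D) u"
    unfolding bounded_by_def by (meson order_trans)
  with u show "u \<in> ?N" by (auto simp: center_bundle_def)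
next
  fix u assume "u \<in> ?N"
  then obtain C where C: "bounded_by C u" and L: "L_op V \<epsilon> W T \<theta> u = (\<lambda>n. of_real E * u n)" by auto
  have "inverse rp ^ n * X_norm \<xi> (shift (int n) u) \<le> C * weight_sum" for n
    using bounded_by_shift_X_norm[OF C, of "int n"] rp_pos
    by (simp add: weight_of_nat power_inverse field_simps)
  moreover have "rm ^ n * X_norm \<xi> (shift (- int n) u) \<le> C * weight_sum" for n
    using bounded_by_shift_X_norm[OF C, of "- int n"] rm_pos
    by (simp add: weight_of_minus_nat field_simps)
  ultimately show "u \<in> ?M"
    using L bounded_by_X_space[OF C] unfolding center_bundle_def
    by (auto intro!: bdd_aboveI2)
qed

lemma window_tail_tendsto: "window_tail \<longlonglongrightarrow> 0"
proof -
  let ?F = "\<lambda>n::int. weight n * exp (- \<xi> * of_int \<bar>n\<bar>)"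
  let ?W = "\<lambda>l::nat. {- int l..int l - 1}"
  have fl: "filterlim ?W (finite_subsets_at_top UNIV) sequentially"
    unfolding filterlim_finite_subsets_at_top
  proof (intro allI impI)
    fix X :: "int set" assume X: "finite X \<and> X \<subseteq> UNIV"
    define L where "L = nat (Max (insert 0 (abs ` X))) + 1"
    have "X \<subseteq> ?W l" if "L \<le> l" for l
    proof
      fix x assume "x \<in> X"
      then have "\<bar>x\<bar> \<le> Max (insert 0 (abs ` X))" using X by (intro Max_ge) auto
      then have "\<bar>x\<bar> < int L" unfolding L_def by linarith
      then show "x \<in> ?W l" using that by auto
    qed
    then show "\<forall>\<^sub>F l in sequentially. finite (?W l) \<and> X \<subseteq> ?W l \<and> ?W l \<subseteq> UNIV"
      by (intro eventually_sequentiallyI[of L]) auto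
  qed
  have "(sum ?F \<longlongrightarrow> weight_sum) (finite_subsets_at_top UNIV)"
    using has_sum_infsum[OF exp_weight_summable] by (simp add: has_sum_def weight_sum_def)
  from filterlim_compose[OF this fl] have lim: "(\<lambda>l. sum ?F (?W l)) \<longlonglongrightarrow> weight_sum" .
  have "window_tail l = weight_sum - sum ?F (?W l)" for l
  proof -
    have "infsum ?F (?W l \<union> - ?W l) = infsum ?F (?W l) + infsum ?F (- ?W l)"
      by (intro infsum_Un_disjoint summable_on_subset[OF exp_weight_summable]) auto
    then show ?thesis by (simp add: weight_sum_def window_tail_def)
  qed
  then have "window_tail = (\<lambda>l. weight_sum - sum ?F (?W l))" by blast
  then show ?thesis
    using tendsto_diff[OF tendsto_const[of weight_sum] lim] by simp
qed

end

section \<open>The center subspace as windows of weight-bounded solutions\<close>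

locale companion_growth = growth_rates + companion_setup
begin

lemma cvec_norm_window_ge: "cmod (u n) \<le> cvec_norm (window l n u)"
proof -
  have "cmod (u n) = cmod (vec_index (window l n u) (l - 1))"
    using l of_nat_diff[of 1 l, where ?'a = int] by (simp add: window_def)
  also have "\<dots> \<le> cvec_norm (window l n u)"
    unfolding cvec_norm_def using l
    by (intro member_le_L2_set[of _ _ "\<lambda>i. cmod (vec_index (window l n u) i)"]) (auto simp: window_def)
  finally show ?thesis .
qed

text \<open>The constant depends on l, which is harmless: it serves to verify the growth conditions
  and never enters the gap estimate.\<close>

lemma cvec_norm_window_le:
  assumes "bounded_by C u"
  shows "cvec_norm (window l n u) \<le> C * (\<Sum>i<2 * l. weight (int l - 1 - int i)) * weight n"
proof -
  have "cvec_norm (window l n u) \<le> (\<Sum>i<2 * l. cmod (vec_index (window l n u) i))"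
    unfolding cvec_norm_def by (rule order_trans[OF L2_set_le_sum]) (auto simp: window_def)
  also have "\<dots> \<le> (\<Sum>i<2 * l. C * (weight (int l - 1 - int i) * weight n))"
  proof (rule sum_mono)
    fix i assume "i \<in> {..<2 * l}"
    then have "cmod (vec_index (window l n u) i) \<le> C * weight (int l - 1 - int i + n)"
      using bounded_byD[OF assms, of "int l - 1 - int i + n"] by (simp add: window_def algebra_simps)
    also have "\<dots> \<le> C * (weight (int l - 1 - int i) * weight n)"
      using bounded_by_nonneg[OF assms] by (intro mult_left_mono weight_add)
    finally show "cmod (vec_index (window l n u) i) \<le> C * (weight (int l - 1 - int i) * weight n)" .
  qed
  also have "\<dots> = C * (\<Sum>i<2 * l. weight (int l - 1 - int i)) * weight n"
    by (simp add: sum_distrib_left sum_distrib_right mult_ac)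
  finally show ?thesis .
qed

text \<open>Every vector is the window at 0 of a solution, and its images under the cocycle are the
  other windows. As u(n) is an entry of the window at n, growth of windows and weight bounds on u
  are equivalent.\<close>

lemma center_subspace_eq:
  "center_subspace rm rp V W T E \<epsilon> l \<theta> = window l 0 ` {u. solves \<theta> u \<and> (\<exists>C. bounded_by C u)}" (is "?M = ?N")
proof (rule Set.set_eqI, rule iffI)
  fix v assume v: "v \<in> ?M"
  then have vc: "v \<in> carrier_vec (2 * l)" by (simp add: center_subspace_def)
  then obtain u where u: "solves \<theta> u" "window l 0 u = v" by (rule solution_through)
  from v obtain B D where "\<And>n::nat. inverse rp ^ n * cvec_norm (window l (int n) u) \<le> B"
    "\<And>n::nat. rm ^ n * cvec_norm (window l (- int n) u) \<le> D"
    using iter_window[OF u(1), of _ 0] back_window[OF u(1)]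
    unfolding center_subspace_def bdd_above_def by (auto simp: ipow_0 u(2))
  from weight_bound[of "\<lambda>n. cvec_norm (window l n u)", OF this]
  have "cvec_norm (window l n u) \<le> max B D * weight n" for n .
  then have "bounded_by (max B D) u"
    unfolding bounded_by_def using cvec_norm_window_ge by (meson order_trans)
  then show "v \<in> ?N" using u by blast
next
  fix v assume "v \<in> ?N"
  then obtain u C where u: "solves \<theta> u" "v = window l 0 u" and C: "bounded_by C u" by auto
  define D where "D = C * (\<Sum>i<2 * l. weight (int l - 1 - int i))"
  have it: "companion_iter V W T E \<epsilon> l n \<theta> *\<^sub>v v = window l (int n) u" for n
    using iter_window[OF u(1), of n 0] by (simp add: ipow_0 u(2))
  have bk: "companion_iter_back V W T E \<epsilon> l n \<theta> *\<^sub>v v = window l (- int n) u" for n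
    using back_window[OF u(1)] by (simp add: u(2))
  have "inverse rp ^ n * cvec_norm (window l (int n) u) \<le> D" for n
    using cvec_norm_window_le[OF C, of "int n", folded D_def] rp_pos
    by (simp add: weight_of_nat power_inverse field_simps)
  moreover have "rm ^ n * cvec_norm (window l (- int n) u) \<le> D" for n
    using cvec_norm_window_le[OF C, of "- int n", folded D_def] rm_pos
    by (simp add: weight_of_minus_nat field_simps)
  ultimately show "v \<in> ?M"
    unfolding center_subspace_def it bk using window_carrier[of l 0 u]
    by (auto intro!: bdd_aboveI2 simp: u(2)[symmetric] it bk)
qed

end

section \<open>Gap estimates and truncation\<close>

context growth_rates begin

definition truncate_to_window :: "nat \<Rightarrow> (int \<Rightarrow> complex) \<Rightarrow> int \<Rightarrow> complex" where
  "truncate_to_window l u = (\<lambda>n. if n \<in> {- int l..int l - 1} then u n else 0)"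

lemma zero_extension_window: "zero_extension l (window l 0 u) = truncate_to_window l u"
  by (auto simp: zero_extension_def window_def truncate_to_window_def fun_eq_iff)

lemma one_sided_gap_le:
  assumes "\<And>u. u \<in> M \<Longrightarrow> X_norm \<xi> u = 1 \<Longrightarrow> \<exists>w\<in>N. X_norm \<xi> (\<lambda>n. u n - w n) \<le> b"
  shows "one_sided_gap \<xi> M N \<le> ennreal b"
  unfolding one_sided_gap_def
proof (rule SUP_least)
  fix u assume "u \<in> {u \<in> M. X_norm \<xi> u = 1}"
  then obtain w where w: "w \<in> N" "X_norm \<xi> (\<lambda>n. u n - w n) \<le> b" using assms by blast
  show "X_dist \<xi> u N \<le> ennreal b"
    unfolding X_dist_def by (rule INF_lower2[OF w(1)]) (use w(2) in \<open>simp add: ennreal_leI\<close>)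
qed

text \<open>A unit vector has values at most exp (\<xi> d) on 0, ..., d - 1, hence the solution has
  bound B, hence there is a solution of the other kind within \<delta>; \<open>window_tail\<close>
  pays for the truncation. \<open>P\<close> and \<open>Q\<close> are abstract so that no equation
  intrudes.\<close>

lemma gap_truncation_le:
  assumes P_bound: "\<And>u C. bounded_by C u \<Longrightarrow> P u \<Longrightarrow> (\<And>j. j < d \<Longrightarrow> cmod (u (int j)) \<le> exp (\<xi> * d)) \<Longrightarrow> bounded_by B u"
    and Q_bound: "\<And>u C. bounded_by C u \<Longrightarrow> Q u \<Longrightarrow> (\<And>j. j < d \<Longrightarrow> cmod (u (int j)) \<le> exp (\<xi> * d)) \<Longrightarrow> bounded_by B u"
    and PQ: "\<And>u. bounded_by B u \<Longrightarrow> P u \<Longrightarrow> \<exists>w. Q w \<and> bounded_by \<delta> (\<lambda>n. w n - u n)"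
    and QP: "\<And>u. bounded_by B u \<Longrightarrow> Q u \<Longrightarrow> \<exists>w. P w \<and> bounded_by \<delta> (\<lambda>n. w n - u n)"
    and d: "d \<le> l"
  shows "gap \<xi> (truncate_to_window l ` {u. P u \<and> (\<exists>C. bounded_by C u)}) {u. (\<exists>C. bounded_by C u) \<and> Q u}
    \<le> ennreal (\<delta> * weight_sum + B * window_tail l)"
proof -
  have pt: "cmod (x (int j)) \<le> exp (\<xi> * d)" if "x \<in> X_space \<xi>" "X_norm \<xi> x = 1" "j < d" for x j
  proof -
    have "cmod (x (int j)) \<le> exp (\<xi> * j)"
      using X_space_point_bound[OF that(1), of "int j"] that(2) by simp
    also have "\<dots> \<le> exp (\<xi> * d)" using \<xi>_pos that(3) by simp
    finally show ?thesis .
  qed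
  have bdd: "\<exists>C. bounded_by C w" if "bounded_by B u" "bounded_by \<delta> (\<lambda>n. w n - u n)" for u w
    using bounded_by_add[OF that] by auto
  have close: "X_norm \<xi> (\<lambda>n. truncate_to_window l u n - w n) \<le> \<delta> * weight_sum + B * window_tail l"
    if "bounded_by B u" "bounded_by \<delta> (\<lambda>n. w n - u n)" for u w
  proof (rule X_norm_le)
    fix n
    have "cmod (w n - u n) \<le> \<delta> * weight n" "cmod (u n) \<le> B * weight n"
      using that by (auto intro: bounded_byD)
    then show "cmod (truncate_to_window l u n - w n)
      \<le> \<delta> * weight n + (if n \<in> {- int l..int l - 1} then 0 else B * weight n)"
      using norm_triangle_ineq[of "w n - u n" "u n"]
      by (auto simp: truncate_to_window_def norm_minus_commute)
  qed
  have close': "X_norm \<xi> (\<lambda>n. u n - truncate_to_window l w n) \<le> \<delta> * weight_sum + B * window_tail l"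
    if "bounded_by B u" "bounded_by \<delta> (\<lambda>n. w n - u n)" for u w
  proof (rule X_norm_le)
    fix n
    have "cmod (w n - u n) \<le> \<delta> * weight n" "cmod (u n) \<le> B * weight n" "0 \<le> \<delta> * weight n"
      using that order_trans[OF norm_ge_zero] by (auto intro: bounded_byD)
    then show "cmod (u n - truncate_to_window l w n)
      \<le> \<delta> * weight n + (if n \<in> {- int l..int l - 1} then 0 else B * weight n)"
      by (auto simp: truncate_to_window_def norm_minus_commute)
  qed
  show ?thesis
    unfolding gap_def
  proof (rule max.boundedI; rule one_sided_gap_le)
    fix x assume x: "x \<in> truncate_to_window l ` {u. P u \<and> (\<exists>C. bounded_by C u)}" "X_norm \<xi> x = 1"
    then obtain u C where u: "x = truncate_to_window l u" "P u" "bounded_by C u" by blast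
    have "bounded_by C x"
      using u(3) bounded_by_nonneg[OF u(3)]
      by (auto simp: u(1) bounded_by_def truncate_to_window_def intro!: mult_nonneg_nonneg less_imp_le[OF weight_pos])
    then have "x \<in> X_space \<xi>" by (rule bounded_by_X_space)
    \<comment> \<open>Only the truncation \<open>x\<close> has norm 1, but d \<le> l puts 0, ..., d
      - 1 inside the window, where \<open>x\<close> and \<open>u\<close> agree.\<close>
    then have "cmod (u (int j)) \<le> exp (\<xi> * d)" if "j < d" for j
      using pt[OF _ x(2) that] that d by (simp add: u(1) truncate_to_window_def)
    with u have uB: "bounded_by B u" by (intro P_bound)
    obtain w where w: "Q w" "bounded_by \<delta> (\<lambda>n. w n - u n)" using PQ[OF uB u(2)] by blast
    show "\<exists>w\<in>{u. (\<exists>C. bounded_by C u) \<and> Q u}. X_norm \<xi> (\<lambda>n. x n - w n) \<le> \<delta> * weight_sum + B * window_tail l"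
      using bdd[OF uB w(2)] w(1) close[OF uB w(2)] by (intro bexI[of _ w]) (auto simp: u(1))
  next
    fix u assume u: "u \<in> {u. (\<exists>C. bounded_by C u) \<and> Q u}" "X_norm \<xi> u = 1"
    then obtain C where C: "bounded_by C u" and Qu: "Q u" by blast
    have "cmod (u (int j)) \<le> exp (\<xi> * d)" if "j < d" for j
      by (rule pt[OF bounded_by_X_space[OF C] u(2) that])
    with C Qu have uB: "bounded_by B u" by (intro Q_bound)
    obtain w where w: "P w" "bounded_by \<delta> (\<lambda>n. w n - u n)" using QP[OF uB Qu] by blast
    show "\<exists>w\<in>truncate_to_window l ` {u. P u \<and> (\<exists>C. bounded_by C u)}. X_norm \<xi> (\<lambda>n. u n - w n)
        \<le> \<delta> * weight_sum + B * window_tail l"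
      using bdd[OF uB w(2)] w(1) close'[OF uB w(2)]
      by (intro bexI[of _ "truncate_to_window l w"]) auto
  qed
qed

definition truncated_symbol :: "nat \<Rightarrow> (int \<Rightarrow> complex) \<Rightarrow> int \<Rightarrow> complex" where
  "truncated_symbol l f = (\<lambda>k. if k \<in> {- int l..int l} then f k else 0)"

lemma conv_truncated_symbol:
  "conv (truncated_symbol l f) u n = (\<Sum>k\<in>{- int l..int l}. f k * u (n + k))"
proof -
  have "conv (truncated_symbol l f) u n = (\<Sum>\<^sub>\<infinity>k\<in>{- int l..int l}. f k * u (n + k))"
    unfolding conv_def by (rule infsum_cong_neutral) (auto simp: truncated_symbol_def)
  then show ?thesis by simp
qed

lemma wsummable_truncated_symbol: "wsummable (truncated_symbol l f)"
proof -
  have "(\<lambda>k. cmod (f k) * weight k) summable_on {- int l..int l}" by simp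
  then show ?thesis
    unfolding wsummable_def
    by (rule summable_on_cong_neutral[THEN iffD1, rotated -1]) (auto simp: truncated_symbol_def)
qed

text \<open>The truncated symbol keeps index l, which the window omits, so the difference is
  supported outside the window and the same tail bounds it.\<close>

lemma wnorm_diff_truncated_symbol:
  assumes C: "\<And>k. cmod (f k) \<le> C * exp (- \<xi> * of_int \<bar>k\<bar>)"
  shows "wnorm (\<lambda>k. f k - truncated_symbol l f k) \<le> C * window_tail l"
proof -
  have f: "wsummable f" using C by (intro decaying_wsummable) (auto simp: decaying_def)
  have "wnorm (\<lambda>k. f k - truncated_symbol l f k)
      \<le> (\<Sum>\<^sub>\<infinity>k\<in>- {- int l..int l - 1}. C * (weight k * exp (- \<xi> * of_int \<bar>k\<bar>)))"
    unfolding wnorm_def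
  proof (rule infsum_mono_neutral)
    show "(\<lambda>k. cmod (f k - truncated_symbol l f k) * weight k) summable_on UNIV"
      using wsummable_diff[OF f wsummable_truncated_symbol] by (simp add: wsummable_def)
    show "(\<lambda>k. C * (weight k * exp (- \<xi> * of_int \<bar>k\<bar>))) summable_on - {- int l..int l - 1}"
      by (rule summable_on_subset[of _ UNIV], rule summable_on_cmult_right[OF exp_weight_summable]) simp
    fix k
    have "cmod (f k - truncated_symbol l f k) \<le> cmod (f k)" by (simp add: truncated_symbol_def)
    then have "cmod (f k - truncated_symbol l f k) \<le> C * exp (- \<xi> * of_int \<bar>k\<bar>)"
      using C[of k] by linarith
    from mult_right_mono[OF this less_imp_le[OF weight_pos[of k]]]
    show "cmod (f k - truncated_symbol l f k) * weight k \<le> C * (weight k * exp (- \<xi> * of_int \<bar>k\<bar>))"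
      by (simp add: mult_ac)
  qed (auto simp: truncated_symbol_def)
  then show ?thesis
    by (simp add: infsum_cmult_right' window_tail_def)
qed

end

section \<open>The symbol V - E and the two eigenvalue equations\<close>

definition shifted_symbol :: "(real \<Rightarrow> real) \<Rightarrow> real \<Rightarrow> int \<Rightarrow> complex" where
  "shifted_symbol V E k = fourier_coeff V k - (if k = 0 then of_real E else 0)"

lemma (in growth_rates) conv_shifted_symbol:
  assumes "wsummable (fourier_coeff V)" "bounded_by C u"
  shows "conv (shifted_symbol V E) u n = conv (fourier_coeff V) u n - of_real E * u n"
proof -
  have "((\<lambda>k. fourier_coeff V k * u (n + k)) has_sum conv (fourier_coeff V) u n) UNIV"
    unfolding conv_def by (rule has_sum_infsum[OF conv_summable[OF assms]])
  moreover have "((\<lambda>k. - (if k = 0 then of_real E else 0) * u (n + k)) has_sum - of_real E * u n) UNIV"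
  proof -
    have "((\<lambda>k. - of_real E * u (n + k)) has_sum - of_real E * u n) {0}"
      using has_sum_finite[of "{0::int}" "\<lambda>k. - of_real E * u (n + k)"] by simp
    then show ?thesis
      by (rule has_sum_cong_neutral[THEN iffD1, rotated -1]) auto
  qed
  ultimately have "((\<lambda>k. shifted_symbol V E k * u (n + k)) has_sum
      conv (fourier_coeff V) u n + - of_real E * u n) UNIV"
    using has_sum_add by (fastforce simp: shifted_symbol_def algebra_simps)
  then show ?thesis by (simp add: conv_def infsumI)
qed

lemma (in growth_rates) L_op_eigen_iff:
  assumes "wsummable (fourier_coeff V)" "bounded_by C u"
  shows "L_op V \<epsilon> W T \<theta> u = (\<lambda>n. of_real E * u n) \<longleftrightarrow>
    conv (shifted_symbol V E) u = (\<lambda>n. - of_real (\<epsilon> * W (ipow T n \<theta>)) * u n)"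
proof -
  have "L_op V \<epsilon> W T \<theta> u n = of_real E * u n \<longleftrightarrow>
      conv (shifted_symbol V E) u n = - of_real (\<epsilon> * W (ipow T n \<theta>)) * u n" for n
    unfolding conv_shifted_symbol[OF assms] by (auto simp: L_op_def conv_def algebra_simps)
  then show ?thesis by (simp add: fun_eq_iff)
qed

context companion_growth begin

text \<open>Index 0 always lies in - l, ..., l, so truncation commutes with the subtraction of
  E.\<close>

lemma solves_iff_conv:
  "solves \<theta> u \<longleftrightarrow> conv (truncated_symbol l (shifted_symbol V E)) u = (\<lambda>n. - of_real (\<epsilon> * W (ipow T n \<theta>)) * u n)"
proof -
  have shifted: "(\<Sum>k\<in>{- int l..int l}. shifted_symbol V E k * u (n + k))
      = (\<Sum>k\<in>{- int l..int l}. a k * u (n + k)) - of_real E * u n" for n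
  proof -
    have "(\<Sum>k\<in>{- int l..int l}. shifted_symbol V E k * u (n + k))
        = (\<Sum>k\<in>{- int l..int l}. a k * u (n + k) - (if k = 0 then of_real E * u (n + k) else 0))"
      by (intro sum.cong) (auto simp: shifted_symbol_def algebra_simps)
    also have "\<dots> = (\<Sum>k\<in>{- int l..int l}. a k * u (n + k)) - (\<Sum>k\<in>{- int l..int l}. if k = 0 then of_real E * u (n + k) else 0)"
      by (rule sum_subtractf)
    finally show ?thesis by simp
  qed
  have "(\<Sum>k\<in>{- int l..int l}. a k * u (n + k)) + of_real (\<epsilon> * W (ipow T n \<theta>)) * u n = of_real E * u n
    \<longleftrightarrow> conv (truncated_symbol l (shifted_symbol V E)) u n = - of_real (\<epsilon> * W (ipow T n \<theta>)) * u n" for n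
    unfolding conv_truncated_symbol shifted by (auto simp: algebra_simps)
  then show ?thesis by (simp add: solves_def fun_eq_iff)
qed

lemma embedded_center_eq:
  "embedded_center rm rp V W T E \<epsilon> l \<theta> = truncate_to_window l `
    {u. conv (truncated_symbol l (shifted_symbol V E)) u = (\<lambda>n. - of_real (\<epsilon> * W (ipow T n \<theta>)) * u n)
      \<and> (\<exists>C. bounded_by C u)}"
  unfolding embedded_center_def center_subspace_eq image_image zero_extension_window solves_iff_conv ..

end

text \<open>V is real-valued. Hence the coefficient at - l is nonzero together with the one at l,
  which makes the companion matrix invertible.\<close>

lemma fourier_coeff_uminus: "fourier_coeff V (- n) = cnj (fourier_coeff V n)"
  unfolding fourier_coeff_def integral_cnj by (intro integral_cong) (simp add: cis_cnj)

lemma fourier_coeff_decay: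
  assumes "extends_to_annulus V h" "0 < \<xi>" "\<xi> < h"
  shows "\<exists>C. \<forall>n. cmod (fourier_coeff V n) \<le> C * exp (- \<xi> * of_int \<bar>n\<bar>)"
proof -
  obtain F where F: "F holomorphic_on annulus h" "\<And>x. F (cis (2 * pi * x)) = of_real (V x)"
    using assms(1) by (auto simp: extends_to_annulus_def)
  have "fourier_coeff V n = circle_coeff F n" for n
    by (simp add: fourier_coeff_def circle_coeff_def F(2))
  then show ?thesis using circle_coeff_decay[OF F(1) assms(2,3)] by simp
qed

lemma (in growth_rates) laurent_shifted_symbol:
  assumes "decaying (fourier_coeff V)" "z \<in> annulus \<xi>"
  shows "laurent (shifted_symbol V E) z = symbol V z - of_real E"
proof -
  have "((\<lambda>k. fourier_coeff V k * z powi k) has_sum symbol V z) UNIV"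
    using laurent_has_sum[OF assms] by (simp add: symbol_def laurent_def)
  moreover have "((\<lambda>k. - (if k = 0 then of_real E else 0) * z powi k) has_sum - of_real E) UNIV"
  proof -
    have "((\<lambda>k. - of_real E * z powi k) has_sum - of_real E) {0}"
      using has_sum_finite[of "{0::int}" "\<lambda>k. - of_real E * z powi k"] by simp
    then show ?thesis
      by (rule has_sum_cong_neutral[THEN iffD1, rotated -1]) auto
  qed
  ultimately have "((\<lambda>k. shifted_symbol V E k * z powi k) has_sum symbol V z + - of_real E) UNIV"
    using has_sum_add by (fastforce simp: shifted_symbol_def algebra_simps)
  then show ?thesis by (simp add: laurent_def infsumI)
qed

lemma (in growth_rates) decaying_shifted_symbol:
  assumes "decaying (fourier_coeff V)"
  shows "decaying (shifted_symbol V E)"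
proof -
  obtain C where C: "0 \<le> C" "\<And>n. cmod (fourier_coeff V n) \<le> C * exp (- \<xi> * of_int \<bar>n\<bar>)"
    using decayingE[OF assms] by blast
  have "cmod (shifted_symbol V E n) \<le> (C + \<bar>E\<bar>) * exp (- \<xi> * of_int \<bar>n\<bar>)" for n
  proof (cases "n = 0")
    case True
    have "cmod (shifted_symbol V E 0) \<le> cmod (fourier_coeff V 0) + \<bar>E\<bar>"
      unfolding shifted_symbol_def using norm_triangle_ineq4[of "fourier_coeff V 0" "of_real E"] by simp
    then show ?thesis using C(2)[of 0] True by simp
  next
    case False
    have "C * exp (- \<xi> * of_int \<bar>n\<bar>) \<le> (C + \<bar>E\<bar>) * exp (- \<xi> * of_int \<bar>n\<bar>)"
      by (intro mult_right_mono) auto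
    from order_trans[OF C(2) this] show ?thesis using False by (simp add: shifted_symbol_def)
  qed
  then show ?thesis by (auto simp: decaying_def)
qed

theorem proposition7p2:
  fixes T :: "'w::metric_space \<Rightarrow> 'w"
    and A :: "('w \<Rightarrow> complex) set"
    and N :: "('w \<Rightarrow> complex) \<Rightarrow> real"
    and W :: "'w \<Rightarrow> real"
    and V :: "real \<Rightarrow> real"
    and h \<xi> E rm rp :: real
  assumes "topological_dynamical_system T"
    and "admissible T A N"
    and "(\<lambda>\<theta>. complex_of_real (W \<theta>)) \<in> A"
    and "continuous_on UNIV W"
    and "real_analytic_circle V"
    and "\<exists>x y. V x \<noteq> V y"
    and "extends_to_annulus V h"
    and "0 < \<xi>" and "\<xi> < h"
    and "exp (- \<xi>) < rm" and "rm < 1" and "1 < rp" and "rp < exp \<xi>"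
    and "\<forall>z. rm \<le> cmod z \<and> cmod z \<le> rp \<and> symbol V z - of_real E = 0 \<longrightarrow> cmod z = 1"
  shows "\<exists>\<epsilon>0>0. \<forall>\<epsilon>::real. \<bar>\<epsilon>\<bar> < \<epsilon>0 \<longrightarrow>
    ((\<lambda>l. SUP \<theta>. gap \<xi> (embedded_center rm rp V W T E \<epsilon> l \<theta>) (center_bundle \<xi> rm rp V W T E \<epsilon> \<theta>))
       \<longlongrightarrow> 0) (inf sequentially (principal {l. fourier_coeff V (int l) \<noteq> 0}))"
proof -
  interpret growth_rates \<xi> rm rp
    using assms(8,10-13) by unfold_locales
  define f where "f = shifted_symbol V E"
  have dV: "decaying (fourier_coeff V)"
    using fourier_coeff_decay[OF assms(7-9)] by (simp add: decaying_def)
  have df: "decaying f" unfolding f_def by (rule decaying_shifted_symbol[OF dV])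
  have wV: "wsummable (fourier_coeff V)" and wf: "wsummable f"
    using dV df by (auto intro: decaying_wsummable)
  obtain C where C: "0 \<le> C" "\<And>n. cmod (f n) \<le> C * exp (- \<xi> * of_int \<bar>n\<bar>)"
    using decayingE[OF df] by blast
  have zeros: "cmod z = 1" if "z \<in> closed_annulus" "laurent f z = 0" for z
    using that assms(14) laurent_shifted_symbol[OF dV subsetD[OF closed_annulus_subset that(1)], of E]
    by (simp add: f_def)
  obtain g c zs where "factored_symbol \<xi> rm rp f g c zs"
    using factored_symbol_exists[OF df zeros] by blast
  then interpret factored_symbol \<xi> rm rp f g c zs .
  define d where "d = length zs"
  obtain \<eta> K where "0 < \<eta>" "0 \<le> K"
    and apriori: "\<And>f1 p u a C. wsummable f1 \<Longrightarrow> wnorm (\<lambda>k. f k - f1 k) \<le> \<eta> \<Longrightarrow> (\<And>n. cmod (p n) \<le> \<eta>) \<Longrightarrow>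
       bounded_by C u \<Longrightarrow> conv f1 u = (\<lambda>n. - p n * u n) \<Longrightarrow> 0 \<le> a \<Longrightarrow>
       (\<And>j. j < d \<Longrightarrow> cmod (u (int j)) \<le> a) \<Longrightarrow> bounded_by (K * a) u"
    and perturb: "\<And>f1 f2 p u C. wsummable f1 \<Longrightarrow> wsummable f2 \<Longrightarrow> wnorm (\<lambda>k. f k - f2 k) \<le> \<eta> \<Longrightarrow>
       (\<And>n. cmod (p n) \<le> \<eta>) \<Longrightarrow> bounded_by C u \<Longrightarrow> conv f1 u = (\<lambda>n. - p n * u n) \<Longrightarrow>
       \<exists>w. conv f2 w = (\<lambda>n. - p n * w n) \<and>
         bounded_by (K * wnorm (\<lambda>k. f1 k - f2 k) * C) (\<lambda>n. w n - u n)"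
  proof (rule solutions_of_perturbations, goal_cases)
    case (1 \<eta> K)
    from 1(2-5) show ?case by (rule 1(1)[unfolded d_def])
  qed
  \<comment> \<open>The algebra norm dominates the sup norm, so it bounds |W|; adding 1 makes
    \<open>B\<close> positive, fit to divide \<eta>.\<close>
  define B where "B = N (\<lambda>\<theta>. complex_of_real (W \<theta>)) + 1"
  have W: "\<bar>W \<theta>\<bar> \<le> B" and B: "0 < B" for \<theta>
  proof -
    have "\<forall>f\<in>A. \<forall>x. cmod (f x) \<le> N f"
      using assms(2) unfolding admissible_def by blast
    from bspec[OF this assms(3)] have "cmod (complex_of_real (W \<theta>)) \<le> N (\<lambda>\<theta>. complex_of_real (W \<theta>))"
      by (rule spec)
    then show "\<bar>W \<theta>\<bar> \<le> B" "0 < B" by (auto simp: B_def)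
  qed
  have bij: "bij T"
    using assms(1) unfolding topological_dynamical_system_def homeomorphism_def
    by (auto simp: bij_def intro: inj_on_inverseI)
  \<comment> \<open>The a priori bound for initial values at most exp (\<xi> d), which is what norm
    1 ensures; it holds for the full and for the truncated symbol.\<close>
  define D where "D = K * exp (\<xi> * d)"
  \<comment> \<open>Error of replacing the symbol plus error of truncating the sequence. It is free
    of \<theta>, since W enters only through |\<epsilon> W| \<le> \<eta>.\<close>
  define b where "b l = K * (C * window_tail l) * D * weight_sum + D * window_tail l" for l
  have b_lim: "b \<longlonglongrightarrow> 0"
  proof -
    have "b \<longlonglongrightarrow> K * (C * 0) * D * weight_sum + D * 0"
      unfolding b_def by (intro tendsto_intros window_tail_tendsto)
    then show ?thesis by simp
  qed
  have "weight_sum \<ge> 0"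
    unfolding weight_sum_def by (intro infsum_nonneg) (simp add: weight_pos less_imp_le)
  show ?thesis
  proof (intro exI[of _ "\<eta> / B"] conjI allI impI)
    show "0 < \<eta> / B" using \<open>0 < \<eta>\<close> B by simp
    fix \<epsilon> :: real assume "\<bar>\<epsilon>\<bar> < \<eta> / B"
    then have "\<bar>\<epsilon>\<bar> * B \<le> \<eta>" using B by (simp add: field_simps)
    then have p: "cmod (of_real (\<epsilon> * W \<phi>)) \<le> \<eta>" for \<phi>
      using mult_left_mono[OF W, of "\<bar>\<epsilon>\<bar>" \<phi>] by (simp add: abs_mult del: of_real_mult)
    have gap_le: "gap \<xi> (embedded_center rm rp V W T E \<epsilon> l \<theta>) (center_bundle \<xi> rm rp V W T E \<epsilon> \<theta>) \<le> ennreal (b l)"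
      if large: "1 \<le> l" "d \<le> l" "C * window_tail l \<le> \<eta>" "fourier_coeff V (int l) \<noteq> 0" for l \<theta>
    proof -
      interpret companion_growth \<xi> rm rp V W T E \<epsilon> l
        using bij large fourier_coeff_uminus[of V "int l"] by unfold_locales auto
      let ?f = "truncated_symbol l f"
      let ?p = "\<lambda>n. complex_of_real (\<epsilon> * W (ipow T n \<theta>))"
      let ?P = "\<lambda>u. conv ?f u = (\<lambda>n. - ?p n * u n)" and ?Q = "\<lambda>u. conv f u = (\<lambda>n. - ?p n * u n)"
      let ?\<delta> = "wnorm (\<lambda>k. f k - ?f k)"
      have \<delta>: "?\<delta> \<le> C * window_tail l" by (rule wnorm_diff_truncated_symbol[OF C(2)])
      have \<delta>': "wnorm (\<lambda>k. ?f k - f k) = ?\<delta>" by (simp add: wnorm_def norm_minus_commute)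
      \<comment> \<open>The full symbol counts as a perturbation of itself with error 0, so the same
        two facts cover both directions of the gap.\<close>
      have \<delta>0: "wnorm (\<lambda>k. f k - f k) \<le> \<eta>" using \<open>0 < \<eta>\<close> by (simp add: wnorm_def)
      have ec: "embedded_center rm rp V W T E \<epsilon> l \<theta> = truncate_to_window l ` {u. ?P u \<and> (\<exists>C. bounded_by C u)}"
        unfolding f_def by (rule embedded_center_eq)
      have cb: "center_bundle \<xi> rm rp V W T E \<epsilon> \<theta> = {u. (\<exists>C. bounded_by C u) \<and> ?Q u}"
        unfolding center_bundle_eq f_def
        by (rule Collect_cong, rule conj_cong[OF refl], erule exE, rule L_op_eigen_iff[OF wV])
      have "gap \<xi> (embedded_center rm rp V W T E \<epsilon> l \<theta>) (center_bundle \<xi> rm rp V W T E \<epsilon> \<theta>)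
          \<le> ennreal (K * ?\<delta> * D * weight_sum + D * window_tail l)"
        unfolding ec cb
      proof (rule gap_truncation_le[OF _ _ _ _ large(2)])
        show "bounded_by D u" if "bounded_by C u" "?P u" "\<And>j. j < d \<Longrightarrow> cmod (u (int j)) \<le> exp (\<xi> * d)" for u C
          unfolding D_def using that p \<delta> large(3)
          by (intro apriori[of ?f ?p]) (auto intro: wsummable_truncated_symbol)
        show "bounded_by D u" if "bounded_by C u" "?Q u" "\<And>j. j < d \<Longrightarrow> cmod (u (int j)) \<le> exp (\<xi> * d)" for u C
          unfolding D_def using that p \<delta>0 wf by (intro apriori[of f ?p]) auto
        show "\<exists>w. ?Q w \<and> bounded_by (K * ?\<delta> * D) (\<lambda>n. w n - u n)" if "bounded_by D u" "?P u" for u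
          using perturb[OF wsummable_truncated_symbol wf \<delta>0 p that] unfolding \<delta>' .
        show "\<exists>w. ?P w \<and> bounded_by (K * ?\<delta> * D) (\<lambda>n. w n - u n)" if "bounded_by D u" "?Q u" for u
          using perturb[OF wf wsummable_truncated_symbol order_trans[OF \<delta> large(3)] p that] .
      qed
      also have "\<dots> \<le> ennreal (b l)"
        unfolding b_def using \<open>0 \<le> K\<close> \<open>0 \<le> weight_sum\<close> \<delta>
        by (intro ennreal_leI add_right_mono mult_right_mono mult_left_mono) (auto simp: D_def)
      finally show ?thesis .
    qed
    \<comment> \<open>l \<ge> 1 for the companion matrix, l \<ge> d to see the initial values in the
      window, and a small tail so that the truncated symbol is within \<eta> of
      \<open>f\<close>.\<close>
    have ev: "\<forall>\<^sub>F l in sequentially. 1 \<le> l \<and> d \<le> l \<and> C * window_tail l \<le> \<eta>"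
    proof (intro eventually_conj eventually_ge_at_top)
      have "(\<lambda>l. C * window_tail l) \<longlonglongrightarrow> C * 0"
        by (intro tendsto_intros window_tail_tendsto)
      then have "\<forall>\<^sub>F l in sequentially. C * window_tail l < \<eta>"
        using \<open>0 < \<eta>\<close> by (intro order_tendstoD(2)) auto
      then show "\<forall>\<^sub>F l in sequentially. C * window_tail l \<le> \<eta>"
        by (rule eventually_mono) simp
    qed
    let ?F = "inf sequentially (principal {l. fourier_coeff V (int l) \<noteq> 0})"
    show "((\<lambda>l. SUP \<theta>. gap \<xi> (embedded_center rm rp V W T E \<epsilon> l \<theta>) (center_bundle \<xi> rm rp V W T E \<epsilon> \<theta>))
       \<longlongrightarrow> 0) ?F"
    proof (rule tendsto_sandwich[of "\<lambda>_. 0" _ _ "\<lambda>l. ennreal (b l)"])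
      show "\<forall>\<^sub>F l in ?F. (SUP \<theta>. gap \<xi> (embedded_center rm rp V W T E \<epsilon> l \<theta>) (center_bundle \<xi> rm rp V W T E \<epsilon> \<theta>))
          \<le> ennreal (b l)"
        unfolding eventually_inf_principal using ev
        by (rule eventually_mono) (auto intro!: SUP_least gap_le)
      have "(\<lambda>l. ennreal (b l)) \<longlonglongrightarrow> ennreal 0"
        using b_lim by (rule tendsto_ennrealI)
      then show "((\<lambda>l. ennreal (b l)) \<longlongrightarrow> 0) ?F"
        by (intro tendsto_mono[OF inf_le1]) simp
    qed auto
  qed
qed

end
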